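(* Let $k$ be an algebraically closed field of characteristic zero and let $\gamma=(\Gamma,\sigma)$ be a $(k[x],x)$-labelled tree. The Danielewski surface $S(\gamma)$ has a trivial Makar-Limanov invariant (that is, $\mathrm{ML}(S(\gamma))=k$) if and only if $\gamma$ is a comb, i.e. a labelled tree $\gamma=(\Gamma,\sigma)$ with the property that all but at most one of the direct descendants (children) of any given $e\in\Gamma$ are terminal elements (leaves) of $\Gamma$.
   Context: Trees. A (rooted) tree $\Gamma$ is a nonempty finite poset with a unique minimal element $e_0$ (the root) such that $(\downarrow e)_\Gamma=\{e'\in\Gamma: e'\le e\}$ is a chain for every $e\in\Gamma$. The length of a chain $C$ is $\mathrm{Card}(C)-1$; $e$ is at level $m$ if $(\downarrow e)_\Gamma$ has length $m$. The leaves (terminal elements) of $\Gamma$ are its maximal elements. The children (direct descendants) of a non-leaf $e$ are the minimal elements of $\{e'\in\Gamma: e'>e\}$. The first common ancestor of $e,e'\in\Gamma\setminus\{e_0\}$ is the maximal element of the chain $((\downarrow e)_\Gamma\setminus\{e\})\cap((\downarrow e')_\Gamma\setminus\{e'\})$. Labelled trees. A $(k[x],x)$-labelled tree is a pair $\gamma=(\Gamma,\sigma)$ of a tree $\Gamma$ with leaves $e_1,\ldots,e_n$ at levels $m_1,\ldots,m_n$ and a cochain $\sigma=(\sigma_i)_{i=1,\ldots,n}\in k[x]^n$ such that for all $i\neq j$, $\sigma_j-\sigma_i\in x^{d_{ij}}k[x]\setminus x^{d_{ij}+1}k[x]$, where $d_{ij}<\min(m_i,m_j)$ is the level of the first common ancestor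 of $e_i$ and $e_j$. The surface $S(\gamma)$. $S(\gamma)$ is the scheme over $X=\mathrm{Spec}(k[x])$ obtained by gluing $n$ copies $\mathrm{Spec}(k[x][T_i])$ of $\mathbb{A}^1_X$, $i=1,\ldots,n$, over $X\setminus\{0\}$ by means of the $k[x]_x$-algebra isomorphisms $k[x]_x[T_i]\to k[x]_x[T_j]$, $T_i\mapsto x^{-m_i}(\sigma_j-\sigma_i)+x^{m_j-m_i}T_j$, $i\ne j$. It is a smooth affine surface (a Danielewski surface). Makar-Limanov invariant. For an affine variety $V=\mathrm{Spec}(B)$ over $k$, $\mathrm{ML}(V)\subset B$ is the subalgebra of regular functions invariant under all actions of the additive group $\mathbb{G}_{a,k}$ on $V$. It is trivial if $\mathrm{ML}(V)=k$. *)

theory Defs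
  imports
    "HOL-Library.FuncSet"
    "HOL-Computational_Algebra.Polynomial_Factorial"
    "HOL-Algebra.UnivPoly"
begin

section \<open>Trees\<close>

text \<open>A finite poset is a carrier set \<open>\<Gamma>\<close> with a relation \<open>r\<close> on it; \<open>(a, b) \<in> r\<close> means \<open>a \<le> b\<close>.\<close>

definition down :: "'e set \<Rightarrow> 'e rel \<Rightarrow> 'e \<Rightarrow> 'e set" where
  "down \<Gamma> r e = {e' \<in> \<Gamma>. (e', e) \<in> r}"

definition rooted_tree :: "'e set \<Rightarrow> 'e rel \<Rightarrow> bool" where
  "rooted_tree \<Gamma> r \<longleftrightarrow>
     finite \<Gamma> \<and> \<Gamma> \<noteq> {} \<and> partial_order_on \<Gamma> r \<and>
     (\<exists>!e0. e0 \<in> \<Gamma> \<and> (\<forall>e\<in>\<Gamma>. (e, e0) \<in> r \<longrightarrow> e = e0)) \<and>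
     (\<forall>e\<in>\<Gamma>. total_on (down \<Gamma> r e) r)"

definition level :: "'e set \<Rightarrow> 'e rel \<Rightarrow> 'e \<Rightarrow> nat" where
  "level \<Gamma> r e = card (down \<Gamma> r e) - 1"

definition leaves :: "'e set \<Rightarrow> 'e rel \<Rightarrow> 'e set" where
  "leaves \<Gamma> r = {e \<in> \<Gamma>. \<forall>e'\<in>\<Gamma>. (e, e') \<in> r \<longrightarrow> e' = e}"

definition children :: "'e set \<Rightarrow> 'e rel \<Rightarrow> 'e \<Rightarrow> 'e set" where
  "children \<Gamma> r e =
     (let A = {e' \<in> \<Gamma>. (e, e') \<in> r \<and> e' \<noteq> e}
      in {c \<in> A. \<forall>c'\<in>A. (c', c) \<in> r \<longrightarrow> c' = c})"

definition first_common_ancestor :: "'e set \<Rightarrow> 'e rel \<Rightarrow> 'e \<Rightarrow> 'e \<Rightarrow> 'e" where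
  "first_common_ancestor \<Gamma> r e e' =
     (let C = (down \<Gamma> r e - {e}) \<inter> (down \<Gamma> r e' - {e'})
      in THE a. a \<in> C \<and> (\<forall>b\<in>C. (a, b) \<in> r \<longrightarrow> b = a))"

definition comb :: "'e set \<Rightarrow> 'e rel \<Rightarrow> bool" where
  "comb \<Gamma> r \<longleftrightarrow> (\<forall>e\<in>\<Gamma>. card {c \<in> children \<Gamma> r e. c \<notin> leaves \<Gamma> r} \<le> 1)"


section \<open>Labelled trees\<close>

text \<open>The cochain is indexed by the leaves themselves; the values of \<open>\<sigma>\<close> elsewhere play no role.
  \<open>[:0, 1:]\<close> is the variable \<open>x\<close> of \<open>k[x]\<close>.\<close>

definition labelled_tree :: "'e set \<Rightarrow> 'e rel \<Rightarrow> ('e \<Rightarrow> 'k::field poly) \<Rightarrow> bool" where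
  "labelled_tree \<Gamma> r \<sigma> \<longleftrightarrow>
     rooted_tree \<Gamma> r \<and>
     (\<forall>i\<in>leaves \<Gamma> r. \<forall>j\<in>leaves \<Gamma> r. i \<noteq> j \<longrightarrow>
        (let d = level \<Gamma> r (first_common_ancestor \<Gamma> r i j)
         in [:0, 1:] ^ d dvd \<sigma> j - \<sigma> i \<and> \<not> [:0, 1:] ^ (d + 1) dvd \<sigma> j - \<sigma> i))"


section \<open>The Danielewski surface of a labelled tree\<close>

text \<open>The image of \<open>T\<^sub>i\<close> under the gluing isomorphism \<open>k[x]\<^sub>x[T\<^sub>i] \<rightarrow> k[x]\<^sub>x[T\<^sub>j]\<close>, namely
  \<open>x\<^bsup>-m\<^sub>i\<^esup>(\<sigma>\<^sub>j - \<sigma>\<^sub>i) + x\<^bsup>m\<^sub>j - m\<^sub>i\<^esup> T\<^sub>j\<close>. The localisation \<open>k[x]\<^sub>x\<close> is taken inside \<open>k(x)\<close>.\<close>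

definition transition ::
  "'e set \<Rightarrow> 'e rel \<Rightarrow> ('e \<Rightarrow> 'k::field poly) \<Rightarrow> 'e \<Rightarrow> 'e \<Rightarrow> 'k poly fract poly" where
  "transition \<Gamma> r \<sigma> i j =
     (let x = to_fract [:0, 1:]; m = (\<lambda>e. int (level \<Gamma> r e))
      in [: x powi (- m i) * to_fract (\<sigma> j - \<sigma> i), x powi (m j - m i) :])"

text \<open>The surface \<open>S(\<gamma>)\<close> is affine, hence is the spectrum of its ring of global functions. A global
  function on the glued scheme is a family of functions \<open>f\<^sub>i \<in> k[x][T\<^sub>i]\<close>, one on each chart, such
  that the gluing isomorphism sends \<open>f\<^sub>i\<close> to \<open>f\<^sub>j\<close> over \<open>x \<noteq> 0\<close>. In \<^typ>\<open>'k poly poly\<close> the inner variable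
  is \<open>x\<close> and the outer one is \<open>T\<^sub>i\<close>.\<close>

definition danielewski_ring ::
  "'e set \<Rightarrow> 'e rel \<Rightarrow> ('e \<Rightarrow> 'k::field poly) \<Rightarrow> ('e \<Rightarrow> 'k poly poly) ring" where
  "danielewski_ring \<Gamma> r \<sigma> =
     (let L = leaves \<Gamma> r in
      \<lparr> carrier = {f \<in> extensional L. \<forall>i\<in>L. \<forall>j\<in>L. i \<noteq> j \<longrightarrow>
                     pcompose (fract_poly (f i)) (transition \<Gamma> r \<sigma> i j) = fract_poly (f j)},
        mult = (\<lambda>f g. \<lambda>i\<in>L. f i * g i),
        one = (\<lambda>i\<in>L. 1),
        zero = (\<lambda>i\<in>L. 0),
        add = (\<lambda>f g. \<lambda>i\<in>L. f i + g i) \<rparr>)"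

definition danielewski_const :: "'e set \<Rightarrow> 'e rel \<Rightarrow> 'k::field \<Rightarrow> 'e \<Rightarrow> 'k poly poly" where
  "danielewski_const \<Gamma> r c = (\<lambda>i\<in>leaves \<Gamma> r. [:[:c:]:])"


section \<open>Additive group actions and the Makar-Limanov invariant\<close>

text \<open>Here \<open>B\<close> is a commutative \<open>k\<close>-algebra with structure homomorphism \<open>\<iota> : k \<rightarrow> B\<close>. An action
  \<open>\<mu> : G\<^sub>a \<times> Spec B \<rightarrow> Spec B\<close> is given by its comorphism \<open>\<phi> : B \<rightarrow> B \<otimes> k[t] = B[t]\<close>, a homomorphism
  of \<open>k\<close>-algebras. The last two conditions are the axioms \<open>\<mu>(0, v) = v\<close> and
  \<open>\<mu>(s, \<mu>(t, v)) = \<mu>(s + t, v)\<close>. The latter is an identity in \<open>B[s,t] = B[s][t]\<close>: on the left \<open>\<phi>\<close>,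
  with parameter \<open>s\<close>, is applied to the coefficients of \<open>\<phi>(b) \<in> B[t]\<close>; on the right \<open>s + t\<close> is
  substituted for the parameter.\<close>

definition ga_action :: "('b, 'm) ring_scheme \<Rightarrow> ('k::field \<Rightarrow> 'b) \<Rightarrow> ('b \<Rightarrow> nat \<Rightarrow> 'b) \<Rightarrow> bool" where
  "ga_action B \<iota> \<phi> \<longleftrightarrow>
     (let Bs = UP B; Bst = UP Bs;
          s = up_ring.monom Bst (up_ring.monom Bs \<one>\<^bsub>B\<^esub> 1) 0;
          t = up_ring.monom Bst \<one>\<^bsub>Bs\<^esub> 1;
          const = (\<lambda>b. up_ring.monom Bst (up_ring.monom Bs b 0) 0)
      in \<phi> \<in> ring_hom B Bs \<and>
         (\<forall>c. \<phi> (\<iota> c) = up_ring.monom Bs (\<iota> c) 0) \<and>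
         (\<forall>b\<in>carrier B. eval B B id \<zero>\<^bsub>B\<^esub> (\<phi> b) = b) \<and>
         (\<forall>b\<in>carrier B.
            eval B Bst (\<lambda>a. up_ring.monom Bst (\<phi> a) 0) t (\<phi> b) =
            eval B Bst const (s \<oplus>\<^bsub>Bst\<^esub> t) (\<phi> b)))"

text \<open>A function \<open>b\<close> is invariant under the action if \<open>b \<circ> \<mu> = b \<circ> pr\<^sub>2\<close>, i.e. \<open>\<phi>(b) = b \<otimes> 1\<close>.\<close>

definition makar_limanov :: "('b, 'm) ring_scheme \<Rightarrow> ('k::field \<Rightarrow> 'b) \<Rightarrow> 'b set" where
  "makar_limanov B \<iota> =
     {b \<in> carrier B. \<forall>\<phi>. ga_action B \<iota> \<phi> \<longrightarrow> \<phi> b = up_ring.monom (UP B) b 0}"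

end

theory Submission
  imports Defs
begin

text \<open>
  A regular function on \<open>S(\<gamma>)\<close> is an element of \<open>k(x)[y]\<close> that becomes a polynomial in \<open>x\<close> and \<open>T\<^sub>i\<close> under
  \<open>y = \<sigma>\<^sub>i + x\<^bsup>m\<^sub>i\<^esup> T\<^sub>i\<close> for every leaf \<open>i\<close>, and \<open>G\<^sub>a\<close>-actions are locally nilpotent derivations. The translations
  \<open>T\<^sub>i \<mapsto> T\<^sub>i + x\<^bsup>N - m\<^sub>i\<^esup> t\<close> have the invariants \<open>k[x]\<close>, so the invariant is trivial if and only if some locally
  nilpotent derivation \<open>\<delta>\<close> moves \<open>x\<close>.

  Let \<open>\<delta> x \<noteq> 0\<close>, and order monomials by the degree in \<open>y\<close> first. Then \<open>\<delta>\<close> shifts the leading exponents of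
  regular functions by a fixed vector \<open>e\<close> wherever a certain linear form \<open>\<rho>\<close> is not zero. Nilpotency forces
  \<open>\<rho>\<close> to be a nonnegative integer on leading exponents, with \<open>\<rho>(e) = -1\<close>. Hence \<open>\<rho>\<close> takes the value 1, and the
  value 0 at two coprime multiples of one vector. On the other hand, by successive blow-ups, \<open>(-P, n)\<close> is a
  leading exponent exactly if \<open>n\<close> roots can be distributed on the tree in such a way that the order of
  vanishing is at least \<open>P\<close> along every leaf. Comparing the values 0 and 1 of \<open>\<rho>\<close> node by node shows that at
  most one child of each node is not a leaf.

  Conversely, a comb has regular functions \<open>z\<close> and \<open>s\<close>, found by walking up its spine, such that every regular
  function is a polynomial in \<open>s\<close>, \<open>z\<close> and \<open>1/z\<close>. Then \<open>z\<^sup>K \<partial>/\<partial>s\<close> preserves the regular functions for large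
  \<open>K\<close>, and it moves \<open>x\<close>.
\<close>

text \<open>The form \<rho> comes from a logarithmic derivative. Let \<open>c1\<close>,
  \<open>c2\<close> be the coefficients of \<delta> x / x and \<delta> y / y at a common leading
  exponent e = (\<open>e1\<close>, \<open>e2\<close>). Then \<delta> multiplies the leading
  coefficient at exponent (p, n) by p c1 + n c2, and \<rho> is this number divided by minus its
  value at e. Iteration of \<delta> from x and from y meets a zero multiplier after B and A steps,
  so \<rho>(p, n) = p B + n A, and \<rho>(e) = -1 is a Bezout relation for the entries of e. In the
  coordinates (P, n) = (-p, n) the two stopping points are the multiples e2 and -e1 of (A, B). Their
  coprimality turns the rational densities of roots at the children of a node into integers, without
  which the defect 1 could be shared among several children.

  In the converse the difficulty is to show that s, z and 1/z suffice. The relation x z = \<Prod>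
  p_i helps, where p_i vanishes on the component of x = 0 at the leaf i and vanishes identically on
  no other one: division by x becomes division by one p_i at a time.\<close>

hide_const (open) up_ring.coeff up_ring.monom module.smult Coset.order

section \<open>Rooted trees\<close>

locale rtree =
  fixes \<Gamma> :: "'e set" and r :: "'e rel"
  assumes rooted: "rooted_tree \<Gamma> r"
begin

abbreviation le (infix "\<preceq>" 50) where "a \<preceq> b \<equiv> (a, b) \<in> r"
abbreviation "L \<equiv> leaves \<Gamma> r"
abbreviation "ch \<equiv> children \<Gamma> r"
abbreviation "lev \<equiv> level \<Gamma> r"
abbreviation "fca \<equiv> first_common_ancestor \<Gamma> r"

lemma finite_tree: "finite \<Gamma>"
  using rooted by (simp add: rooted_tree_def)

lemma le_refl: "e \<in> \<Gamma> \<Longrightarrow> e \<preceq> e"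
  using rooted by (auto simp: rooted_tree_def partial_order_on_def preorder_on_def refl_on_def)

lemma le_antisym: "a \<preceq> b \<Longrightarrow> b \<preceq> a \<Longrightarrow> a = b"
  using rooted by (auto simp: rooted_tree_def partial_order_on_def antisym_def)

lemma le_trans: "a \<preceq> b \<Longrightarrow> b \<preceq> c \<Longrightarrow> a \<preceq> c"
  using rooted unfolding rooted_tree_def partial_order_on_def preorder_on_def trans_def by blast

lemma le_carrier: "a \<preceq> b \<Longrightarrow> a \<in> \<Gamma> \<and> b \<in> \<Gamma>"
  using rooted unfolding rooted_tree_def partial_order_on_def preorder_on_def refl_on_def by blast

lemma le_linear: "a \<preceq> e \<Longrightarrow> b \<preceq> e \<Longrightarrow> a \<preceq> b \<or> b \<preceq> a"
proof -
  assume ab: "a \<preceq> e" "b \<preceq> e"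
  then have "total_on (down \<Gamma> r e) r" "a \<in> down \<Gamma> r e" "b \<in> down \<Gamma> r e"
    using rooted le_carrier by (auto simp: rooted_tree_def down_def)
  then show ?thesis
    using le_refl le_carrier ab unfolding total_on_def by metis
qed

lemma finite_min: "M \<noteq> {} \<Longrightarrow> M \<subseteq> \<Gamma> \<Longrightarrow> \<exists>a\<in>M. \<forall>b\<in>M. b \<preceq> a \<longrightarrow> b = a"
  and finite_max: "M \<noteq> {} \<Longrightarrow> M \<subseteq> \<Gamma> \<Longrightarrow> \<exists>a\<in>M. \<forall>b\<in>M. a \<preceq> b \<longrightarrow> b = a"
proof -
  assume M: "M \<noteq> {}" "M \<subseteq> \<Gamma>"
  define R where "R a b \<longleftrightarrow> a \<preceq> b \<and> a \<noteq> b" for a b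
  have fin: "finite M" using M(2) finite_tree by (rule finite_subset)
  have R: "transp_on M R"
    by (rule transp_onI) (auto simp: R_def dest: le_antisym intro: le_trans)
  have R': "asymp_on M R"
    by (rule asymp_onI) (auto simp: R_def dest: le_antisym)
  show "\<exists>a\<in>M. \<forall>b\<in>M. b \<preceq> a \<longrightarrow> b = a"
    using Finite_Set.bex_min_element[OF fin R' R M(1)] by (auto simp: R_def)
  show "\<exists>a\<in>M. \<forall>b\<in>M. a \<preceq> b \<longrightarrow> b = a"
    using Finite_Set.bex_max_element[OF fin R' R M(1)] by (auto simp: R_def)
qed

definition root where
  "root = (THE e0. e0 \<in> \<Gamma> \<and> (\<forall>e\<in>\<Gamma>. e \<preceq> e0 \<longrightarrow> e = e0))"

lemma ex1_root: "\<exists>!e0. e0 \<in> \<Gamma> \<and> (\<forall>e\<in>\<Gamma>. e \<preceq> e0 \<longrightarrow> e = e0)"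
  using rooted by (simp add: rooted_tree_def)

lemma root_in: "root \<in> \<Gamma>" and root_minimal: "e \<preceq> root \<Longrightarrow> e = root"
  using theI'[OF ex1_root] le_carrier unfolding root_def by blast+

lemma root_le:
  assumes "e \<in> \<Gamma>"
  shows "root \<preceq> e"
proof -
  obtain a where a: "a \<in> down \<Gamma> r e" "\<forall>b\<in>down \<Gamma> r e. b \<preceq> a \<longrightarrow> b = a"
    using finite_min[of "down \<Gamma> r e"] assms le_refl by (fastforce simp: down_def)
  then have "a \<in> \<Gamma> \<and> (\<forall>b\<in>\<Gamma>. b \<preceq> a \<longrightarrow> b = a)"
    using le_trans by (fastforce simp: down_def)
  then have "a = root"
    using ex1_root root_in root_minimal by blast
  with a(1) show ?thesis by (simp add: down_def)
qed

lemma childD: "c \<in> ch e \<Longrightarrow> e \<preceq> c" "c \<in> ch e \<Longrightarrow> c \<in> \<Gamma>" "c \<in> ch e \<Longrightarrow> c \<noteq> e"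
  by (auto simp: children_def Let_def)

lemma child_minimal: "c \<in> ch e \<Longrightarrow> e \<preceq> c' \<Longrightarrow> c' \<noteq> e \<Longrightarrow> c' \<preceq> c \<Longrightarrow> c' = c"
  by (auto simp: children_def Let_def dest: le_carrier)

lemma child_above:
  assumes "e \<preceq> e'" "e \<noteq> e'"
  obtains c where "c \<in> ch e" "c \<preceq> e'"
proof -
  let ?M = "{c. e \<preceq> c \<and> c \<noteq> e \<and> c \<preceq> e'}"
  have M: "?M \<noteq> {}" "?M \<subseteq> \<Gamma>"
    using assms le_carrier le_refl by blast+
  obtain c where c: "c \<in> ?M" "\<forall>b\<in>?M. b \<preceq> c \<longrightarrow> b = c"
    using bexE[OF finite_min[OF M]] .
  then have "c \<in> ch e"
    using le_carrier le_trans unfolding children_def Let_def by blast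
  with c that show ?thesis by blast
qed

lemma child_unique:
  assumes "c \<in> ch e" "c' \<in> ch e" "c \<preceq> i" "c' \<preceq> i"
  shows "c = c'"
  using le_linear[OF assms(3,4)] child_minimal childD assms by metis

lemma finite_ch: "finite (ch e)"
  using finite_tree by (rule finite_subset[rotated]) (auto simp: childD)

lemma down_child:
  assumes "c \<in> ch e"
  shows "down \<Gamma> r c = insert c (down \<Gamma> r e)"
proof -
  have "a \<preceq> e" if "a \<preceq> c" "a \<noteq> c" for a
    using le_linear[OF that(1) childD(1)[OF assms]] child_minimal[OF assms] that le_refl childD le_carrier
    by metis
  then show ?thesis
    using childD[OF assms] le_refl le_trans le_carrier by (auto simp: down_def)
qed

lemma card_down: "e \<in> \<Gamma> \<Longrightarrow> card (down \<Gamma> r e) = Suc (lev e)"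
proof -
  assume "e \<in> \<Gamma>"
  then have "card (down \<Gamma> r e) > 0"
    using finite_tree le_refl by (subst card_gt_0_iff) (auto simp: down_def)
  then show ?thesis by (simp add: level_def)
qed

lemma level_child:
  assumes "c \<in> ch e"
  shows "lev c = Suc (lev e)"
proof -
  have "finite (down \<Gamma> r e)" using finite_tree by (simp add: down_def)
  moreover have "c \<notin> down \<Gamma> r e"
    using childD[OF assms] le_antisym by (auto simp: down_def)
  ultimately have "card (down \<Gamma> r c) = Suc (card (down \<Gamma> r e))"
    by (simp add: down_child[OF assms])
  then show ?thesis
    using card_down childD[OF assms] le_carrier by (metis Suc_inject)
qed

lemma level_root: "lev root = 0"
proof -
  have "down \<Gamma> r root = {root}"
    using root_in root_minimal le_refl by (auto simp: down_def)
  then show ?thesis by (simp add: level_def)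
qed

lemma level_mono:
  assumes "a \<preceq> b"
  shows "lev a \<le> lev b"
proof -
  have "down \<Gamma> r a \<subseteq> down \<Gamma> r b" using assms le_trans by (auto simp: down_def)
  then have "card (down \<Gamma> r a) \<le> card (down \<Gamma> r b)"
    using finite_tree by (intro card_mono) (auto simp: down_def)
  then show ?thesis by (simp add: level_def)
qed

lemma level_strict_mono: "a \<preceq> b \<Longrightarrow> a \<noteq> b \<Longrightarrow> lev a < lev b"
  by (metis child_above level_child level_mono less_eq_Suc_le)

lemma tree_bottom_up [consumes 1, case_names node]:
  assumes "e \<in> \<Gamma>" "\<And>e. e \<in> \<Gamma> \<Longrightarrow> (\<And>c. c \<in> ch e \<Longrightarrow> P c) \<Longrightarrow> P e"
  shows "P e"
  using assms(1)
proof (induction "card {y \<in> \<Gamma>. e \<preceq> y}" arbitrary: e rule: less_induct)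
  case less
  have "P c" if c: "c \<in> ch e" for c
  proof (rule less(1))
    have "{y \<in> \<Gamma>. c \<preceq> y} \<subset> {y \<in> \<Gamma>. e \<preceq> y}"
      using childD[OF c] le_trans le_antisym le_refl less(2) by blast
    then show "card {y \<in> \<Gamma>. c \<preceq> y} < card {y \<in> \<Gamma>. e \<preceq> y}"
      using finite_tree by (intro psubset_card_mono) auto
  qed (use childD c in auto)
  with less(2) assms(2) show ?case by blast
qed

lemma tree_top_down [consumes 1, case_names root child]:
  assumes "e \<in> \<Gamma>" "P root" "\<And>e c. e \<in> \<Gamma> \<Longrightarrow> P e \<Longrightarrow> c \<in> ch e \<Longrightarrow> P c"
  shows "P e"
proof -
  have "P a \<longrightarrow> (\<forall>e. a \<preceq> e \<longrightarrow> P e)" if "a \<in> \<Gamma>" for a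
    using that
  proof (induction rule: tree_bottom_up)
    case (node a)
    then show ?case using assms(3) child_above by metis
  qed
  with assms(1,2) root_in root_le show ?thesis by blast
qed

lemma leaf_in: "i \<in> L \<Longrightarrow> i \<in> \<Gamma>"
  by (simp add: leaves_def)

lemma leaf_maximal: "i \<in> L \<Longrightarrow> i \<preceq> e \<Longrightarrow> e = i"
  by (auto simp: leaves_def dest: le_carrier)

lemma finite_L: "finite L"
  using finite_tree by (simp add: leaves_def)

lemma leaf_above:
  assumes "e \<in> \<Gamma>"
  obtains i where "i \<in> L" "e \<preceq> i"
proof -
  have M: "{y. e \<preceq> y} \<noteq> {}" "{y. e \<preceq> y} \<subseteq> \<Gamma>"
    using assms le_carrier le_refl by blast+
  obtain a where a: "a \<in> {y. e \<preceq> y}" "\<forall>b\<in>{y. e \<preceq> y}. a \<preceq> b \<longrightarrow> b = a"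
    using bexE[OF finite_max[OF M]] .
  have ea: "e \<preceq> a" using a(1) by simp
  have "a \<in> L"
    unfolding leaves_def using le_trans[OF ea] le_carrier[OF ea] a(2) by simp
  with ea show ?thesis by (intro that)
qed

lemma leaf_children: "i \<in> L \<Longrightarrow> ch i = {}"
  using leaf_maximal childD by blast

lemma nonleaf_children: "e \<in> \<Gamma> \<Longrightarrow> e \<notin> L \<Longrightarrow> ch e \<noteq> {}"
  by (metis (no_types, lifting) child_above emptyE leaf_above)

lemma L_nonempty: "L \<noteq> {}"
  using leaf_above root_in by blast

text \<open>Distinct leaves are incomparable, so removing the two endpoints loses no common lower
  bound; inside the chain below \<open>i\<close> a maximal common lower bound is the greatest
  one.\<close>

lemma fca_props:
  assumes "i \<in> L" "j \<in> L" "i \<noteq> j"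
  shows fca_le1: "fca i j \<preceq> i" and fca_le2: "fca i j \<preceq> j"
    and fca_greatest: "\<And>e. e \<preceq> i \<Longrightarrow> e \<preceq> j \<Longrightarrow> e \<preceq> fca i j"
    and fca_ne: "fca i j \<noteq> i" "fca i j \<noteq> j"
proof -
  let ?C = "(down \<Gamma> r i - {i}) \<inter> (down \<Gamma> r j - {j})"
  have C: "?C = {e. e \<preceq> i \<and> e \<preceq> j}"
    unfolding down_def using assms leaf_maximal le_carrier by blast
  have "root \<in> ?C" unfolding C using assms root_le leaf_in by auto
  then obtain a where a: "a \<in> ?C" "\<forall>b\<in>?C. a \<preceq> b \<longrightarrow> b = a"
    using finite_max[of ?C] by (auto simp: down_def)
  have gt: "e \<preceq> a" if "e \<in> ?C" for e
    using le_linear[of e i a] a that unfolding C by blast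
  have "fca i j = a"
    unfolding first_common_ancestor_def Let_def
  proof (rule the_equality)
    show "b = a" if "b \<in> ?C \<and> (\<forall>c\<in>?C. b \<preceq> c \<longrightarrow> c = b)" for b
      using that gt a by blast
  qed (use a in blast)
  with a(1) gt show f: "fca i j \<preceq> i" "fca i j \<preceq> j" "\<And>e. e \<preceq> i \<Longrightarrow> e \<preceq> j \<Longrightarrow> e \<preceq> fca i j"
    unfolding C by blast+
  show "fca i j \<noteq> i" "fca i j \<noteq> j"
    using f(1,2) leaf_maximal[OF assms(1)] leaf_maximal[OF assms(2)] assms(3) by metis+
qed

lemma fca_children:
  assumes "i \<in> L" "j \<in> L" "c \<in> ch e" "c' \<in> ch e" "c \<noteq> c'" "c \<preceq> i" "c' \<preceq> j"
  shows "i \<noteq> j" "fca i j = e"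
proof -
  show ij: "i \<noteq> j" using child_unique assms by blast
  have e: "e \<preceq> fca i j"
    using fca_greatest[OF assms(1,2) ij] childD assms le_trans by blast
  show "fca i j = e"
  proof (rule ccontr)
    assume "fca i j \<noteq> e"
    then obtain d where d: "d \<in> ch e" "d \<preceq> fca i j" using e child_above by metis
    then have "d = c" "d = c'"
      using child_unique assms fca_le1[OF assms(1,2) ij] fca_le2[OF assms(1,2) ij] le_trans by blast+
    with assms show False by blast
  qed
qed

end

locale labelled = rtree \<Gamma> r for \<Gamma> :: "'e set" and r +
  fixes \<sigma> :: "'e \<Rightarrow> 'k::field_char_0 poly"
  assumes labelled: "labelled_tree \<Gamma> r \<sigma>"
begin

lemma label_dvd:
  assumes "i \<in> L" "j \<in> L" "e \<preceq> i" "e \<preceq> j"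
  shows "[:0, 1:] ^ lev e dvd \<sigma> j - \<sigma> i"
proof (cases "i = j")
  case False
  then have "[:0, 1:] ^ lev (fca i j) dvd \<sigma> j - \<sigma> i"
    using labelled assms by (auto simp: labelled_tree_def Let_def)
  moreover have "lev e \<le> lev (fca i j)"
    using fca_greatest assms False level_mono by blast
  ultimately show ?thesis using power_le_dvd by blast
qed simp

lemma label_not_dvd:
  assumes "i \<in> L" "j \<in> L" "c \<in> ch e" "c' \<in> ch e" "c \<noteq> c'" "c \<preceq> i" "c' \<preceq> j"
  shows "\<not> [:0, 1:] ^ Suc (lev e) dvd \<sigma> j - \<sigma> i"
  using labelled fca_children[OF assms] assms by (auto simp: labelled_tree_def Let_def)

text \<open>If the child towards \<open>i\<close> at the branching node were not a leaf, the comb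
  condition would make the child towards \<open>i0\<close> a leaf, hence equal to \<open>i0\<close>,
  and \<open>i\<close> would have a larger level than \<open>i0\<close>. So the path to a leaf of
  maximal level is a spine from which all other leaves hang directly.\<close>

lemma comb_leaf_structure:
  assumes "comb \<Gamma> r" "i0 \<in> L" "\<And>i. i \<in> L \<Longrightarrow> lev i \<le> lev i0" "i \<in> L" "i \<noteq> i0"
  obtains e where "i \<in> ch e" "e \<preceq> i0" "e \<noteq> i0"
proof -
  define e where "e = fca i i0"
  note f = fca_le1[OF assms(4,2,5)] fca_le2[OF assms(4,2,5)] fca_ne[OF assms(4,2,5)]
  obtain c where c: "c \<in> ch e" "c \<preceq> i" using f child_above unfolding e_def by metis
  obtain c' where c': "c' \<in> ch e" "c' \<preceq> i0" using f child_above unfolding e_def by metis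
  have ne: "c \<noteq> c'"
  proof
    assume "c = c'"
    then have "c \<preceq> e" using c c' fca_greatest[OF assms(4,2,5)] unfolding e_def by blast
    then show False using childD[OF c(1)] le_antisym by blast
  qed
  have "c \<in> L"
  proof (rule ccontr)
    assume nl: "c \<notin> L"
    have "card {d \<in> ch e. d \<notin> L} \<le> 1"
      using assms(1) f le_carrier unfolding comb_def e_def by blast
    then have "c' \<in> L"
      using nl ne c(1) c'(1) finite_ch[of e] by (auto simp: card_le_Suc0_iff_eq)
    then have "i0 = c'" using c' leaf_maximal by blast
    moreover have "c \<noteq> i" using nl assms(4) by blast
    then have "lev c < lev i" using level_strict_mono c by blast
    ultimately show False
      using assms(3)[OF assms(4)] level_child[OF c(1)] level_child[OF c'(1)] by simp
  qed
  then have "i = c" using c leaf_maximal by blast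
  with c f that[of e] show ?thesis unfolding e_def by blast
qed

end

section \<open>Additive group actions and locally nilpotent derivations\<close>

text \<open>Identities in a ring with carrier are to be checked in an integral domain given as a
  type, where the polynomial library applies; \<open>E\<close> transports them.\<close>

locale ring_emb = cring B for B :: "('b, 'm) ring_scheme" (structure) +
  fixes E :: "'b \<Rightarrow> 'r::idom"
  assumes E_inj: "inj_on E (carrier B)"
    and E_add: "\<And>a b. a \<in> carrier B \<Longrightarrow> b \<in> carrier B \<Longrightarrow> E (a \<oplus> b) = E a + E b"
    and E_mult: "\<And>a b. a \<in> carrier B \<Longrightarrow> b \<in> carrier B \<Longrightarrow> E (a \<otimes> b) = E a * E b"
    and E_zero: "E \<zero> = 0" and E_one: "E \<one> = 1"
begin

lemma E_eq_iff: "a \<in> carrier B \<Longrightarrow> b \<in> carrier B \<Longrightarrow> E a = E b \<longleftrightarrow> a = b"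
  using E_inj by (auto simp: inj_on_def)

lemma E_finsum:
  assumes "finite I" "f \<in> I \<rightarrow> carrier B"
  shows "E (finsum B f I) = (\<Sum>i\<in>I. E (f i))"
  using assms
proof (induction I rule: finite_induct)
  case (insert i I)
  then have "finsum B f (insert i I) = f i \<oplus> finsum B f I"
    by (intro finsum_insert) auto
  with insert show ?case by (simp add: E_add)
qed (simp add: E_zero)

lemma E_pow: "a \<in> carrier B \<Longrightarrow> E (a [^] (n::nat)) = E a ^ n"
  by (induction n) (simp_all add: E_one E_mult mult.commute)

definition EU :: "(nat \<Rightarrow> 'b) \<Rightarrow> 'r poly" where
  "EU p = Abs_poly (\<lambda>n. E (p n))"

lemma UP_cring: "cring (UP B)"
proof -
  interpret UP_cring B "UP B" by unfold_locales simp_all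
  show ?thesis by (rule UP_cring)
qed

lemma carrier_UP: "carrier (UP B) = up B"
  by (simp add: UP_def)

lemma coeff_EU:
  assumes "p \<in> up B"
  shows "coeff (EU p) n = E (p n)"
proof -
  obtain N where "bound \<zero> N p" using assms bound_upD by blast
  then have "\<And>i. i > N \<Longrightarrow> E (p i) = 0" by (metis bound.bound E_zero)
  then show ?thesis unfolding EU_def by (subst coeff_Abs_poly[of N]) auto
qed

lemma monom_UP_eq: "a \<in> carrier B \<Longrightarrow> up_ring.monom (UP B) a n = (\<lambda>i. if i = n then a else \<zero>)"
  by (simp add: UP_def)

lemma monom_closed: "a \<in> carrier B \<Longrightarrow> up_ring.monom (UP B) a n \<in> up B"
  by (auto simp: monom_UP_eq up_def)

lemma EU_monom: "a \<in> carrier B \<Longrightarrow> EU (up_ring.monom (UP B) a n) = Polynomial.monom (E a) n"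
  by (rule poly_eqI) (subst coeff_EU[OF monom_closed], auto simp: monom_UP_eq E_zero)

text \<open>The embedding passes to polynomial rings and can thus be iterated; two rounds reach
  B[s][t], where the associativity of an action is stated.\<close>

lemma ring_emb_UP: "ring_emb (UP B) EU"
proof (intro ring_emb.intro ring_emb_axioms.intro)
  show "inj_on EU (carrier (UP B))"
  proof (rule inj_onI)
    fix p q assume pq: "p \<in> carrier (UP B)" "q \<in> carrier (UP B)" "EU p = EU q"
    then have "E (p n) = E (q n)" for n by (metis coeff_EU carrier_UP)
    with pq show "p = q" by (intro ext) (auto simp: carrier_UP E_eq_iff mem_upD)
  qed
  show "EU (p \<oplus>\<^bsub>UP B\<^esub> q) = EU p + EU q" if "p \<in> carrier (UP B)" "q \<in> carrier (UP B)" for p q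
  proof (rule poly_eqI)
    fix n
    have "(\<lambda>i. p i \<oplus> q i) \<in> up B" using that up_add_closed by (simp add: carrier_UP)
    with that show "coeff (EU (p \<oplus>\<^bsub>UP B\<^esub> q)) n = coeff (EU p + EU q) n"
      by (simp add: carrier_UP coeff_EU UP_def E_add mem_upD)
  qed
  show "EU (p \<otimes>\<^bsub>UP B\<^esub> q) = EU p * EU q" if "p \<in> carrier (UP B)" "q \<in> carrier (UP B)" for p q
  proof (rule poly_eqI)
    fix n
    have "(\<lambda>n. \<Oplus>i\<in>{..n}. p i \<otimes> q (n - i)) \<in> up B"
      using that up_mult_closed by (simp add: carrier_UP)
    with that show "coeff (EU (p \<otimes>\<^bsub>UP B\<^esub> q)) n = coeff (EU p * EU q) n"
      by (simp add: carrier_UP coeff_EU UP_def E_mult E_finsum mem_upD coeff_mult)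
  qed
  show "EU \<zero>\<^bsub>UP B\<^esub> = 0"
    by (rule poly_eqI) (use UP_cring in \<open>simp add: UP_def coeff_EU up_def bound_def E_zero Pi_def\<close>)
  show "EU \<one>\<^bsub>UP B\<^esub> = 1"
    by (rule poly_eqI) (simp add: UP_def coeff_EU up_one_closed E_zero E_one)
qed (rule UP_cring)

lemma deg_above: "p \<in> up B \<Longrightarrow> deg B p < n \<Longrightarrow> p n = \<zero>"
proof -
  assume p: "p \<in> up B" "deg B p < n"
  interpret U: UP_ring B "UP B" by unfold_locales simp_all
  show ?thesis using U.deg_aboveD[of p n] p by (simp add: UP_def)
qed

lemma E_eval:
  assumes "ring_emb S E'" "p \<in> up B" "\<And>a. a \<in> carrier B \<Longrightarrow> h a \<in> carrier S" "s \<in> carrier S"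
  shows "E' (eval B S h s p) = (\<Sum>i\<le>deg B p. E' (h (p i)) * E' s ^ i)"
proof -
  interpret S: ring_emb S E' by fact
  have c: "p i \<in> carrier B" for i using assms(2) by auto
  have "E' (eval B S h s p) = E' (\<Oplus>\<^bsub>S\<^esub>i\<in>{..deg B p}. h (p i) \<otimes>\<^bsub>S\<^esub> s [^]\<^bsub>S\<^esub> i)"
    using assms(2) by (simp add: eval_def UP_def)
  also have "\<dots> = (\<Sum>i\<le>deg B p. E' (h (p i) \<otimes>\<^bsub>S\<^esub> s [^]\<^bsub>S\<^esub> i))"
    by (intro S.E_finsum) (use assms c in auto)
  also have "\<dots> = (\<Sum>i\<le>deg B p. E' (h (p i)) * E' s ^ i)"
    by (intro sum.cong refl) (use assms c in \<open>simp add: S.E_mult S.E_pow\<close>)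
  finally show ?thesis .
qed

lemma eval_closed:
  assumes "cring S" "p \<in> up B" "\<And>a. a \<in> carrier B \<Longrightarrow> h a \<in> carrier S" "s \<in> carrier S"
  shows "eval B S h s p \<in> carrier S"
proof -
  interpret S: cring S by fact
  have c: "p i \<in> carrier B" for i using assms(2) by auto
  have "eval B S h s p = (\<Oplus>\<^bsub>S\<^esub>i\<in>{..deg B p}. h (p i) \<otimes>\<^bsub>S\<^esub> s [^]\<^bsub>S\<^esub> i)"
    using assms(2) by (simp add: eval_def UP_def)
  also have "\<dots> \<in> carrier S"
    by (intro S.finsum_closed) (use assms c in auto)
  finally show ?thesis .
qed

lemma eval_zero_iff:
  assumes "p \<in> up B" "b \<in> carrier B"
  shows "eval B B id \<zero> p = b \<longleftrightarrow> p 0 = b"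
proof -
  have e: "E (eval B B id \<zero> p) = E (p 0)"
    by (subst E_eval[OF ring_emb_axioms])
      (use assms in \<open>auto simp: E_zero power_0_left sum.atMost_shift\<close>)
  have "eval B B id \<zero> p \<in> carrier B"
    by (rule eval_closed) (use assms is_cring in auto)
  with e assms show ?thesis by (metis E_eq_iff mem_upD)
qed

end

lemma coeff_const_mult_var_power:
  "coeff (\<Sum>n\<le>d. smult (f n) ([:0, 1:] ^ n)) i = (if i \<le> d then f i else (0::'a::comm_ring_1))"
proof -
  have "smult (f n) ([:0, 1:] ^ n) = Polynomial.monom (f n) n" for n
    by (simp add: monom_altdef)
  then show ?thesis by (simp add: coeff_sum)
qed

text \<open>The binomial theorem for (s + t)^n, with s the inner and t the outer variable.\<close>

lemma coeff_sum_var_power: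
  "coeff (coeff (([:[:0, 1:]:] + [:0, 1:]) ^ n) i) j
    = (if i + j = n then of_nat (n choose i) else (0::'a::comm_ring_1))"
proof -
  have "[:[:0, 1:]:] + [:0, 1:] = [:[:0, 1::'a:], 1:]" by simp
  then have "coeff (([:[:0, 1:]:] + [:0, 1:]) ^ n) i = (of_nat (n choose i) * [:0, 1::'a:] ^ (n - i))" if "i \<le> n"
    using that by (simp add: coeff_linear_poly_power)
  moreover have "degree ([:[:0, 1::'a:], 1:] ^ n) \<le> n"
    using degree_power_le[of "[:[:0, 1::'a:], 1:]" n] by simp
  then have "coeff (([:[:0, 1:]:] + [:0, 1::'a poly:]) ^ n) i = 0" if "n < i"
    using that by (simp add: coeff_eq_0)
  moreover have "of_nat k * [:0, 1::'a:] ^ m = Polynomial.monom (of_nat k) m" for k m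
    by (simp add: monom_altdef of_nat_poly)
  ultimately show ?thesis by (cases "i \<le> n") auto
qed

section \<open>The action axioms in terms of coefficients\<close>

context ring_emb
begin

text \<open>With D_n(b) the coefficient \<open>\<phi> b n\<close>, comparison of the coefficients of
  t^i s^j turns associativity into D_j D_i = binom(i + j, i) D_(i+j). In characteristic zero D_1
  then determines all D_n.\<close>

lemma ga_action_iff:
  fixes \<iota> :: "'k::field \<Rightarrow> 'b"
  assumes \<iota>: "\<And>c. \<iota> c \<in> carrier B"
  shows "ga_action B \<iota> \<phi> \<longleftrightarrow> \<phi> \<in> ring_hom B (UP B) \<and> (\<forall>c. \<phi> (\<iota> c) = up_ring.monom (UP B) (\<iota> c) 0) \<and>
    (\<forall>b\<in>carrier B. \<phi> b 0 = b) \<and>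
    (\<forall>b\<in>carrier B. \<forall>i j. E (\<phi> (\<phi> b i) j) = of_nat (i + j choose i) * E (\<phi> b (i + j)))"
proof (cases "\<phi> \<in> ring_hom B (UP B)")
  case hom: True
  let ?Bs = "UP B" and ?Bst = "UP (UP B)"
  interpret U: ring_emb "UP B" EU by (rule ring_emb_UP)
  interpret V: ring_emb "UP (UP B)" U.EU by (rule U.ring_emb_UP)
  have cl: "\<phi> b \<in> up B" if "b \<in> carrier B" for b
    using hom that by (auto simp: ring_hom_def carrier_UP)
  have cl': "\<phi> b i \<in> carrier B" if "b \<in> carrier B" for b i
    using cl[OF that] by auto
  have \<phi>0: "\<phi> \<zero> i = \<zero>" for i
    using ring_hom_zero[OF hom ring_axioms U.ring_axioms] by (simp add: UP_def)
  define s where "s = up_ring.monom ?Bst (up_ring.monom ?Bs \<one> 1) 0"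
  define t where "t = up_ring.monom ?Bst \<one>\<^bsub>?Bs\<^esub> 1"
  define const where "const = (\<lambda>b. up_ring.monom ?Bst (up_ring.monom ?Bs b 0) 0)"
  have sc: "s \<in> carrier ?Bst" and tc: "t \<in> carrier ?Bst"
    unfolding s_def t_def by (auto simp: U.carrier_UP carrier_UP intro!: U.monom_closed monom_closed)
  have Es: "U.EU s = [:[:0, 1:]:]" and Et: "U.EU t = [:0, 1:]"
    unfolding s_def t_def
    by (simp_all add: U.EU_monom[OF U.one_closed] U.EU_monom EU_monom monom_closed carrier_UP E_one
        U.E_one monom_0 monom_altdef del: One_nat_def)
  have cc: "const a \<in> carrier ?Bst" if "a \<in> carrier B" for a
    unfolding const_def using that by (simp add: U.carrier_UP carrier_UP U.monom_closed monom_closed)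
  have Ec: "U.EU (const a) = [:[:E a:]:]" if "a \<in> carrier B" for a
    unfolding const_def using that by (simp add: U.EU_monom EU_monom monom_closed carrier_UP monom_0)
  have mc: "up_ring.monom ?Bst (\<phi> a) 0 \<in> carrier ?Bst" if "a \<in> carrier B" for a
    using that cl by (simp add: U.carrier_UP carrier_UP U.monom_closed)
  have Em: "U.EU (up_ring.monom ?Bst (\<phi> a) 0) = [:EU (\<phi> a):]" if "a \<in> carrier B" for a
    using that cl by (simp add: U.EU_monom carrier_UP monom_0)
  have assoc: "eval B ?Bst (\<lambda>a. up_ring.monom ?Bst (\<phi> a) 0) t (\<phi> b) = eval B ?Bst const (s \<oplus>\<^bsub>?Bst\<^esub> t) (\<phi> b)
      \<longleftrightarrow> (\<forall>i j. E (\<phi> (\<phi> b i) j) = of_nat (i + j choose i) * E (\<phi> b (i + j)))"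
    (is "?l = ?r \<longleftrightarrow> ?rhs") if b: "b \<in> carrier B" for b
  proof -
    let ?d = "deg B (\<phi> b)"
    have c1: "?l \<in> carrier ?Bst" "?r \<in> carrier ?Bst"
      by (auto intro!: eval_closed V.is_cring cl[OF b] mc cc sc tc V.a_closed)
    have "U.EU ?l = (\<Sum>n\<le>?d. smult (EU (\<phi> (\<phi> b n))) ([:0, 1:] ^ n))"
      by (subst E_eval[OF V.ring_emb_axioms]) (use cl[OF b] cl'[OF b] mc tc in \<open>auto simp: Et Em\<close>)
    \<comment> \<open>Beyond the degree of \<open>\<phi> b\<close> the sum has no term, in agreement
      with the value of \<phi> at a zero coefficient.\<close>
    then have l: "coeff (coeff (U.EU ?l) i) j = E (\<phi> (\<phi> b i) j)" for i j
      using cl'[OF b] deg_above[OF cl[OF b], of i] \<phi>0 E_zero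
      by (auto simp: coeff_const_mult_var_power coeff_EU cl)
    have "U.EU ?r = (\<Sum>n\<le>?d. [:[:E (\<phi> b n):]:] * ([:[:0, 1:]:] + [:0, 1:]) ^ n)"
      by (subst E_eval[OF V.ring_emb_axioms])
        (use cl[OF b] cl'[OF b] cc sc tc in \<open>auto simp del: add_pCons simp add: Es Et Ec V.E_add\<close>)
    then have "coeff (coeff (U.EU ?r) i) j
        = (\<Sum>n\<le>?d. E (\<phi> b n) * (if i + j = n then of_nat (n choose i) else 0))" for i j
      by (simp add: coeff_sum coeff_sum_var_power del: add_pCons)
    then have r: "coeff (coeff (U.EU ?r) i) j = of_nat (i + j choose i) * E (\<phi> b (i + j))" for i j
      using deg_above[OF cl[OF b], of "i + j"] E_zero
      by (cases "i + j \<le> deg B (\<phi> b)") (auto simp: if_distrib mult.commute cong: if_cong)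
    have "?l = ?r \<longleftrightarrow> U.EU ?l = U.EU ?r" using c1 V.E_eq_iff by blast
    also have "\<dots> \<longleftrightarrow> ?rhs" unfolding poly_eq_iff l r by blast
    finally show ?thesis .
  qed
  show ?thesis
    unfolding ga_action_def Let_def s_def[symmetric] t_def[symmetric] const_def[symmetric]
    using hom assoc eval_zero_iff cl by (auto simp: id_def)
qed (simp add: ga_action_def Let_def)

end

text \<open>Vanishing on constants together with the product rule amounts to linearity over the
  field when \<open>A\<close> contains the constants.\<close>

definition lnd :: "('k::field_char_0 \<Rightarrow> 'r::comm_ring_1) \<Rightarrow> 'r set \<Rightarrow> ('r \<Rightarrow> 'r) \<Rightarrow> bool" where
  "lnd \<kappa> A \<delta> \<longleftrightarrow> (\<forall>a\<in>A. \<delta> a \<in> A) \<and> (\<forall>a\<in>A. \<forall>b\<in>A. \<delta> (a + b) = \<delta> a + \<delta> b) \<and>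
     (\<forall>a\<in>A. \<forall>b\<in>A. \<delta> (a * b) = \<delta> a * b + a * \<delta> b) \<and> (\<forall>c. \<delta> (\<kappa> c) = 0) \<and>
     (\<forall>a\<in>A. \<exists>n. (\<delta> ^^ n) a = 0)"

lemma
  assumes "lnd \<kappa> A \<delta>"
  shows lnd_closed: "\<And>a. a \<in> A \<Longrightarrow> \<delta> a \<in> A"
    and lnd_add: "\<And>a b. a \<in> A \<Longrightarrow> b \<in> A \<Longrightarrow> \<delta> (a + b) = \<delta> a + \<delta> b"
    and lnd_mult: "\<And>a b. a \<in> A \<Longrightarrow> b \<in> A \<Longrightarrow> \<delta> (a * b) = \<delta> a * b + a * \<delta> b"
    and lnd_const: "\<And>c. \<delta> (\<kappa> c) = 0"
    and lnd_nilpotent: "\<And>a. a \<in> A \<Longrightarrow> \<exists>n. (\<delta> ^^ n) a = 0"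
  using assms by (auto simp: lnd_def)

section \<open>The correspondence between actions and locally nilpotent derivations\<close>

locale algebra_emb = ring_emb B E for B :: "('b, 'm) ring_scheme" (structure) and E :: "'b \<Rightarrow> 'r::idom" +
  fixes \<iota> :: "'k::field_char_0 \<Rightarrow> 'b" and \<kappa> :: "'k \<Rightarrow> 'r"
  assumes \<iota>_closed: "\<iota> c \<in> carrier B" and E_\<iota>: "E (\<iota> c) = \<kappa> c"
    and \<kappa>_add: "\<kappa> (a + b) = \<kappa> a + \<kappa> b" and \<kappa>_mult: "\<kappa> (a * b) = \<kappa> a * \<kappa> b" and \<kappa>_one: "\<kappa> 1 = 1"
begin

abbreviation "A \<equiv> E ` carrier B"

lemma A_add: "a \<in> A \<Longrightarrow> b \<in> A \<Longrightarrow> a + b \<in> A"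
  by (auto simp: E_add[symmetric])

lemma A_mult: "a \<in> A \<Longrightarrow> b \<in> A \<Longrightarrow> a * b \<in> A"
  by (auto simp: E_mult[symmetric])

lemma A_zero: "0 \<in> A" and A_one: "1 \<in> A"
  using imageI[OF zero_closed, of E] imageI[OF one_closed, of E] by (simp_all add: E_zero E_one)

lemma A_const: "\<kappa> c \<in> A"
  by (metis E_\<iota> \<iota>_closed imageI)

lemma \<kappa>_zero: "\<kappa> 0 = 0"
  using \<kappa>_add[of 0 0] by (metis add.right_neutral add_left_cancel)

lemma \<kappa>_of_nat: "\<kappa> (of_nat n) = of_nat n"
  by (induction n) (simp_all add: \<kappa>_zero \<kappa>_add \<kappa>_one)

lemma \<kappa>_inverse: "c \<noteq> 0 \<Longrightarrow> \<kappa> c * \<kappa> (inverse c) = 1"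
  by (simp add: \<kappa>_mult[symmetric] \<kappa>_one)

lemma of_nat_neq_0: "n > 0 \<Longrightarrow> (of_nat n :: 'r) \<noteq> 0"
  using \<kappa>_inverse[of "of_nat n"] by (auto simp: \<kappa>_of_nat)

text \<open>The derivation is the coefficient of t. Associativity gives \<delta>^n = n! D_n, so
  nilpotency is the polynomiality of \<open>\<phi> b\<close>, and in characteristic zero \<delta> b
  = 0 kills all coefficients of positive index.\<close>

lemma lnd_of_action:
  assumes act: "ga_action B \<iota> \<phi>"
  obtains \<delta> where "lnd \<kappa> A \<delta>" "\<And>b. b \<in> carrier B \<Longrightarrow> \<delta> (E b) = 0 \<Longrightarrow> \<phi> b = up_ring.monom (UP B) b 0"
proof
  note act' = act[unfolded ga_action_iff[of \<iota>, OF \<iota>_closed]]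
  have hom: "\<phi> \<in> ring_hom B (UP B)" and const: "\<And>c. \<phi> (\<iota> c) = up_ring.monom (UP B) (\<iota> c) 0"
    and zero: "\<And>b. b \<in> carrier B \<Longrightarrow> \<phi> b 0 = b"
    and assoc: "\<And>b i j. b \<in> carrier B \<Longrightarrow> E (\<phi> (\<phi> b i) j) = of_nat (i + j choose i) * E (\<phi> b (i + j))"
    using act' by auto
  have cl: "\<phi> b \<in> up B" if "b \<in> carrier B" for b
    using hom that by (auto simp: ring_hom_def carrier_UP)
  have cl': "\<phi> b i \<in> carrier B" if "b \<in> carrier B" for b i
    using cl[OF that] by auto
  interpret U: ring_emb "UP B" EU by (rule ring_emb_UP)
  define \<psi> where "\<psi> b = EU (\<phi> b)" for b
  have \<psi>: "coeff (\<psi> b) i = E (\<phi> b i)" if "b \<in> carrier B" for b i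
    unfolding \<psi>_def by (rule coeff_EU[OF cl[OF that]])
  have \<psi>_add: "\<psi> (a \<oplus> b) = \<psi> a + \<psi> b" and \<psi>_mult: "\<psi> (a \<otimes> b) = \<psi> a * \<psi> b"
    if "a \<in> carrier B" "b \<in> carrier B" for a b
    using hom that cl unfolding \<psi>_def
    by (simp_all add: ring_hom_add ring_hom_mult U.E_add U.E_mult carrier_UP)
  define \<delta> where "\<delta> a = E (\<phi> (inv_into (carrier B) E a) 1)" for a
  have \<delta>E: "\<delta> (E b) = E (\<phi> b 1)" if "b \<in> carrier B" for b
    unfolding \<delta>_def using inv_into_f_f[OF E_inj that] by simp
  have pow: "(\<delta> ^^ n) (E b) = of_nat (fact n) * E (\<phi> b n)" if "b \<in> carrier B" for b n
    using that
  proof (induction n arbitrary: b)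
    case (Suc n)
    have "(\<delta> ^^ Suc n) (E b) = (\<delta> ^^ n) (E (\<phi> b 1))"
      by (simp add: funpow_Suc_right \<delta>E Suc.prems del: funpow.simps)
    also have "\<dots> = of_nat (fact n) * E (\<phi> (\<phi> b 1) n)"
      by (intro Suc.IH cl' Suc.prems)
    also have "\<dots> = of_nat (fact (Suc n)) * E (\<phi> b (Suc n))"
      using assoc[OF Suc.prems, of 1 n] by (simp add: algebra_simps)
    finally show ?case .
  qed (simp add: zero)
  show "lnd \<kappa> A \<delta>"
    unfolding lnd_def
  proof (intro conjI ballI allI)
    fix a b assume ab: "a \<in> A" "b \<in> A"
    then obtain a' b' where a': "a' \<in> carrier B" "a = E a'" and b': "b' \<in> carrier B" "b = E b'" by auto
    have "\<delta> (a + b) = coeff (\<psi> (a' \<oplus> b')) 1" "\<delta> (a * b) = coeff (\<psi> (a' \<otimes> b')) 1"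
      using a' b' \<delta>E[of "a' \<oplus> b'"] \<delta>E[of "a' \<otimes> b'"] by (simp_all add: E_add E_mult \<psi>)
    then show "\<delta> (a + b) = \<delta> a + \<delta> b" "\<delta> (a * b) = \<delta> a * b + a * \<delta> b"
      using a' b' by (simp_all add: \<psi>_add \<psi>_mult coeff_mult \<psi> zero \<delta>E)
  next
    fix a assume "a \<in> A"
    then obtain b where b: "b \<in> carrier B" "a = E b" by auto
    show "\<delta> a \<in> A" using b cl' \<delta>E by simp
    obtain N where "bound \<zero> N (\<phi> b)" using cl[OF b(1)] bound_upD by blast
    then have "\<phi> b (Suc N) = \<zero>" by (auto simp: bound_def)
    then have "(\<delta> ^^ Suc N) a = 0" using pow[OF b(1), of "Suc N"] b(2) E_zero by simp
    then show "\<exists>n. (\<delta> ^^ n) a = 0" by blast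
  next
    fix c show "\<delta> (\<kappa> c) = 0"
      using \<delta>E[OF \<iota>_closed, of c] by (simp add: E_\<iota> const monom_UP_eq \<iota>_closed E_zero)
  qed
  show "\<phi> b = up_ring.monom (UP B) b 0" if b: "b \<in> carrier B" "\<delta> (E b) = 0" for b
  proof
    fix n
    have "\<phi> b n = \<zero>" if "n > 0"
    proof -
      from that obtain m where n: "n = Suc m" by (cases n) auto
      have p0: "(\<delta> ^^ m) 0 = 0"
      proof (induction m)
        case (Suc m)
        have "\<delta> 0 = 0" using \<delta>E[OF \<iota>_closed, of 0] by (simp add: E_\<iota> \<kappa>_zero const monom_UP_eq \<iota>_closed E_zero)
        with Suc show ?case by simp
      qed simp
      have "(\<delta> ^^ n) (E b) = 0" by (simp add: n funpow_Suc_right b p0 del: funpow.simps)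
      then have "of_nat (fact n) * E (\<phi> b n) = 0" using pow[OF b(1)] by simp
      then have "E (\<phi> b n) = E \<zero>" using of_nat_neq_0[of "fact n"] by (simp add: E_zero)
      then show ?thesis using E_eq_iff cl'[OF b(1)] by blast
    qed
    with zero[OF b(1)] show "\<phi> b n = up_ring.monom (UP B) b 0 n"
      by (cases n) (auto simp: monom_UP_eq b(1))
  qed
qed

text \<open>The action is exp(t \<delta>), with coefficients \<open>D n\<close> equal to \<delta>^n
  / n!; nilpotency makes it a polynomial in t.\<close>

lemma action_of_lnd:
  assumes lnd: "lnd \<kappa> A \<delta>"
  obtains \<phi> where "ga_action B \<iota> \<phi>" "\<And>b. b \<in> carrier B \<Longrightarrow> E (\<phi> b 1) = \<delta> (E b)"
proof -
  note cl = lnd_closed[OF lnd] and add = lnd_add[OF lnd] and mult = lnd_mult[OF lnd]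
    and const = lnd_const[OF lnd] and nil = lnd_nilpotent[OF lnd]
  have \<delta>0: "\<delta> 0 = 0" using const[of 0] by (simp add: \<kappa>_zero)
  define D where "D n a = \<kappa> (inverse (fact n)) * (\<delta> ^^ n) a" for n a
  have pcl: "(\<delta> ^^ n) a \<in> A" if "a \<in> A" for n a
    using that by (induction n) (auto intro: cl)
  have Dcl: "D n a \<in> A" if "a \<in> A" for n a
    unfolding D_def by (intro A_mult A_const pcl that)
  have \<delta>scale: "\<delta> (\<kappa> c * a) = \<kappa> c * \<delta> a" if "a \<in> A" for c a
    using mult[OF A_const that] const by simp
  have pscale: "(\<delta> ^^ n) (\<kappa> c * a) = \<kappa> c * (\<delta> ^^ n) a" if "a \<in> A" for n c a
    by (induction n) (use \<delta>scale pcl that in auto)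
  have inv_fact: "of_nat (Suc n) * \<kappa> (inverse (fact (Suc n))) = \<kappa> (inverse (fact n))" for n
    by (simp add: \<kappa>_of_nat[symmetric] \<kappa>_mult[symmetric] field_simps del: of_nat_Suc)
  have DS: "of_nat (Suc n) * D (Suc n) a = \<delta> (D n a)" if "a \<in> A" for n a
    unfolding D_def using pcl[OF that] by (simp add: \<delta>scale mult.assoc[symmetric] inv_fact del: of_nat_Suc fact_Suc)
  have Dadd: "D n (a + b) = D n a + D n b" if "a \<in> A" "b \<in> A" for n a b
  proof -
    have "(\<delta> ^^ n) (a + b) = (\<delta> ^^ n) a + (\<delta> ^^ n) b"
      by (induction n) (use add pcl that in auto)
    then show ?thesis by (simp add: D_def distrib_left)
  qed
  have \<delta>sum: "\<delta> (sum f I) = (\<Sum>i\<in>I. \<delta> (f i))" if "finite I" "\<And>i. i \<in> I \<Longrightarrow> f i \<in> A" for f and I :: "nat set"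
  proof -
    have "sum f I \<in> A \<and> \<delta> (sum f I) = (\<Sum>i\<in>I. \<delta> (f i))"
      using that by (induction I rule: finite_induct) (auto simp: \<delta>0 A_zero A_add add)
    then show ?thesis by simp
  qed
  have Dmult: "D n (a * b) = (\<Sum>i\<le>n. D i a * D (n - i) b)" if ab: "a \<in> A" "b \<in> A" for n a b
  proof (induction n)
    case 0
    show ?case by (simp add: D_def \<kappa>_one)
  next
    case (Suc n)
    \<comment> \<open>After multiplication by n + 1 the left side is \<delta> of the product formula
      for n. On the right the term with \<open>D i a\<close> and \<open>D (Suc n - i) b\<close>
      collects the weights i and n + 1 - i.\<close>
    have "of_nat (Suc n) * D (Suc n) (a * b) = \<delta> (\<Sum>i\<le>n. D i a * D (n - i) b)"
      using DS[OF A_mult[OF ab]] Suc by simp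
    also have "\<dots> = (\<Sum>i\<le>n. \<delta> (D i a) * D (n - i) b + D i a * \<delta> (D (n - i) b))"
      by (subst \<delta>sum) (auto intro!: sum.cong mult A_mult Dcl ab)
    also have "\<dots> = (\<Sum>i\<le>n. of_nat (Suc i) * D (Suc i) a * D (n - i) b)
        + (\<Sum>i\<le>n. of_nat (Suc n - i) * D i a * D (Suc n - i) b)"
    proof -
      have "\<delta> (D i a) * D (n - i) b + D i a * \<delta> (D (n - i) b) = of_nat (Suc i) * D (Suc i) a * D (n - i) b
          + of_nat (Suc n - i) * D i a * D (Suc n - i) b" if "i \<le> n" for i
        using that by (simp only: DS[OF ab(1), symmetric] DS[OF ab(2), symmetric] Suc_diff_le ac_simps)
      then show ?thesis by (simp add: sum.distrib[symmetric] del: of_nat_Suc)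
    qed
    also have "(\<Sum>i\<le>n. of_nat (Suc i) * D (Suc i) a * D (n - i) b)
        = (\<Sum>i\<le>Suc n. of_nat i * (D i a * D (Suc n - i) b))"
      by (subst sum.atMost_Suc_shift) (simp add: mult.assoc del: of_nat_Suc)
    also have "(\<Sum>i\<le>n. of_nat (Suc n - i) * D i a * D (Suc n - i) b)
        = (\<Sum>i\<le>Suc n. of_nat (Suc n - i) * (D i a * D (Suc n - i) b))"
      by (simp add: mult.assoc)
    also have "(\<Sum>i\<le>Suc n. of_nat i * (D i a * D (Suc n - i) b))
          + (\<Sum>i\<le>Suc n. of_nat (Suc n - i) * (D i a * D (Suc n - i) b))
        = (\<Sum>i\<le>Suc n. of_nat (Suc n) * (D i a * D (Suc n - i) b))"
      unfolding sum.distrib[symmetric]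
      by (intro sum.cong refl) (simp add: distrib_right[symmetric] of_nat_add[symmetric] del: of_nat_Suc of_nat_add)
    also have "\<dots> = of_nat (Suc n) * (\<Sum>i\<le>Suc n. D i a * D (Suc n - i) b)"
      by (simp only: sum_distrib_left)
    finally show ?case
      using of_nat_neq_0[of "Suc n"] by (metis mult_left_cancel zero_less_Suc)
  qed
  define \<phi> where "\<phi> b n = inv_into (carrier B) E (D n (E b))" for b n
  have E\<phi>: "E (\<phi> b n) = D n (E b)" and \<phi>cl: "\<phi> b n \<in> carrier B" if "b \<in> carrier B" for b n
    using Dcl[of "E b" n] that unfolding \<phi>_def by (auto intro: f_inv_into_f inv_into_into)
  have \<phi>up: "\<phi> b \<in> up B" if b: "b \<in> carrier B" for b
  proof (rule mem_upI)
    obtain N where N: "(\<delta> ^^ N) (E b) = 0" using nil b by blast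
    have "(\<delta> ^^ (N + k)) (E b) = 0" for k
      by (induction k) (simp_all add: N \<delta>0)
    then have "(\<delta> ^^ m) (E b) = 0" if "N < m" for m
      using that by (metis less_imp_add_positive)
    then have "bound \<zero> N (\<phi> b)"
      using E_eq_iff[OF \<phi>cl[OF b] zero_closed] by (auto simp: bound_def E\<phi>[OF b] D_def E_zero)
    then show "\<exists>n. bound \<zero> n (\<phi> b)" by blast
  qed (rule \<phi>cl[OF b])
  interpret U: ring_emb "UP B" EU by (rule ring_emb_UP)
  have eqI: "p = q" if "p \<in> up B" "q \<in> up B" "\<And>n. E (p n) = E (q n)" for p q
    using that by (intro ext) (metis E_eq_iff mem_upD)
  have EU\<phi>: "coeff (EU (\<phi> b)) n = D n (E b)" if "b \<in> carrier B" for b n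
    using that by (simp add: coeff_EU \<phi>up E\<phi>)
  have EUeq: "p = q" if "p \<in> up B" "q \<in> up B" "EU p = EU q" for p q
    using that U.E_eq_iff by (simp add: carrier_UP)
  have upcl: "p \<oplus>\<^bsub>UP B\<^esub> q \<in> up B" "p \<otimes>\<^bsub>UP B\<^esub> q \<in> up B" if "p \<in> up B" "q \<in> up B" for p q
    using that U.a_closed[of p q] U.m_closed[of p q] by (simp_all add: carrier_UP)
  have upone: "\<one>\<^bsub>UP B\<^esub> \<in> up B" using U.one_closed by (simp add: carrier_UP)
  have D1: "D n 1 = (if n = 0 then 1 else 0)" for n
  proof (cases n)
    case (Suc m)
    have p0: "(\<delta> ^^ m) 0 = 0" for m by (induction m) (simp_all add: \<delta>0)
    have "\<delta> 1 = 0" using const[of 1] by (simp add: \<kappa>_one)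
    then show ?thesis by (simp add: D_def Suc funpow_Suc_right p0 del: funpow.simps)
  qed (simp add: D_def \<kappa>_one)
  have D\<kappa>: "D n (\<kappa> c) = (if n = 0 then \<kappa> c else 0)" for n c
    using pscale[OF A_one, of n c] D1[of n] by (auto simp: D_def)
  have "\<phi> \<in> ring_hom B (UP B)"
  proof (rule ring_hom_memI)
    fix a b assume ab: "a \<in> carrier B" "b \<in> carrier B"
    show "\<phi> a \<in> carrier (UP B)" using \<phi>up ab by (simp add: carrier_UP)
    show "\<phi> (a \<otimes> b) = \<phi> a \<otimes>\<^bsub>UP B\<^esub> \<phi> b"
      by (rule EUeq) (use ab \<phi>up upcl in \<open>auto simp: U.E_mult carrier_UP poly_eq_iff EU\<phi> E_mult Dmult coeff_mult\<close>)
    show "\<phi> (a \<oplus> b) = \<phi> a \<oplus>\<^bsub>UP B\<^esub> \<phi> b"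
      by (rule EUeq) (use ab \<phi>up upcl in \<open>auto simp: U.E_add carrier_UP poly_eq_iff EU\<phi> E_add Dadd\<close>)
  next
    show "\<phi> \<one> = \<one>\<^bsub>UP B\<^esub>"
      by (rule EUeq) (use \<phi>up upone in \<open>auto simp: U.E_one carrier_UP poly_eq_iff EU\<phi> E_one D1\<close>)
  qed
  moreover have "\<phi> (\<iota> c) = up_ring.monom (UP B) (\<iota> c) 0" for c
    by (rule EUeq) (auto simp: \<phi>up \<iota>_closed monom_closed poly_eq_iff EU\<phi> EU_monom E_\<iota> D\<kappa>)
  moreover have "\<phi> b 0 = b" if "b \<in> carrier B" for b
    using E\<phi>[OF that, of 0] E_eq_iff \<phi>cl that by (simp add: D_def \<kappa>_one)
  moreover have "E (\<phi> (\<phi> b i) j) = of_nat (i + j choose i) * E (\<phi> b (i + j))" if b: "b \<in> carrier B" for b i j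
  proof -
    have "D j (D i (E b)) = \<kappa> (inverse (fact i) * inverse (fact j)) * (\<delta> ^^ (j + i)) (E b)"
      using pscale[OF pcl[of "E b" i]] b
      by (simp add: D_def funpow_add \<kappa>_mult mult.assoc mult.left_commute)
    also have "inverse (fact i) * inverse (fact j) = of_nat (i + j choose i) * (inverse (fact (i + j)) :: 'k)"
      by (simp add: binomial_fact field_simps)
    also have "\<kappa> (of_nat (i + j choose i) * inverse (fact (i + j))) * (\<delta> ^^ (j + i)) (E b)
        = of_nat (i + j choose i) * D (i + j) (E b)"
      by (simp only: D_def \<kappa>_mult \<kappa>_of_nat add.commute[of j i] mult.assoc)
    finally show ?thesis using E\<phi> \<phi>cl b by simp
  qed
  ultimately have "ga_action B \<iota> \<phi>"
    unfolding ga_action_iff[of \<iota>, OF \<iota>_closed] by blast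
  then show ?thesis
    using that[of \<phi>] E\<phi>[of _ 1] by (simp add: D_def \<kappa>_one)
qed

lemma makar_limanov_eq:
  "makar_limanov B \<iota> = {b \<in> carrier B. \<forall>\<delta>. lnd \<kappa> A \<delta> \<longrightarrow> \<delta> (E b) = 0}"
proof (intro equalityI subsetI CollectI conjI allI impI; clarsimp simp: makar_limanov_def)
  fix b \<delta>
  assume b: "b \<in> carrier B" "\<forall>\<phi>. ga_action B \<iota> \<phi> \<longrightarrow> \<phi> b = up_ring.monom (UP B) b 0" "lnd \<kappa> A \<delta>"
  obtain \<phi> where \<phi>: "ga_action B \<iota> \<phi>" "\<And>b. b \<in> carrier B \<Longrightarrow> E (\<phi> b 1) = \<delta> (E b)"
    using action_of_lnd[OF b(3)] by blast
  then have "\<phi> b 1 = \<zero>" using b by (simp add: monom_UP_eq)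
  with \<phi>(2)[OF b(1)] show "\<delta> (E b) = 0" by (simp add: E_zero)
next
  fix b \<phi>
  assume b: "b \<in> carrier B" "\<forall>\<delta>. lnd \<kappa> A \<delta> \<longrightarrow> \<delta> (E b) = 0" "ga_action B \<iota> \<phi>"
  then show "\<phi> b = up_ring.monom (UP B) b 0"
    using lnd_of_action[OF b(3)] by blast
qed

end

section \<open>The regular functions inside k(x)[y]\<close>

abbreviation X :: "'k::field poly fract" where "X \<equiv> to_fract [:0, 1:]"

context labelled
begin

abbreviation "\<B> \<equiv> danielewski_ring \<Gamma> r \<sigma>"
abbreviation \<iota> :: "'k \<Rightarrow> 'e \<Rightarrow> 'k poly poly" where "\<iota> \<equiv> danielewski_const \<Gamma> r"
abbreviation \<kappa> :: "'k \<Rightarrow> 'k poly fract poly" where "\<kappa> c \<equiv> [:to_fract [:c:]:]"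
abbreviation x :: "'k poly fract poly" where "x \<equiv> [:X:]"
abbreviation y :: "'k poly fract poly" where "y \<equiv> [:0, 1:]"

definition chart :: "'e \<Rightarrow> 'k poly fract poly \<Rightarrow> 'k poly fract poly" where
  "chart i F = pcompose F [:to_fract (\<sigma> i), X ^ lev i:]"

definition unchart :: "'e \<Rightarrow> 'k poly fract poly \<Rightarrow> 'k poly fract poly" where
  "unchart i F = pcompose F [:- to_fract (\<sigma> i) / X ^ lev i, 1 / X ^ lev i:]"

lemma chart_unchart: "chart i (unchart i F) = F" and unchart_chart: "unchart i (chart i F) = F"
  unfolding chart_def unchart_def pcompose_assoc[symmetric] by (simp_all add: pcompose_pCons)

lemma chart_simps [simp]:
  "chart i (F + G) = chart i F + chart i G" "chart i (F - G) = chart i F - chart i G"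
  "chart i (F * G) = chart i F * chart i G" "chart i 0 = 0" "chart i 1 = 1" "chart i [:c:] = [:c:]"
  "chart i (F ^ n) = chart i F ^ n"
proof -
  show m: "chart i (F * G) = chart i F * chart i G" for F G
    by (simp add: chart_def pcompose_mult)
  show o: "chart i 1 = 1"
    by (simp add: chart_def pcompose_1)
  show "chart i (F ^ n) = chart i F ^ n"
    by (induction n) (simp_all add: m o)
qed (simp_all add: chart_def pcompose_add pcompose_diff)

lemma chart_prod: "chart i (prod f S) = (\<Prod>s\<in>S. chart i (f s))"
  by (simp add: chart_def pcompose_prod)

text \<open>The gluing map factors through the common coordinate y, so a compatible family of chart
  functions is a single element of k(x)[y] written in all charts.\<close>

lemma transition_eq: "pcompose F (transition \<Gamma> r \<sigma> i j) = chart j (unchart i F)"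
proof -
  have "transition \<Gamma> r \<sigma> i j =
      pcompose [:- to_fract (\<sigma> i) / X ^ lev i, 1 / X ^ lev i:] [:to_fract (\<sigma> j), X ^ lev j:]"
    by (simp add: transition_def Let_def pcompose_pCons power_int_minus power_int_diff field_simps)
  then show ?thesis by (simp add: chart_def unchart_def pcompose_assoc)
qed

abbreviation "\<O> \<equiv> range (fract_poly :: 'k poly poly \<Rightarrow> _)"

definition "\<A> = {F. \<forall>i\<in>L. chart i F \<in> \<O>}"

section \<open>The coordinate ring as a subring of k(x)[y]\<close>

lemma carrier_B:
  "f \<in> carrier \<B> \<longleftrightarrow> f \<in> extensional L \<and>
    (\<forall>i\<in>L. \<forall>j\<in>L. i \<noteq> j \<longrightarrow> chart j (unchart i (fract_poly (f i))) = fract_poly (f j))"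
  by (simp add: danielewski_ring_def Let_def transition_eq)

lemma B_simps:
  "f \<otimes>\<^bsub>\<B>\<^esub> g = (\<lambda>i\<in>L. f i * g i)" "f \<oplus>\<^bsub>\<B>\<^esub> g = (\<lambda>i\<in>L. f i + g i)"
  "\<one>\<^bsub>\<B>\<^esub> = (\<lambda>i\<in>L. 1)" "\<zero>\<^bsub>\<B>\<^esub> = (\<lambda>i\<in>L. 0)"
  by (simp_all add: danielewski_ring_def Let_def)

text \<open>The choice of the leaf is immaterial on the carrier, where all charts come from the same
  element.\<close>

definition EE :: "('e \<Rightarrow> 'k poly poly) \<Rightarrow> 'k poly fract poly" where
  "EE f = (let i = SOME i. i \<in> L in unchart i (fract_poly (f i)))"

lemma carrier_B_iff:
  "f \<in> carrier \<B> \<longleftrightarrow> f \<in> extensional L \<and> (\<exists>F. \<forall>i\<in>L. chart i F = fract_poly (f i))"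
proof -
  obtain i0 where "i0 \<in> L" using L_nonempty by blast
  then show ?thesis
    unfolding carrier_B by (metis chart_unchart unchart_chart)
qed

lemma chart_EE:
  assumes "f \<in> carrier \<B>" "i \<in> L"
  shows "chart i (EE f) = fract_poly (f i)"
proof -
  have "(SOME i. i \<in> L) \<in> L" using L_nonempty by (simp add: some_in_eq)
  then show ?thesis
    using assms unfolding carrier_B_iff EE_def Let_def by (metis unchart_chart)
qed

lemma EE_eqI: "f \<in> carrier \<B> \<Longrightarrow> (\<And>i. i \<in> L \<Longrightarrow> chart i F = fract_poly (f i)) \<Longrightarrow> EE f = F"
  using L_nonempty chart_EE by (metis all_not_in_conv unchart_chart)

lemma chart_eqI: "i \<in> L \<Longrightarrow> chart i F = chart i G \<Longrightarrow> F = G"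
  by (metis unchart_chart)

lemma B_closed:
  assumes "f \<in> carrier \<B>" "g \<in> carrier \<B>"
  shows "f \<otimes>\<^bsub>\<B>\<^esub> g \<in> carrier \<B>" "f \<oplus>\<^bsub>\<B>\<^esub> g \<in> carrier \<B>"
    "(\<lambda>i\<in>L. - f i) \<in> carrier \<B>"
    "EE (f \<otimes>\<^bsub>\<B>\<^esub> g) = EE f * EE g" "EE (f \<oplus>\<^bsub>\<B>\<^esub> g) = EE f + EE g"
proof -
  have c: "chart i (EE f * EE g) = fract_poly ((f \<otimes>\<^bsub>\<B>\<^esub> g) i)"
    "chart i (EE f + EE g) = fract_poly ((f \<oplus>\<^bsub>\<B>\<^esub> g) i)"
    "chart i (0 - EE f) = fract_poly ((\<lambda>i\<in>L. 0 - f i) i)" if "i \<in> L" for i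
    using that by (simp_all only: chart_simps chart_EE assms B_simps restrict_apply if_True
        fract_poly_mult fract_poly_add fract_poly_diff fract_poly_0)
  show *: "f \<otimes>\<^bsub>\<B>\<^esub> g \<in> carrier \<B>" "f \<oplus>\<^bsub>\<B>\<^esub> g \<in> carrier \<B>" "(\<lambda>i\<in>L. - f i) \<in> carrier \<B>"
    unfolding carrier_B_iff using c by (auto simp: B_simps simp del: chart_simps)
  show "EE (f \<otimes>\<^bsub>\<B>\<^esub> g) = EE f * EE g" "EE (f \<oplus>\<^bsub>\<B>\<^esub> g) = EE f + EE g"
    using c by (auto intro!: EE_eqI *)
qed

lemma B_const:
  "\<iota> c \<in> carrier \<B>" "EE (\<iota> c) = \<kappa> c"
  "\<zero>\<^bsub>\<B>\<^esub> \<in> carrier \<B>" "EE \<zero>\<^bsub>\<B>\<^esub> = 0" "\<one>\<^bsub>\<B>\<^esub> \<in> carrier \<B>" "EE \<one>\<^bsub>\<B>\<^esub> = 1"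
proof -
  have c: "chart i (\<kappa> c) = fract_poly (\<iota> c i)" "chart i 0 = fract_poly (\<zero>\<^bsub>\<B>\<^esub> i)"
    "chart i 1 = fract_poly (\<one>\<^bsub>\<B>\<^esub> i)" if "i \<in> L" for i
    using that by (simp_all add: danielewski_const_def B_simps map_poly_pCons)
  show *: "\<iota> c \<in> carrier \<B>" "\<zero>\<^bsub>\<B>\<^esub> \<in> carrier \<B>" "\<one>\<^bsub>\<B>\<^esub> \<in> carrier \<B>"
    unfolding carrier_B_iff using c
    by (auto simp: B_simps danielewski_const_def simp del: chart_simps)
  show "EE (\<iota> c) = \<kappa> c" "EE \<zero>\<^bsub>\<B>\<^esub> = 0" "EE \<one>\<^bsub>\<B>\<^esub> = 1"
    using c by (auto intro!: EE_eqI * simp del: chart_simps)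
qed

lemma B_eqI:
  "f \<in> carrier \<B> \<Longrightarrow> g \<in> carrier \<B> \<Longrightarrow> (\<And>i. i \<in> L \<Longrightarrow> f i = g i) \<Longrightarrow> f = g"
  using extensionalityI[of f L g] by (auto simp: carrier_B)

lemma cring_B: "cring \<B>"
proof (intro cringI abelian_groupI comm_monoidI)
  fix f g h assume "f \<in> carrier \<B>" "g \<in> carrier \<B>" "h \<in> carrier \<B>"
  note c = this B_closed B_const
  show "f \<oplus>\<^bsub>\<B>\<^esub> g \<oplus>\<^bsub>\<B>\<^esub> h = f \<oplus>\<^bsub>\<B>\<^esub> (g \<oplus>\<^bsub>\<B>\<^esub> h)"
    by (rule B_eqI, simp_all add: c) (simp add: B_simps algebra_simps)
  show "f \<otimes>\<^bsub>\<B>\<^esub> g \<otimes>\<^bsub>\<B>\<^esub> h = f \<otimes>\<^bsub>\<B>\<^esub> (g \<otimes>\<^bsub>\<B>\<^esub> h)"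
    by (rule B_eqI, simp_all add: c) (simp add: B_simps algebra_simps)
  show "(f \<oplus>\<^bsub>\<B>\<^esub> g) \<otimes>\<^bsub>\<B>\<^esub> h = f \<otimes>\<^bsub>\<B>\<^esub> h \<oplus>\<^bsub>\<B>\<^esub> g \<otimes>\<^bsub>\<B>\<^esub> h"
    by (rule B_eqI, simp_all add: c) (simp add: B_simps algebra_simps)
next
  fix f g assume "f \<in> carrier \<B>" "g \<in> carrier \<B>"
  note c = this B_closed B_const
  show "f \<oplus>\<^bsub>\<B>\<^esub> g = g \<oplus>\<^bsub>\<B>\<^esub> f" "f \<otimes>\<^bsub>\<B>\<^esub> g = g \<otimes>\<^bsub>\<B>\<^esub> f"
    by (simp_all add: B_simps ac_simps)
next
  fix f assume f: "f \<in> carrier \<B>"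
  note c = this B_closed B_const
  show "\<zero>\<^bsub>\<B>\<^esub> \<oplus>\<^bsub>\<B>\<^esub> f = f"
    by (rule B_eqI, simp_all add: c) (simp add: B_simps)
  show "\<one>\<^bsub>\<B>\<^esub> \<otimes>\<^bsub>\<B>\<^esub> f = f"
    by (rule B_eqI, simp_all add: c) (simp add: B_simps)
  show "\<exists>g\<in>carrier \<B>. g \<oplus>\<^bsub>\<B>\<^esub> f = \<zero>\<^bsub>\<B>\<^esub>"
    by (rule bexI[of _ "\<lambda>i\<in>L. - f i"]) (auto simp: B_simps B_closed(3)[OF f f])
qed (auto simp: B_closed B_const)

lemma EE_image: "EE ` carrier \<B> = \<A>"
proof (intro equalityI subsetI)
  fix F assume "F \<in> \<A>"
  then have "\<forall>i\<in>L. \<exists>q. chart i F = fract_poly q" by (auto simp: \<A>_def)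
  then obtain f where f: "\<forall>i\<in>L. chart i F = fract_poly (f i)" by metis
  then have c: "restrict f L \<in> carrier \<B>" unfolding carrier_B_iff by auto
  then have "EE (restrict f L) = F" using f by (intro EE_eqI) auto
  with c show "F \<in> EE ` carrier \<B>" by blast
qed (auto simp: \<A>_def chart_EE)

sublocale danielewski: algebra_emb \<B> EE \<iota> \<kappa>
proof (intro algebra_emb.intro ring_emb.intro ring_emb_axioms.intro algebra_emb_axioms.intro cring_B)
  show "inj_on EE (carrier \<B>)"
  proof (rule inj_onI)
    fix f g assume fg: "f \<in> carrier \<B>" "g \<in> carrier \<B>" "EE f = EE g"
    then have "fract_poly (f i) = fract_poly (g i)" if "i \<in> L" for i
      using chart_EE that by metis
    then show "f = g" using fg by (intro B_eqI) auto
  qed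
  show "\<kappa> (a + b) = \<kappa> a + \<kappa> b" "\<kappa> (a * b) = \<kappa> a * \<kappa> b" for a b
    by (simp_all flip: to_fract_add to_fract_mult)
  show "\<kappa> 1 = 1" by (simp add: pCons_one)
qed (simp_all add: B_closed B_const)

lemma makar_limanov_trivial_iff:
  "makar_limanov \<B> \<iota> = range \<iota> \<longleftrightarrow>
    (\<forall>a\<in>\<A>. (\<forall>\<delta>. lnd \<kappa> \<A> \<delta> \<longrightarrow> \<delta> a = 0) \<longrightarrow> a \<in> range \<kappa>)"
proof -
  have "makar_limanov \<B> \<iota> = range \<iota> \<longleftrightarrow> makar_limanov \<B> \<iota> \<subseteq> range \<iota>"
    by (auto simp: danielewski.makar_limanov_eq B_const intro: lnd_const)
  also have "\<dots> \<longleftrightarrow> (\<forall>b\<in>carrier \<B>. (\<forall>\<delta>. lnd \<kappa> \<A> \<delta> \<longrightarrow> \<delta> (EE b) = 0) \<longrightarrow> EE b \<in> range \<kappa>)"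
  proof -
    have "b \<in> range \<iota> \<longleftrightarrow> EE b \<in> range \<kappa>" if "b \<in> carrier \<B>" for b
      using danielewski.E_eq_iff[OF that B_const(1)] by (auto simp: B_const image_iff)
    then show ?thesis
      unfolding danielewski.makar_limanov_eq EE_image by blast
  qed
  also have "\<dots> \<longleftrightarrow> (\<forall>a\<in>\<A>. (\<forall>\<delta>. lnd \<kappa> \<A> \<delta> \<longrightarrow> \<delta> a = 0) \<longrightarrow> a \<in> range \<kappa>)"
    unfolding EE_image[symmetric] by blast
  finally show ?thesis .
qed

section \<open>Subring properties and Laurent expansion in x\<close>

lemma O_closed:
  assumes "p \<in> \<O>" "q \<in> \<O>"
  shows "p + q \<in> \<O>" "p - q \<in> \<O>" "p * q \<in> \<O>"
proof -
  obtain p' q' where "p = fract_poly p'" "q = fract_poly q'" using assms by blast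
  then have "p + q = fract_poly (p' + q')" "p - q = fract_poly (p' - q')" "p * q = fract_poly (p' * q')"
    by simp_all
  then show "p + q \<in> \<O>" "p - q \<in> \<O>" "p * q \<in> \<O>" by blast+
qed

lemma O_const: "[:to_fract c:] \<in> \<O>"
  by (rule image_eqI[of _ _ "[:c:]"]) (auto simp: map_poly_pCons)

lemma O_1: "1 \<in> \<O>"
  using O_const[of 1] by (simp add: pCons_one)

lemma A_closed:
  assumes "a \<in> \<A>" "b \<in> \<A>"
  shows "a + b \<in> \<A>" "a - b \<in> \<A>" "a * b \<in> \<A>"
  using assms by (auto simp: \<A>_def intro: O_closed)

lemma A_const: "[:to_fract c:] \<in> \<A>"
  using O_const by (simp add: \<A>_def)

lemma A_1: "1 \<in> \<A>" and A_0: "0 \<in> \<A>"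
  using A_const[of 1] A_const[of 0] by (simp_all add: pCons_one)

lemma O_power: "p \<in> \<O> \<Longrightarrow> p ^ n \<in> \<O>"
  by (induction n) (auto intro: O_closed O_1)

lemma A_power: "a \<in> \<A> \<Longrightarrow> a ^ n \<in> \<A>"
  by (induction n) (auto intro: A_closed A_1)

lemma A_prod: "(\<And>s. s \<in> S \<Longrightarrow> f s \<in> \<A>) \<Longrightarrow> prod f S \<in> \<A>"
  by (induction S rule: infinite_finite_induct) (auto intro: A_closed A_1)

lemma A_x: "x \<in> \<A>"
  by (rule A_const)

lemma to_fract_power: "to_fract (p ^ n) = to_fract p ^ n"
  by (induction n) simp_all

lemma chart_y: "chart i y = fract_poly [:\<sigma> i, [:0, 1:] ^ lev i:]"
  by (simp add: chart_def map_poly_pCons to_fract_power pcompose_pCons)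

lemma A_y: "y \<in> \<A>"
  by (simp add: \<A>_def chart_y)

lemma fract_poly_pCons: "fract_poly (pCons c G) = [:to_fract c:] + y * fract_poly G"
  by (rule poly_eqI) (simp add: coeff_map_poly coeff_pCons split: nat.splits)

lemma to_fract_pCons: "[:to_fract (pCons c p):] = \<kappa> c + x * [:to_fract p:]"
proof -
  have "pCons c p = [:c:] + [:0, 1:] * p" by simp
  then have "to_fract (pCons c p) = to_fract [:c:] + X * to_fract p"
    by (metis to_fract_add to_fract_mult)
  then show ?thesis by simp
qed

lemma A_fract_poly: "fract_poly G \<in> \<A>"
proof (induction G)
  case (pCons a G)
  show ?case unfolding fract_poly_pCons by (intro A_closed A_const A_y pCons.IH)
qed (simp add: A_0)

text \<open>A single chart suffices: its variable is (y - \<sigma> i) divided by a power of x, so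
  powers of x clear all denominators.\<close>

lemma laurent:
  assumes "a \<in> \<A>"
  obtains N G where "x ^ N * a = fract_poly G"
proof -
  obtain i where i: "i \<in> L" using L_nonempty by blast
  then obtain q where q: "chart i a = fract_poly q" using assms by (auto simp: \<A>_def)
  have "\<exists>N G. x ^ N * unchart i (fract_poly q) = fract_poly G"
  proof (induction q)
    case 0
    show ?case by (rule exI[of _ 0], rule exI[of _ 0]) (simp add: unchart_def)
  next
    case (pCons c q)
    then obtain N G where NG: "x ^ N * unchart i (fract_poly q) = fract_poly G" by blast
    have e: "unchart i (fract_poly (pCons c q)) = [:to_fract c:]
        + [:- to_fract (\<sigma> i) / X ^ lev i, 1 / X ^ lev i:] * unchart i (fract_poly q)"
      by (simp add: unchart_def map_poly_pCons pCons.hyps pcompose_pCons)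
    have xm: "x ^ lev i * [:- to_fract (\<sigma> i) / X ^ lev i, 1 / X ^ lev i:] = fract_poly [:- \<sigma> i, 1:]"
      by (simp add: map_poly_pCons poly_const_pow)
    have "x ^ (lev i + N) * unchart i (fract_poly (pCons c q))
        = x ^ (lev i + N) * [:to_fract c:] + (x ^ lev i * [:- to_fract (\<sigma> i) / X ^ lev i, 1 / X ^ lev i:]) *
          (x ^ N * unchart i (fract_poly q))"
      unfolding e power_add by (simp only: distrib_left mult_ac)
    also have "\<dots> = x ^ (lev i + N) * [:to_fract c:] + fract_poly ([:- \<sigma> i, 1:] * G)"
      unfolding xm NG by (simp only: fract_poly_mult)
    also have "x ^ (lev i + N) * [:to_fract c:] \<in> \<O>"
      by (intro O_closed O_const O_power)
    then obtain H where "x ^ (lev i + N) * [:to_fract c:] = fract_poly H" by blast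
    finally show ?case by (metis fract_poly_add)
  qed
  then show ?thesis
    unfolding q[symmetric] unchart_chart using that by blast
qed

end

section \<open>Distributing roots on a tree\<close>

context rtree
begin

text \<open>\<open>pot e P n\<close>: a polynomial in \<open>y\<close> with \<open>n\<close> roots over the node \<open>e\<close> can vanish to order \<open>P\<close>, not counting the
  levels up to that of \<open>e\<close>, along every leaf above \<open>e\<close>. Of these roots \<open>h c\<close> pass through the child \<open>c\<close>.\<close>

inductive pot :: "'e \<Rightarrow> int \<Rightarrow> nat \<Rightarrow> bool" where
  leaf: "e \<in> L \<Longrightarrow> P \<le> 0 \<Longrightarrow> pot e P n"
| node: "e \<in> \<Gamma> \<Longrightarrow> e \<notin> L \<Longrightarrow> (\<Sum>c\<in>ch e. h c) \<le> n \<Longrightarrow>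
    (\<And>c. c \<in> ch e \<Longrightarrow> pot c (P - int (h c)) (h c)) \<Longrightarrow> pot e P n"

lemma pot_nodeE:
  assumes "pot e P n" "e \<notin> L"
  obtains h where "(\<Sum>c\<in>ch e. h c) \<le> n" "\<And>c. c \<in> ch e \<Longrightarrow> pot c (P - int (h c)) (h c)"
  using assms by (cases rule: pot.cases) auto

lemma pot_antimono: "pot e P n \<Longrightarrow> P' \<le> P \<Longrightarrow> n \<le> n' \<Longrightarrow> pot e P' n'"
proof (induction arbitrary: P' n' rule: pot.induct)
  case (node e h n P)
  then show ?case by (intro pot.node[of e h]) auto
qed (auto intro: pot.leaf)

lemma pot_scale: "pot e P n \<Longrightarrow> pot e (int k * P) (k * n)"
proof (induction rule: pot.induct)
  case (node e h n P)
  then show ?case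
    by (intro pot.node[of e "\<lambda>c. k * h c"]) (auto simp: sum_distrib_left[symmetric] algebra_simps)
qed (auto intro: pot.leaf simp: mult_nonneg_nonpos)

lemma pot_zero: "e \<in> \<Gamma> \<Longrightarrow> pot e 0 n"
proof -
  assume "e \<in> \<Gamma>"
  then have "pot e 0 0"
  proof (induction rule: tree_bottom_up)
    case (node e)
    then show ?case
      by (cases "e \<in> L") (auto intro: pot.leaf pot.node[of e "\<lambda>_. 0"])
  qed
  then show ?thesis by (rule pot_antimono) auto
qed

lemma pot_one: "e \<in> \<Gamma> \<Longrightarrow> e \<notin> L \<Longrightarrow> pot e 1 (card (ch e))"
  by (intro pot.node[of e "\<lambda>_. 1"]) (auto intro: pot_zero childD)

lemma pot_no_roots: "pot e P 0 \<Longrightarrow> P \<le> 0"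
proof (induction e P "0::nat" rule: pot.induct)
  case (node e h P)
  then show ?case using nonleaf_children finite_ch by fastforce
qed

text \<open>At the root this will be \<rho> = a n - b P: nonnegative on all pairs that occur, zero
  at the multiples \<open>k1\<close> and \<open>k2\<close> of (a, b), and equal to 1 somewhere. The
  form is chosen so that it can be inherited by a child with new coefficients and the same
  \<open>k1\<close>, \<open>k2\<close>.\<close>

definition tight :: "int \<Rightarrow> int \<Rightarrow> 'e \<Rightarrow> bool" where
  "tight k1 k2 e \<longleftrightarrow> (\<exists>a b. b > 0 \<and> (\<forall>P n. pot e P n \<longrightarrow> b * P \<le> a * int n) \<and>
     (\<exists>n. int n = k1 * b \<and> pot e (k1 * a) n) \<and> (\<exists>n. int n = k2 * b \<and> pot e (k2 * a) n) \<and>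
     (\<exists>P n. pot e P n \<and> a * int n - b * P = 1))"

text \<open>If the bound \<open>b P \<le> a n\<close> is attained, every child \<open>c\<close> receives the least possible density \<open>\<eta> c / a\<close> of
  roots, since otherwise the roots over \<open>c\<close> could be thinned out. The defect 1 of the last condition of
  \<open>tight\<close> is borne by a single child; a child without defect has an integral density, whereas the
  density of a child that is not a leaf lies strictly between 0 and 1.\<close>

lemma tight_step:
  assumes e: "e \<in> \<Gamma>" "e \<notin> L" and k: "k2 > 0" "coprime k1 k2" and tight: "tight k1 k2 e"
  shows "card {c \<in> ch e. c \<notin> L} \<le> 1" and "\<And>c. c \<in> ch e \<Longrightarrow> c \<notin> L \<Longrightarrow> tight k1 k2 c"
proof -
  obtain a b n1 n2 n3 P3 where b: "b > 0" and ineq: "\<And>P n. pot e P n \<Longrightarrow> b * P \<le> a * int n"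
    and n1: "int n1 = k1 * b" "pot e (k1 * a) n1" and n2: "int n2 = k2 * b" "pot e (k2 * a) n2"
    and n3: "pot e P3 n3" "a * int n3 - b * P3 = 1"
    using tight unfolding tight_def by blast
  obtain u v where uv: "u * k1 + v * k2 = 1"
    using k(2) bezout_int[of k1 k2] by (auto simp: coprime_iff_gcd_eq_1)
  have a: "a > 0"
  proof (rule ccontr)
    assume "\<not> a > 0"
    then have "a * int (card (ch e)) \<le> 0" by (simp add: mult_nonpos_nonneg)
    with ineq[OF pot_one[OF e]] b show False by simp
  qed
  define P1 P2 where "P1 = k1 * a" and "P2 = k2 * a"
  have P2: "P2 > 0" using a k by (simp add: P2_def)
  obtain h1 where h1: "(\<Sum>c\<in>ch e. h1 c) \<le> n1" "\<And>c. c \<in> ch e \<Longrightarrow> pot c (P1 - int (h1 c)) (h1 c)"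
    using pot_nodeE[OF n1(2) e(2)] unfolding P1_def by blast
  obtain h2 where h2: "(\<Sum>c\<in>ch e. h2 c) \<le> n2" "\<And>c. c \<in> ch e \<Longrightarrow> pot c (P2 - int (h2 c)) (h2 c)"
    using pot_nodeE[OF n2(2) e(2)] unfolding P2_def by blast
  obtain h3 where h3: "(\<Sum>c\<in>ch e. h3 c) \<le> n3" "\<And>c. c \<in> ch e \<Longrightarrow> pot c (P3 - int (h3 c)) (h3 c)"
    using pot_nodeE[OF n3(1) e(2)] by blast
  \<comment> \<open>Scale \<open>h2\<close> by P and the competing distribution over
    \<open>c\<close> by \<open>P2\<close>, so that both have order \<open>P2 * P\<close>, and
    exchange them over \<open>c\<close> only. The bound at \<open>e\<close>, which \<open>h2\<close>
    attains, says that the exchange cannot save roots.\<close>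
  have exch: "int (h2 c) * P \<le> P2 * int h" if c: "c \<in> ch e" "pot c (P - int h) h" for c P h
  proof (cases "P \<le> 0")
    case True
    then have "int (h2 c) * P \<le> 0" by (simp add: mult_nonneg_nonpos)
    also have "0 \<le> P2 * int h" using P2 by simp
    finally show ?thesis .
  next
    case False
    define p p2 where "p = nat P" and "p2 = nat P2"
    have p: "int p = P" "int p2 = P2" using False P2 by (auto simp: p_def p2_def)
    define h' where "h' d = (if d = c then p2 * h else p * h2 d)" for d
    have "pot d (P2 * P - int (h' d)) (h' d)" if "d \<in> ch e" for d
      using pot_scale[OF c(2), of p2] pot_scale[OF h2(2)[OF that], of p]
      by (auto simp: h'_def p algebra_simps)
    then have "pot e (P2 * P) (\<Sum>d\<in>ch e. h' d)" by (intro pot.node[OF e]) auto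
    then have 1: "b * (P2 * P) \<le> a * int (\<Sum>d\<in>ch e. h' d)" by (rule ineq)
    have s: "(\<Sum>d\<in>ch e. h' d) = p2 * h + p * (\<Sum>d\<in>ch e - {c}. h2 d)"
      using c(1) finite_ch by (simp add: sum.remove[of _ c] h'_def sum_distrib_left)
    have "h2 c + (\<Sum>d\<in>ch e - {c}. h2 d) \<le> n2"
      using h2(1) c(1) finite_ch by (simp add: sum.remove[of _ c])
    then have "p * (\<Sum>d\<in>ch e - {c}. h2 d) + p * h2 c \<le> p * n2"
      by (metis add.commute distrib_left mult_le_mono2)
    then have "int (p * (\<Sum>d\<in>ch e - {c}. h2 d) + p * h2 c) \<le> int (p * n2)"
      by (simp only: of_nat_le_iff)
    then have "int (\<Sum>d\<in>ch e. h' d) \<le> P2 * int h + P * int n2 - P * int (h2 c)"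
      unfolding s by (simp add: p)
    then have "a * int (\<Sum>d\<in>ch e. h' d) \<le> a * (P2 * int h + P * int n2 - P * int (h2 c))"
      using a by (simp only: mult_le_cancel_left_pos)
    with 1 have "b * (P2 * P) \<le> a * (P2 * int h + P * int n2 - P * int (h2 c))" by simp
    moreover have "a * (P * int n2) = b * (P2 * P)" by (simp add: n2(1) P2_def)
    ultimately have "a * (P * int (h2 c)) \<le> a * (P2 * int h)"
      unfolding distrib_left right_diff_distrib by linarith
    then have "a * (int (h2 c) * P) \<le> a * (P2 * int h)" by (simp only: mult.commute[of P])
    then show ?thesis using a by simp
  qed
  have sum2: "int (\<Sum>c\<in>ch e. h2 c) = k2 * b"
  proof -
    have "pot e P2 (\<Sum>c\<in>ch e. h2 c)" using h2(2) by (intro pot.node[OF e]) auto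
    then have "b * P2 \<le> a * int (\<Sum>c\<in>ch e. h2 c)" by (rule ineq)
    then have "a * (k2 * b) \<le> a * int (\<Sum>c\<in>ch e. h2 c)" by (simp only: P2_def ac_simps)
    then have "k2 * b \<le> int (\<Sum>c\<in>ch e. h2 c)" using a by (simp only: mult_le_cancel_left_pos)
    moreover have "int (\<Sum>c\<in>ch e. h2 c) \<le> k2 * b" using h2(1) n2(1) by linarith
    ultimately show ?thesis by simp
  qed
  \<comment> \<open>Each difference is nonnegative by the exchange argument and their sum is at most
    0, so the two optimal distributions are proportional.\<close>
  have eq12: "int (h1 c) * P2 = int (h2 c) * P1" if "c \<in> ch e" for c
  proof -
    have nn: "\<forall>c\<in>ch e. 0 \<le> P2 * int (h1 c) - int (h2 c) * P1"
      using exch h1(2) by auto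
    have "(\<Sum>c\<in>ch e. P2 * int (h1 c) - int (h2 c) * P1)
        = P2 * int (\<Sum>c\<in>ch e. h1 c) - int (\<Sum>c\<in>ch e. h2 c) * P1"
      by (simp add: sum_subtractf sum_distrib_left sum_distrib_right)
    also have "\<dots> \<le> P2 * int n1 - int (\<Sum>c\<in>ch e. h2 c) * P1"
      using h1(1) P2 by (simp del: of_nat_sum)
    also have "\<dots> = 0" unfolding sum2 n1(1) P1_def P2_def by simp
    finally have "(\<Sum>c\<in>ch e. P2 * int (h1 c) - int (h2 c) * P1) = 0"
      using nn by (intro antisym sum_nonneg) auto
    then show ?thesis using nn that finite_ch by (simp add: sum_nonneg_eq_0_iff mult.commute)
  qed
  \<comment> \<open>The Bezout combination divides both optimal counts: \<open>h1 c\<close> is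
    \<open>k1\<close> times it and \<open>h2 c\<close> is \<open>k2\<close> times it. Coprimality
    thus provides an integral density.\<close>
  define \<eta> where "\<eta> c = u * int (h1 c) + v * int (h2 c)" for c
  have \<eta>2: "\<eta> c * k2 = int (h2 c)" and \<eta>1: "\<eta> c * k1 = int (h1 c)" if "c \<in> ch e" for c
  proof -
    have eq: "int (h1 c) * k2 = int (h2 c) * k1"
      using eq12[OF that] a by (simp add: P1_def P2_def)
    have "\<eta> c * k2 = u * (int (h1 c) * k2) + v * k2 * int (h2 c)" by (simp add: \<eta>_def algebra_simps)
    also have "\<dots> = (u * k1 + v * k2) * int (h2 c)" unfolding eq by (simp add: algebra_simps)
    finally show 2: "\<eta> c * k2 = int (h2 c)" by (simp add: uv)
    have "\<eta> c * k1 * k2 = int (h1 c) * k2" using 2 eq by (simp add: algebra_simps)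
    then show "\<eta> c * k1 = int (h1 c)" using k by simp
  qed
  have \<eta>_le: "\<eta> c * P \<le> a * int h" if "c \<in> ch e" "pot c (P - int h) h" for c P h
  proof -
    have "k2 * (\<eta> c * P) \<le> k2 * (a * int h)"
      using exch[OF that] \<eta>2[OF that(1)] by (simp add: P2_def algebra_simps)
    then show ?thesis using k by simp
  qed
  have sum_\<eta>: "(\<Sum>c\<in>ch e. \<eta> c) = b"
  proof -
    have "(\<Sum>c\<in>ch e. \<eta> c) * k2 = b * k2"
      unfolding sum_distrib_right using sum2 by (simp add: \<eta>2)
    then show ?thesis using k by simp
  qed
  define \<delta> where "\<delta> c = a * int (h3 c) - \<eta> c * P3" for c
  have \<delta>_nonneg: "\<delta> c \<ge> 0" if "c \<in> ch e" for c
    using \<eta>_le[OF that h3(2)[OF that]] by (simp add: \<delta>_def)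
  have "(\<Sum>c\<in>ch e. \<delta> c) = a * int (\<Sum>c\<in>ch e. h3 c) - b * P3"
    unfolding \<delta>_def sum_subtractf sum_distrib_right[symmetric] sum_\<eta> by (simp add: sum_distrib_left)
  also have "\<dots> \<le> a * int n3 - b * P3" using h3(1) a by (simp del: of_nat_sum)
  finally have sum_\<delta>: "(\<Sum>c\<in>ch e. \<delta> c) \<le> 1" using n3(2) by simp
  have \<eta>_bounds: "0 < \<eta> c" "\<eta> c < a" if c: "c \<in> ch e" "c \<notin> L" for c
  proof -
    show "0 < \<eta> c"
    proof (rule ccontr)
      assume "\<not> 0 < \<eta> c"
      then have "int (h2 c) \<le> 0" using \<eta>2[OF c(1)] k by (metis linorder_not_less mult_nonpos_nonneg order_less_imp_le)
      then have "pot c P2 0" using h2(2)[OF c(1)] by simp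
      with P2 pot_no_roots show False by fastforce
    qed
    \<comment> \<open>One root through each child of \<open>c\<close> gives order 1 above
      \<open>c\<close> with \<open>card (ch c)\<close> roots, hence order
      \<open>1 + card (ch c)\<close> seen from \<open>e\<close>; this keeps the density strictly
      below \<open>a\<close>.\<close>
    have "pot c 1 (card (ch c))" using c childD by (intro pot_one) auto
    then have "\<eta> c * (1 + int (card (ch c))) \<le> a * int (card (ch c))" by (intro \<eta>_le c) simp
    also have "\<dots> < a * (1 + int (card (ch c)))" using a by simp
    finally show "\<eta> c < a" by (simp add: mult_less_cancel_right)
  qed
  have \<delta>_pos: "\<delta> c \<ge> 1" if c: "c \<in> ch e" "c \<notin> L" for c
  proof (rule ccontr)
    assume "\<not> \<delta> c \<ge> 1"
    then have "a * int (h3 c) = \<eta> c * P3" using \<delta>_nonneg[OF c(1)] by (simp add: \<delta>_def)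
    \<comment> \<open>The defect equation multiplied by \<open>\<eta> c\<close> exhibits
      \<open>\<eta> c\<close> as a multiple of \<open>a\<close>.\<close>
    then have "\<eta> c * (a * int n3 - b * P3) = a * (\<eta> c * int n3 - b * int (h3 c))"
      by (simp add: algebra_simps)
    then have "\<eta> c = a * (\<eta> c * int n3 - b * int (h3 c))" unfolding n3(2) by simp
    then have "a dvd \<eta> c" by (rule dvdI)
    with \<eta>_bounds[OF c] show False using zdvd_not_zless by blast
  qed
  have "int (card {c \<in> ch e. c \<notin> L}) = (\<Sum>c | c \<in> ch e \<and> c \<notin> L. 1)" by simp
  also have "\<dots> \<le> (\<Sum>c | c \<in> ch e \<and> c \<notin> L. \<delta> c)" using \<delta>_pos by (intro sum_mono) auto
  also have "\<dots> \<le> (\<Sum>c\<in>ch e. \<delta> c)" using \<delta>_nonneg finite_ch by (intro sum_mono2) auto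
  also note sum_\<delta>
  finally show "card {c \<in> ch e. c \<notin> L} \<le> 1" by simp
  show "tight k1 k2 c" if c: "c \<in> ch e" "c \<notin> L" for c
    unfolding tight_def
  \<comment> \<open>Orders at \<open>c\<close> do not count the level gained from \<open>e\<close>
    to \<open>c\<close>, so P drops by the number of roots; the bound
    \<open>\<eta> c * P \<le> a * int h\<close> becomes one with the coefficients
    \<open>\<eta> c\<close> and \<open>a - \<eta> c\<close>.\<close>
  proof (rule exI[of _ "a - \<eta> c"], rule exI[of _ "\<eta> c"], intro conjI allI impI)
    show "0 < \<eta> c" using \<eta>_bounds[OF c] by simp
    show "\<eta> c * P \<le> (a - \<eta> c) * int n" if "pot c P n" for P n
      using \<eta>_le[OF c(1), of "P + int n" n] that by (simp add: algebra_simps)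
    show "\<exists>n. int n = k1 * \<eta> c \<and> pot c (k1 * (a - \<eta> c)) n"
      using h1(2)[OF c(1)] \<eta>1[OF c(1)] by (intro exI[of _ "h1 c"]) (simp add: P1_def algebra_simps)
    show "\<exists>n. int n = k2 * \<eta> c \<and> pot c (k2 * (a - \<eta> c)) n"
      using h2(2)[OF c(1)] \<eta>2[OF c(1)] by (intro exI[of _ "h2 c"]) (simp add: P2_def algebra_simps)
    have "\<delta> c \<le> (\<Sum>c\<in>ch e. \<delta> c)" using \<delta>_nonneg finite_ch c by (intro member_le_sum) auto
    then have "\<delta> c = 1" using \<delta>_pos[OF c] sum_\<delta> by simp
    then show "\<exists>P n. pot c P n \<and> (a - \<eta> c) * int n - \<eta> c * P = 1"
      using h3(2)[OF c(1)] by (intro exI[of _ "P3 - int (h3 c)"] exI[of _ "h3 c"])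
        (simp add: \<delta>_def algebra_simps)
  qed
qed

lemma comb_if_tight:
  assumes "k2 > 0" "coprime k1 k2" "tight k1 k2 root"
  shows "comb \<Gamma> r"
proof -
  have "e \<in> L \<or> tight k1 k2 e" if "e \<in> \<Gamma>" for e
    using that
  proof (induction rule: tree_top_down)
    case (child e c)
    then have "e \<notin> L" using leaf_children by blast
    with child tight_step(2)[OF child(1) _ assms(1,2)] show ?case by blast
  qed (use assms in simp)
  then show ?thesis
    using tight_step(1)[OF _ _ assms(1,2)] leaf_children unfolding comb_def by fastforce
qed

end

section \<open>Blowing up along the tree\<close>

abbreviation tt :: "'k::field poly" where "tt \<equiv> [:0, 1:]"

definition red :: "'k::field poly poly \<Rightarrow> 'k poly" where
  "red H = map_poly (\<lambda>p. poly p 0) H"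

lemma coeff_red [simp]: "coeff (red H) n = poly (coeff H n) 0"
  by (simp add: red_def coeff_map_poly)

lemma red_simps [simp]:
  "red 0 = 0" "red 1 = 1" "red (F + G) = red F + red G" "red (F - G) = red F - red G"
  "red (F * G) = red F * red G" "red (smult c F) = smult (poly c 0) (red F)"
  "red (pCons c F) = pCons (poly c 0) (red F)"
  by (rule poly_eqI, simp add: coeff_mult poly_sum coeff_pCons coeff_1 split: nat.splits)+

lemma red_pcompose: "red (pcompose F G) = pcompose (red F) (red G)"
  by (induction F) (simp_all add: pcompose_pCons)

lemma degree_red_le: "degree (red H) \<le> degree H"
  by (rule degree_le) (simp add: coeff_eq_0)

lemma poly_0_iff_dvd: "poly p 0 = 0 \<longleftrightarrow> tt dvd p"
  using poly_eq_0_iff_dvd[of p 0] by simp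

lemma red_eq_0_iff: "red H = 0 \<longleftrightarrow> [:tt:] dvd H"
  by (simp add: poly_eq_iff const_poly_dvd_iff poly_0_iff_dvd)

lemma red_factor:
  assumes "H \<noteq> 0"
  obtains h H' where "H = smult (tt ^ h) H'" "red H' \<noteq> 0"
proof -
  have "\<exists>h H'. H = smult (tt ^ h) H' \<and> red H' \<noteq> 0"
    using assms
  proof (induction "degree (lead_coeff H)" arbitrary: H rule: less_induct)
    case less
    show ?case
    proof (cases "red H = 0")
      case False
      then show ?thesis by (intro exI[of _ 0] exI[of _ H]) simp
    next
      case True
      then obtain H1 where H1: "H = smult tt H1" by (auto simp: red_eq_0_iff dvd_def)
      with less.prems have "H1 \<noteq> 0" by auto
      then have "degree (lead_coeff H) = Suc (degree (lead_coeff H1))"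
        unfolding H1 by (simp add: degree_mult_eq)
      then obtain h H' where "H1 = smult (tt ^ h) H'" "red H' \<noteq> 0"
        using less.hyps[of H1] \<open>H1 \<noteq> 0\<close> by auto
      then show ?thesis unfolding H1 by (intro exI[of _ "Suc h"] exI[of _ H']) simp
    qed
  qed
  then show ?thesis using that by blast
qed

lemma pcompose_power: "pcompose (p ^ n) s = pcompose p s ^ n" for p :: "'a::comm_semiring_1 poly"
  by (induction n) (simp_all add: pcompose_mult pcompose_1)

text \<open>Blowing up the point \<open>(0, b(0))\<close>: the exceptional divisor has multiplicity at most the
  intersection number \<open>order\<close> of the curve with \<open>x = 0\<close> at that point.\<close>

lemma blowup:
  assumes H: "red H \<noteq> 0" and eq: "pcompose H [:b, tt:] = smult (tt ^ h) H'" and H': "red H' \<noteq> 0"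
  shows "h \<le> Polynomial.order (poly b 0) (red H)" "degree (red H') \<le> h"
proof -
  define l where "l = poly b 0"
  define \<mu> where "\<mu> = Polynomial.order l (red H)"
  define G where "G = pcompose H [:b, 1:]"
  have "pcompose H [:b, tt:] = pcompose G [:0, tt:]"
    unfolding G_def pcompose_assoc[symmetric] by (simp add: pcompose_pCons)
  \<comment> \<open>H at b + x T is G at x T, which scales the coefficient of index j by x^j. The
    coefficient of \<open>G\<close> at \<mu> does not vanish at x = 0, which bounds h; beyond index
    h the coefficients of \<open>H'\<close> are divisible by x.\<close>
  then have c: "tt ^ j * coeff G j = tt ^ h * coeff H' j" for j
    using eq by (metis coeff_pcompose_linear coeff_smult)
  obtain q where q: "red H = [:- l, 1:] ^ \<mu> * q" "\<not> [:- l, 1:] dvd q"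
    using order_decomp[OF H, of l] unfolding \<mu>_def by blast
  have "pcompose [:- l, 1:] [:l, 1:] = [:0, 1:]" by (simp add: pcompose_pCons)
  moreover have "red G = pcompose (red H) [:l, 1:]" unfolding G_def red_pcompose l_def by simp
  ultimately have "red G = monom 1 \<mu> * pcompose q [:l, 1:]"
    by (simp only: q(1) pcompose_mult pcompose_power monom_altdef smult_1_left)
  then have "coeff (red G) \<mu> = poly (pcompose q [:l, 1:]) 0"
    by (simp only: coeff_monom_mult poly_0_coeff_0) simp
  then have ne: "poly (coeff G \<mu>) 0 \<noteq> 0"
    using q(2) by (simp add: poly_eq_0_iff_dvd poly_pcompose)
  have "h \<le> \<mu>"
  proof (rule ccontr)
    assume "\<not> h \<le> \<mu>"
    then have "h = \<mu> + Suc (h - \<mu> - 1)" by simp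
    then have "tt ^ \<mu> * coeff G \<mu> = tt ^ \<mu> * (tt * (tt ^ (h - \<mu> - 1) * coeff H' \<mu>))"
      using c[of \<mu>] by (metis mult.assoc power_Suc power_add)
    then have "coeff G \<mu> = tt * (tt ^ (h - \<mu> - 1) * coeff H' \<mu>)"
      by (subst (asm) mult_left_cancel) auto
    with ne show False by simp
  qed
  then show "h \<le> Polynomial.order (poly b 0) (red H)" by (simp add: \<mu>_def l_def)
  show "degree (red H') \<le> h"
  proof (rule degree_le, intro allI impI)
    fix j assume "h < j"
    then have "j = h + Suc (j - h - 1)" by simp
    then have "tt ^ h * coeff H' j = tt ^ h * (tt * (tt ^ (j - h - 1) * coeff G j))"
      using c[of j] by (metis mult.assoc power_Suc power_add)
    then have "coeff H' j = tt * (tt ^ (j - h - 1) * coeff G j)"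
      by (subst (asm) mult_left_cancel) auto
    then show "coeff (red H') j = 0" by simp
  qed
qed

section \<open>Root distributions of regular functions, and conversely\<close>

context labelled
begin

text \<open>Here y = s + x^(lev e) Y, and \<open>H\<close> is a polynomial in Y that has to vanish
  to order K along the leaves above \<open>e\<close>. The children of \<open>e\<close> are distinct
  points of x = 0. Blowing up the point of \<open>c\<close> splits off x^(h c) and leaves the order
  \<open>K - h c\<close>; the numbers \<open>h c\<close> are bounded by the multiplicities of
  distinct roots of \<open>red H\<close>, so their sum is at most n.\<close>

lemma pot_of_divisible:
  assumes "e \<in> \<Gamma>" "red H \<noteq> 0" "degree (red H) \<le> n"
    "\<And>j. j \<in> L \<Longrightarrow> e \<preceq> j \<Longrightarrow> tt ^ lev e dvd \<sigma> j - s"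
    "\<And>j. j \<in> L \<Longrightarrow> e \<preceq> j \<Longrightarrow>
      [:tt ^ nat K:] dvd pcompose H [:(\<sigma> j - s) div tt ^ lev e, tt ^ (lev j - lev e):]"
  shows "pot e K n"
  using assms
proof (induction arbitrary: H n s K rule: tree_bottom_up)
  case (node e)
  note dvd = node.prems(3) and div = node.prems(4)
  show ?case
  proof (cases "e \<in> L")
    case True
    have "K \<le> 0"
    proof (rule ccontr)
      assume "\<not> K \<le> 0"
      then have "[:tt:] dvd [:tt ^ nat K:]" by (simp add: dvd_power)
      also have "\<dots> dvd pcompose H [:(\<sigma> e - s) div tt ^ lev e, 1:]"
        using div[OF True] le_refl node.hyps by simp
      finally have "pcompose (red H) [:poly ((\<sigma> e - s) div tt ^ lev e) 0, 1:] = 0"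
        by (simp add: red_eq_0_iff[symmetric] red_pcompose)
      then show False using node.prems(1) by (simp add: pcompose_eq_0_iff)
    qed
    with True show ?thesis by (rule pot.leaf)
  next
    case False
    define jc where "jc c = (SOME j. j \<in> L \<and> c \<preceq> j)" for c
    have jc: "jc c \<in> L" "c \<preceq> jc c" if "c \<in> ch e" for c
      using someI_ex[of "\<lambda>j. j \<in> L \<and> c \<preceq> j"] leaf_above[OF childD(2)[OF that]] unfolding jc_def by blast+
    have ejc: "e \<preceq> jc c" if "c \<in> ch e" for c using jc[OF that] childD[OF that] le_trans by blast
    define b where "b c = (\<sigma> (jc c) - s) div tt ^ lev e" for c
    have b: "\<sigma> (jc c) - s = tt ^ lev e * b c" if "c \<in> ch e" for c
      using dvd[OF jc(1)[OF that] ejc[OF that]] by (simp add: b_def)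
    have H0: "H \<noteq> 0" using node.prems(1) by auto
    have "\<exists>h H'. pcompose H [:b c, tt:] = smult (tt ^ h) H' \<and> red H' \<noteq> 0" for c
      using red_factor[of "pcompose H [:b c, tt:]"] H0 by (metis pcompose_eq_0_iff degree_pCons_eq_if
          pCons_eq_0_iff zero_less_Suc zero_neq_one)
    then obtain h H' where hH: "\<And>c. pcompose H [:b c, tt:] = smult (tt ^ h c) (H' c)"
      "\<And>c. red (H' c) \<noteq> 0" by metis
    \<comment> \<open>Equal centres would make the labels above two children agree to one order more
      than the level of their branching node.\<close>
    have inj: "inj_on (\<lambda>c. poly (b c) 0) (ch e)"
    proof (rule inj_onI, rule ccontr)
      fix c c' assume c: "c \<in> ch e" "c' \<in> ch e" "poly (b c) 0 = poly (b c') 0" "c \<noteq> c'"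
      then have "tt dvd b c' - b c" by (simp add: poly_0_iff_dvd[symmetric])
      then have "tt ^ lev e * tt dvd tt ^ lev e * (b c' - b c)" by (rule mult_dvd_mono[OF dvd_refl])
      also have "tt ^ lev e * (b c' - b c) = \<sigma> (jc c') - \<sigma> (jc c)"
        using b[OF c(1)] b[OF c(2)] by (simp add: right_diff_distrib[symmetric] algebra_simps)
      finally show False
        using label_not_dvd[OF jc(1)[OF c(1)] jc(1)[OF c(2)] c(1,2,4) jc(2)[OF c(1)] jc(2)[OF c(2)]]
        by (simp add: mult.commute)
    qed
    have "(\<Sum>c\<in>ch e. h c) \<le> (\<Sum>c\<in>ch e. Polynomial.order (poly (b c) 0) (red H))"
      by (intro sum_mono blowup(1)[OF node.prems(1) hH])
    also have "\<dots> = (\<Sum>l\<in>(\<lambda>c. poly (b c) 0) ` ch e. Polynomial.order l (red H))"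
      by (simp add: sum.reindex[OF inj])
    also have "\<dots> = (\<Sum>l\<in>(\<lambda>c. poly (b c) 0) ` ch e \<inter> {l. poly (red H) l = 0}. Polynomial.order l (red H))"
      using finite_ch by (intro sum.mono_neutral_right) (auto simp: order_root)
    also have "\<dots> \<le> (\<Sum>l | poly (red H) l = 0. Polynomial.order l (red H))"
      using poly_roots_finite[OF node.prems(1)] by (intro sum_mono2) auto
    also have "\<dots> \<le> n"
      using sum_order_le_degree[OF node.prems(1)] node.prems(2) by simp
    finally have sum: "(\<Sum>c\<in>ch e. h c) \<le> n" .
    show ?thesis
    proof (rule pot.node[OF node.hyps False sum])
      fix c assume c: "c \<in> ch e"
      show "pot c (K - int (h c)) (h c)"
      proof (rule node.IH[OF c, of "H' c" "h c" "\<sigma> (jc c)"])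
        show "degree (red (H' c)) \<le> h c" by (rule blowup(2)[OF node.prems(1) hH])
        fix j assume j: "j \<in> L" "c \<preceq> j"
        show d: "tt ^ lev c dvd \<sigma> j - \<sigma> (jc c)"
          using jc[OF c] j by (intro label_dvd)
        show "[:tt ^ nat (K - int (h c)):] dvd
            pcompose (H' c) [:(\<sigma> j - \<sigma> (jc c)) div tt ^ lev c, tt ^ (lev j - lev c):]" (is "_ dvd ?F")
        proof (cases "K \<le> int (h c)")
          case False
          have ej: "e \<preceq> j" using j childD[OF c] le_trans by blast
          have lc: "lev c = Suc (lev e)" by (rule level_child[OF c])
          obtain w where w: "\<sigma> j - \<sigma> (jc c) = tt ^ lev c * w" using d by blast
          \<comment> \<open>The chart of \<open>j\<close> factors through the blow-up at
            \<open>c\<close>; this transfers the divisibility from \<open>H\<close> to its proper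
            transform.\<close>
          have "\<sigma> j - s = tt ^ lev e * (b c + tt * w)"
            using w b[OF c] lc by (simp add: algebra_simps)
          then have "[:(\<sigma> j - s) div tt ^ lev e, tt ^ (lev j - lev e):] = [:b c + tt * w, tt * tt ^ (lev j - lev c):]"
            using level_mono[OF j(2)] lc by (simp add: power_Suc[symmetric] Suc_diff_Suc del: power_Suc)
          also have "\<dots> = pcompose [:b c, tt:] [:w, tt ^ (lev j - lev c):]"
            by (simp add: pcompose_pCons)
          also have "[:w, tt ^ (lev j - lev c):] = [:(\<sigma> j - \<sigma> (jc c)) div tt ^ lev c, tt ^ (lev j - lev c):]"
            using w by simp
          finally have "pcompose H [:(\<sigma> j - s) div tt ^ lev e, tt ^ (lev j - lev e):] = smult (tt ^ h c) ?F"
            by (simp add: pcompose_assoc hH(1) pcompose_smult)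
          then have "[:tt ^ nat K:] dvd [:tt ^ h c:] * ?F"
            using div[OF j(1) ej] by simp
          moreover have "nat K = h c + nat (K - int (h c))" using False by simp
          then have "[:tt ^ nat K:] = [:tt ^ h c:] * [:tt ^ nat (K - int (h c)):]"
            by (simp add: power_add)
          ultimately show ?thesis by (metis dvd_mult_cancel_left pCons_eq_0_iff power_eq_0_iff zero_neq_one)
        qed (simp add: pCons_one)
      qed (rule hH)
    qed
  qed
qed

lemma chart_fract_poly: "chart i (fract_poly G) = fract_poly (pcompose G [:\<sigma> i, tt ^ lev i:])"
proof (induction G)
  case (pCons a G)
  have "chart i (fract_poly (pCons a G)) = [:to_fract a:] + chart i y * chart i (fract_poly G)"
    unfolding chart_def by (simp add: map_poly_pCons pCons.hyps pcompose_pCons)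
  also have "\<dots> = fract_poly ([:a:] + [:\<sigma> i, tt ^ lev i:] * pcompose G [:\<sigma> i, tt ^ lev i:])"
    unfolding pCons.IH chart_y fract_poly_add fract_poly_mult by (simp add: map_poly_pCons)
  finally show ?case by (simp only: pcompose_pCons)
qed simp

lemma xpow_eq: "x ^ N = fract_poly [:tt ^ N:]"
  by (simp add: map_poly_pCons poly_const_pow to_fract_power)

lemma mult_to_poly: "[:p * q:] = [:p:] * [:q:]" for p q :: "'a::comm_semiring_0"
  by simp (rule mult.commute)

text \<open>The exact power x^v dividing \<open>G\<close> divides its leading coefficient, so v is
  at most i; the cofactor starts the walk at the root with remaining order N - v.\<close>

lemma pot_of_element:
  assumes a: "a \<in> \<A>" "x ^ N * a = fract_poly G"
    and G: "degree G \<le> n" "degree (coeff G n) \<le> i" "coeff G n \<noteq> 0"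
  shows "pot root (int N - int i) n"
proof -
  have G0: "G \<noteq> 0" using G(3) by auto
  obtain v H where v: "G = smult (tt ^ v) H" "red H \<noteq> 0" using red_factor[OF G0] .
  have "coeff G n = tt ^ v * coeff H n" using v(1) by simp
  then have "v + degree (coeff H n) \<le> i"
    using G(2,3) by (auto simp: degree_mult_eq degree_power_eq)
  have "pot root (int N - int v) n"
  proof (rule pot_of_divisible[OF root_in v(2), of n 0])
    show "degree (red H) \<le> n" using degree_red_le[of H] G(1) v(1) by simp
    fix j assume j: "j \<in> L"
    obtain q where q: "chart j a = fract_poly q" using a(1) j by (auto simp: \<A>_def)
    have "x ^ N * chart j a = chart j (fract_poly G)" using a(2)[symmetric] by simp
    then have "fract_poly ([:tt ^ N:] * q) = fract_poly (pcompose G [:\<sigma> j, tt ^ lev j:])"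
      unfolding q chart_fract_poly xpow_eq by (simp only: fract_poly_mult)
    then have "[:tt ^ N:] * q = [:tt ^ v:] * pcompose H [:\<sigma> j, tt ^ lev j:]"
      unfolding fract_poly_eq_iff v(1) pcompose_smult by simp
    then have d: "[:tt ^ N:] dvd [:tt ^ v:] * pcompose H [:\<sigma> j, tt ^ lev j:]"
      by (metis dvd_triv_left)
    have "[:tt ^ nat (int N - int v):] dvd pcompose H [:\<sigma> j, tt ^ lev j:]"
    proof (cases "N \<le> v")
      case False
      define m where "m = nat (int N - int v)"
      have "N = v + m" using False by (simp add: m_def)
      then have e: "[:tt ^ N:] = [:tt ^ v:] * [:tt ^ nat (int N - int v):]"
        unfolding m_def[symmetric] by (simp only: power_add mult_to_poly)
      show ?thesis using d unfolding e by (subst (asm) dvd_mult_cancel_left) auto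
    qed (simp add: pCons_one)
    then show "[:tt ^ nat (int N - int v):] dvd
        pcompose H [:(\<sigma> j - 0) div tt ^ lev root, tt ^ (lev j - lev root):]"
      by (simp add: level_root)
  qed (simp add: level_root)
  then show ?thesis by (rule pot_antimono) (use \<open>v + degree (coeff H n) \<le> i\<close> in auto)
qed

text \<open>Two orders of vanishing are recorded. Along a leaf that shares only the node
  \<open>e'\<close> below \<open>e\<close>, each of the n roots contributes \<open>lev e'\<close>.
  Along a leaf above \<open>e\<close>, the term \<open>lev e * n\<close> restores the levels that
  \<open>pot\<close> leaves out.\<close>

definition realizes :: "'e \<Rightarrow> int \<Rightarrow> nat \<Rightarrow> 'k poly poly \<Rightarrow> bool" where
  "realizes e P n Q \<longleftrightarrow> lead_coeff Q = 1 \<and> degree Q = n \<and>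
    (\<forall>e' j. e' \<preceq> e \<longrightarrow> e' \<preceq> j \<longrightarrow> j \<in> L \<longrightarrow> [:tt ^ (lev e' * n):] dvd pcompose Q [:\<sigma> j, tt ^ lev j:]) \<and>
    (\<forall>j. e \<preceq> j \<longrightarrow> j \<in> L \<longrightarrow> [:tt ^ nat (P + int (lev e * n)):] dvd pcompose Q [:\<sigma> j, tt ^ lev j:])"

text \<open>The polynomial is a product of factors y - \<sigma> i for leaves i, as prescribed by the
  distribution; agreement of labels below the branching nodes supplies the orders.\<close>

lemma pot_realize:
  assumes "pot e P n"
  shows "\<exists>Q. realizes e P n Q"
proof -
  have lin: "[:tt ^ (lev e' * n):] dvd pcompose ([:- \<sigma> i, 1:] ^ n) [:\<sigma> j, tt ^ lev j:]"
    if "e' \<preceq> i" "e' \<preceq> j" "i \<in> L" "j \<in> L" for e' i j n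
  proof -
    have "tt ^ lev e' dvd \<sigma> j - \<sigma> i" by (rule label_dvd) (use that in auto)
    moreover have "tt ^ lev e' dvd tt ^ lev j" using level_mono[OF that(2)] by (rule le_imp_power_dvd)
    ultimately have "[:tt ^ lev e':] dvd [:\<sigma> j - \<sigma> i, tt ^ lev j:]"
      by (auto simp: const_poly_dvd_iff coeff_pCons split: nat.splits)
    then have "[:tt ^ lev e':] ^ n dvd [:\<sigma> j - \<sigma> i, tt ^ lev j:] ^ n" by (rule dvd_power_same)
    moreover have "pcompose ([:- \<sigma> i, 1:] ^ n) [:\<sigma> j, tt ^ lev j:] = [:\<sigma> j - \<sigma> i, tt ^ lev j:] ^ n"
      by (simp add: pcompose_power pcompose_pCons)
    ultimately show ?thesis by (simp add: poly_const_pow power_mult)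
  qed
  show ?thesis
    using assms
  proof (induction rule: pot.induct)
    case (leaf e P n)
    have "[:tt ^ nat (P + int (lev e * n)):] dvd pcompose ([:- \<sigma> e, 1:] ^ n) [:\<sigma> j, tt ^ lev j:]"
      if "e \<preceq> j" "j \<in> L" for j
    proof -
      have "[:tt ^ nat (P + int (lev e * n)):] dvd [:tt ^ (lev e * n):]"
        using leaf(2) by (subst const_poly_dvd_const_poly_iff, intro le_imp_power_dvd) (simp del: of_nat_mult)
      also have "\<dots> dvd pcompose ([:- \<sigma> e, 1:] ^ n) [:\<sigma> j, tt ^ lev j:]"
        by (rule lin) (use that leaf(1) le_refl[OF leaf_in[OF leaf(1)]] in blast)+
      finally show ?thesis .
    qed
    then have "realizes e P n ([:- \<sigma> e, 1:] ^ n)"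
      unfolding realizes_def using leaf(1)
      by (auto intro: lin simp: degree_linear_power coeff_linear_power)
    then show ?case by blast
  next
    case (node e h n P)
    have "\<forall>c\<in>ch e. \<exists>Q. realizes c (P - int (h c)) (h c) Q" using node.IH by blast
    then obtain Q where real: "\<And>c. c \<in> ch e \<Longrightarrow> realizes c (P - int (h c)) (h c) (Q c)"
      by (auto dest!: bchoice)
    have Q: "lead_coeff (Q c) = 1" "degree (Q c) = h c" if "c \<in> ch e" for c
      using real[OF that] unfolding realizes_def by blast+
    have Qa: "[:tt ^ (lev e' * h c):] dvd pcompose (Q c) [:\<sigma> j, tt ^ lev j:]"
      if "c \<in> ch e" "e' \<preceq> c" "e' \<preceq> j" "j \<in> L" for c e' j
      using real[OF that(1)] that unfolding realizes_def by blast
    have Qb: "[:tt ^ nat (P - int (h c) + int (lev c * h c)):] dvd pcompose (Q c) [:\<sigma> j, tt ^ lev j:]"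
      if "c \<in> ch e" "c \<preceq> j" "j \<in> L" for c j
      using real[OF that(1)] that unfolding realizes_def by blast
    obtain i where i: "i \<in> L" "e \<preceq> i" using leaf_above[OF node.hyps(1)] .
    \<comment> \<open>Surplus roots are all placed at an arbitrary leaf above \<open>e\<close>,
      where they still contribute \<open>lev e\<close> each.\<close>
    define k where "k = n - (\<Sum>c\<in>ch e. h c)"
    have k: "(\<Sum>c\<in>ch e. h c) + k = n" using node.hyps(3) by (simp add: k_def)
    define R where "R = (\<Prod>c\<in>ch e. Q c) * [:- \<sigma> i, 1:] ^ k"
    have comp: "pcompose R s = (\<Prod>c\<in>ch e. pcompose (Q c) s) * pcompose ([:- \<sigma> i, 1:] ^ k) s" for s
      by (simp add: R_def pcompose_mult pcompose_prod)
    have Q0: "Q c \<noteq> 0" if "c \<in> ch e" for c using Q(1)[OF that] by auto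
    have "(\<Prod>c\<in>ch e. lead_coeff (Q c)) = 1" by (rule prod.neutral) (use Q(1) in blast)
    then have lc: "lead_coeff R = 1"
      unfolding R_def lead_coeff_mult lead_coeff_prod lead_coeff_power by simp
    have "degree (\<Prod>c\<in>ch e. Q c) = (\<Sum>c\<in>ch e. degree (Q c))"
      by (rule degree_prod_eq_sum_degree) (use Q0 in blast)
    also have "\<dots> = (\<Sum>c\<in>ch e. h c)" by (rule sum.cong) (simp_all add: Q(2))
    finally have "degree (\<Prod>c\<in>ch e. Q c) = (\<Sum>c\<in>ch e. h c)" .
    moreover have "(\<Prod>c\<in>ch e. Q c) \<noteq> 0" using Q0 finite_ch by (simp add: prod_zero_iff)
    ultimately have dg: "degree R = n"
      unfolding R_def using k by (subst degree_mult_eq) (auto simp: degree_linear_power)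
    have constprod: "(\<Prod>c\<in>S. [:tt ^ f c:]) = [:tt ^ (\<Sum>c\<in>S. f c):]" if "finite S" for S and f :: "'e \<Rightarrow> nat"
      using that
    proof (induction S rule: finite_induct)
      case (insert s S)
      then show ?case by (simp only: prod.insert sum.insert power_add mult_to_poly not_False_eq_True)
    qed (simp add: pCons_one)
    have ejl: "e \<preceq> c" if "c \<in> ch e" for c by (rule childD[OF that])
    have dvdR: "[:tt ^ ((\<Sum>c\<in>ch e. f c) + m):] dvd pcompose R [:\<sigma> j, tt ^ lev j:]"
      if "\<And>c. c \<in> ch e \<Longrightarrow> [:tt ^ f c:] dvd pcompose (Q c) [:\<sigma> j, tt ^ lev j:]"
        "[:tt ^ m:] dvd pcompose ([:- \<sigma> i, 1:] ^ k) [:\<sigma> j, tt ^ lev j:]" for f m j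
    proof -
      have "(\<Prod>c\<in>ch e. [:tt ^ f c:]) dvd (\<Prod>c\<in>ch e. pcompose (Q c) [:\<sigma> j, tt ^ lev j:])"
        by (rule prod_dvd_prod) (rule that(1))
      then have "(\<Prod>c\<in>ch e. [:tt ^ f c:]) * [:tt ^ m:] dvd pcompose R [:\<sigma> j, tt ^ lev j:]"
        unfolding comp by (rule mult_dvd_mono) (rule that(2))
      then show ?thesis by (simp only: constprod[OF finite_ch] power_add mult_to_poly)
    qed
    have 1: "[:tt ^ (lev e' * n):] dvd pcompose R [:\<sigma> j, tt ^ lev j:]"
      if e': "e' \<preceq> e" "e' \<preceq> j" "j \<in> L" for e' j
    proof -
      have "lev e' * n = (\<Sum>c\<in>ch e. lev e' * h c) + lev e' * k"
        by (simp only: k[symmetric] sum_distrib_left distrib_left)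
      moreover have "[:tt ^ ((\<Sum>c\<in>ch e. lev e' * h c) + lev e' * k):] dvd pcompose R [:\<sigma> j, tt ^ lev j:]"
      proof (rule dvdR)
        show "[:tt ^ (lev e' * h c):] dvd pcompose (Q c) [:\<sigma> j, tt ^ lev j:]" if "c \<in> ch e" for c
          by (rule Qa[OF that le_trans[OF e'(1) ejl[OF that]] e'(2,3)])
        show "[:tt ^ (lev e' * k):] dvd pcompose ([:- \<sigma> i, 1:] ^ k) [:\<sigma> j, tt ^ lev j:]"
          by (rule lin[OF le_trans[OF e'(1) i(2)] e'(2) i(1) e'(3)])
      qed
      ultimately show ?thesis by (simp only:)
    qed
    have 2: "[:tt ^ nat (P + int (lev e * n)):] dvd pcompose R [:\<sigma> j, tt ^ lev j:]"
      if j: "e \<preceq> j" "j \<in> L" for j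
    proof -
      have "e \<noteq> j" using j node.hyps(2) by blast
      then obtain c where c: "c \<in> ch e" "c \<preceq> j" by (rule child_above[OF j(1)])
      \<comment> \<open>Only the child below \<open>j\<close> contributes the order that its
        distribution guarantees; roots over the other children agree with the label of
        \<open>j\<close> up to the level of \<open>e\<close>.\<close>
      define f where "f d = (if d = c then nat (P + int (lev e * h c)) else lev e * h d)" for d
      have "[:tt ^ nat (P + int (lev e * n)):] dvd [:tt ^ ((\<Sum>d\<in>ch e. f d) + lev e * k):]"
      proof -
        have "(\<Sum>d\<in>ch e. f d) = nat (P + int (lev e * h c)) + lev e * (\<Sum>d\<in>ch e - {c}. h d)"
          using c(1) finite_ch by (simp add: sum.remove[of _ c] f_def sum_distrib_left)
        moreover have "lev e * n = lev e * h c + lev e * (\<Sum>d\<in>ch e - {c}. h d) + lev e * k"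
          using c(1) finite_ch by (simp add: k[symmetric] sum.remove[of _ c] distrib_left)
        ultimately have "nat (P + int (lev e * n)) \<le> (\<Sum>d\<in>ch e. f d) + lev e * k"
          by (simp del: of_nat_mult)
        then show ?thesis by (simp only: const_poly_dvd_const_poly_iff le_imp_power_dvd)
      qed
      also have "\<dots> dvd pcompose R [:\<sigma> j, tt ^ lev j:]"
      proof (rule dvdR)
        show "[:tt ^ f d:] dvd pcompose (Q d) [:\<sigma> j, tt ^ lev j:]" if d: "d \<in> ch e" for d
        proof (cases "d = c")
          case True
          have "P - int (h c) + int (lev c * h c) = P + int (lev e * h c)"
            unfolding level_child[OF c(1)] by simp
          then show ?thesis using Qb[OF c j(2)] True by (simp only: f_def if_True simp_thms)
        next
          case False
          then show ?thesis using Qa[OF d ejl[OF d] j] by (simp only: f_def if_False simp_thms)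
        qed
        show "[:tt ^ (lev e * k):] dvd pcompose ([:- \<sigma> i, 1:] ^ k) [:\<sigma> j, tt ^ lev j:]"
          by (rule lin[OF i(2) j(1) i(1) j(2)])
      qed
      finally show ?thesis .
    qed
    have "realizes e P n R" unfolding realizes_def by (intro conjI allI impI lc dg 1 2)
    then show ?case by blast
  qed
qed

lemma element_of_pot:
  assumes "pot root (int N) n"
  obtains a Q where "a \<in> \<A>" "x ^ N * a = fract_poly Q" "degree Q = n" "coeff Q n = 1"
proof -
  obtain Q where real: "realizes root (int N) n Q" using pot_realize[OF assms] ..
  note Q = real[unfolded realizes_def, THEN conjunct1]
    real[unfolded realizes_def, THEN conjunct2, THEN conjunct1]
  have QN: "[:tt ^ N:] dvd pcompose Q [:\<sigma> j, tt ^ lev j:]" if "j \<in> L" for j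
  proof -
    have "[:tt ^ nat (int N + int (lev root * n)):] dvd pcompose Q [:\<sigma> j, tt ^ lev j:]"
      using real[unfolded realizes_def, THEN conjunct2, THEN conjunct2, THEN conjunct2]
        root_le[OF leaf_in[OF that]] that by simp
    then show ?thesis by (simp add: level_root)
  qed
  define a where "a = [:1 / X ^ N:] * fract_poly Q"
  have inv: "x ^ N * [:1 / X ^ N:] = 1" by (simp add: poly_const_pow pCons_one)
  have "a \<in> \<A>"
    unfolding \<A>_def
  proof (intro CollectI ballI)
    fix j assume j: "j \<in> L"
    obtain F where F: "pcompose Q [:\<sigma> j, tt ^ lev j:] = [:tt ^ N:] * F" using QN[OF j] by (rule dvdE)
    have "chart j a = [:1 / X ^ N:] * (x ^ N * fract_poly F)"
      unfolding a_def chart_simps chart_fract_poly F xpow_eq by (simp only: fract_poly_mult)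
    also have "\<dots> = (x ^ N * [:1 / X ^ N:]) * fract_poly F" by (simp only: mult_ac)
    also have "\<dots> = fract_poly F" unfolding inv by (rule mult_1)
    finally show "chart j a \<in> \<O>" by simp
  qed
  moreover have "x ^ N * a = fract_poly Q" unfolding a_def mult.assoc[symmetric] inv by (rule mult_1)
  moreover have "coeff Q n = 1" using Q(1) unfolding Q(2) .
  ultimately show ?thesis using that[of a Q] Q(2) by simp
qed

end

section \<open>Leading exponents\<close>

lemma coeff_mult_bounded:
  assumes "degree p \<le> n" "degree q \<le> m"
  shows "coeff (p * q) (n + m) = coeff p n * coeff q m"
proof -
  have "coeff (p * q) (n + m) = (\<Sum>i\<le>n + m. coeff p i * coeff q (n + m - i))"
    by (rule coeff_mult)
  also have "\<dots> = (\<Sum>i\<in>{n}. coeff p i * coeff q (n + m - i))"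
  proof (rule sum.mono_neutral_right)
    show "\<forall>i\<in>{..n + m} - {n}. coeff p i * coeff q (n + m - i) = 0"
    proof
      fix i assume i: "i \<in> {..n + m} - {n}"
      show "coeff p i * coeff q (n + m - i) = 0"
      proof (cases "i < n")
        case True
        then have "degree q < n + m - i" using assms i by simp
        then show ?thesis by (simp add: coeff_eq_0)
      next
        case False
        then have "degree p < i" using assms i by simp
        then show ?thesis by (simp add: coeff_eq_0)
      qed
    qed
  qed auto
  finally show ?thesis by simp
qed

text \<open>\<open>bounded G i n c\<close>: in the lexicographic order that compares the degree in \<open>y\<close> first, \<open>G\<close> is
  \<open>c x\<^sup>i y\<^sup>n\<close> plus smaller monomials; \<open>c = 0\<close> is allowed.\<close>

definition bounded :: "'k::field poly poly \<Rightarrow> nat \<Rightarrow> nat \<Rightarrow> 'k \<Rightarrow> bool" where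
  "bounded G i n c \<longleftrightarrow> degree G \<le> n \<and> degree (coeff G n) \<le> i \<and> coeff (coeff G n) i = c"

lemma bounded_add: "bounded F i n c \<Longrightarrow> bounded G i n d \<Longrightarrow> bounded (F + G) i n (c + d)"
  by (auto simp: bounded_def intro!: degree_add_le)

lemma bounded_diff: "bounded F i n c \<Longrightarrow> bounded G i n d \<Longrightarrow> bounded (F - G) i n (c - d)"
  by (auto simp: bounded_def intro!: degree_diff_le)

lemma bounded_mult:
  assumes "bounded F i n c" "bounded G j m d"
  shows "bounded (F * G) (i + j) (n + m) (c * d)"
proof -
  have "coeff (F * G) (n + m) = coeff F n * coeff G m"
    using assms by (intro coeff_mult_bounded) (auto simp: bounded_def)
  moreover have "degree (F * G) \<le> n + m"
    using degree_mult_le[of F G] assms by (simp add: bounded_def)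
  moreover have "degree (coeff F n * coeff G m) \<le> i + j"
    using degree_mult_le[of "coeff F n" "coeff G m"] assms by (simp add: bounded_def)
  ultimately show ?thesis using assms by (simp add: bounded_def coeff_mult_bounded)
qed

lemma bounded_of_nat: "bounded G i n c \<Longrightarrow> bounded (of_nat k * G) i n (of_nat k * c)"
  using bounded_mult[of "of_nat k" 0 0 "of_nat k" G i n c]
  by (simp add: bounded_def of_nat_poly)

lemma bounded_zero: "bounded 0 i n 0"
  by (simp add: bounded_def)

lemma coeff_max_degree:
  assumes "coeff p (max (degree p) (degree q)) = 0" "coeff q (max (degree p) (degree q)) = 0"
  shows "p = 0" "q = 0"
proof -
  have "p = 0 \<and> q = 0"
  proof (cases "degree p \<le> degree q")
    case True
    then have "q = 0" using assms(2) by (simp add: max_def)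
    then show ?thesis using assms(1) True by simp
  next
    case False
    then have "p = 0" using assms(1) by (simp add: max_def)
    with False show ?thesis by simp
  qed
  then show "p = 0" "q = 0" by auto
qed

definition Dx :: "'k::field poly poly \<Rightarrow> 'k poly poly" where
  "Dx G = map_poly pderiv G"

lemma coeff_Dx: "coeff (Dx G) n = pderiv (coeff G n)"
  by (simp add: Dx_def coeff_map_poly)

lemma Dx_pCons: "Dx (pCons c G) = pCons (pderiv c) (Dx G)"
  by (rule poly_eqI) (simp add: coeff_Dx coeff_pCons split: nat.splits)

text \<open>The Euler operator x d/dx replaces d/dx because it preserves exponents.\<close>

lemma bounded_tt_Dx:
  assumes "bounded G i n c"
  shows "bounded ([:tt:] * Dx G) i n (of_nat i * c)"
proof -
  have "degree (Dx G) \<le> n"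
    using assms by (intro degree_le) (auto simp: coeff_Dx bounded_def coeff_eq_0)
  moreover have "degree (tt * pderiv p) \<le> i \<and> coeff (tt * pderiv p) i = of_nat i * coeff p i"
    if "degree p \<le> i" for p :: "'a poly"
  proof -
    have "degree (tt * pderiv p) \<le> i"
      using that by (intro degree_le) (auto simp: coeff_pCons coeff_pderiv coeff_eq_0 split: nat.splits)
    then show ?thesis by (cases i) (auto simp: coeff_pderiv)
  qed
  ultimately show ?thesis
    using assms degree_smult_le[of tt "Dx G"] by (auto simp: bounded_def coeff_Dx)
qed

text \<open>The degree in y lost by differentiation is charged to \<open>F\<close>, which avoids a
  truncated n - 1; in the application \<open>F\<close> is x times the numerator of \<delta>
  y.\<close>

lemma bounded_pderiv_mult:
  assumes G: "bounded G i n c" and F: "bounded F j (Suc m) d"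
  shows "bounded (pderiv G * F) (i + j) (n + m) (of_nat n * c * d)"
proof (cases n)
  case 0
  then have "pderiv G = 0" using G by (simp add: bounded_def pderiv_eq_0_iff[symmetric])
      (metis degree_eq_zeroE pderiv_pCons pderiv_0 pderiv_singleton)
  then show ?thesis using 0 by (simp add: bounded_zero)
next
  case (Suc k)
  have "bounded (pderiv G) i k (of_nat n * c)"
  proof -
    have "degree (pderiv G) \<le> k"
      using G Suc by (intro degree_le) (auto simp: coeff_pderiv bounded_def coeff_eq_0)
    moreover have "coeff (pderiv G) k = smult (of_nat n) (coeff G n)"
      by (simp only: coeff_pderiv Suc of_nat_poly) simp
    ultimately show ?thesis
      using G degree_smult_le[of "of_nat n" "coeff G n"] by (auto simp: bounded_def)
  qed
  from bounded_mult[OF this F] show ?thesis by (simp add: Suc)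
qed

context labelled
begin

lemma lnd_zero: "lnd \<kappa> \<A> \<delta> \<Longrightarrow> \<delta> 0 = 0"
  using lnd_const[of \<kappa> \<A> \<delta> 0] by simp

lemma lnd_chain:
  assumes "lnd \<kappa> \<A> \<delta>"
  shows "\<delta> (fract_poly G) = fract_poly (Dx G) * \<delta> x + fract_poly (pderiv G) * \<delta> y"
proof -
  note mult = lnd_mult[OF assms] and add = lnd_add[OF assms] and const = lnd_const[OF assms]
  have inner: "\<delta> [:to_fract p:] = [:to_fract (pderiv p):] * \<delta> x" for p
  proof (induction p)
    case 0
    show ?case using lnd_zero[OF assms] by simp
  next
    case (pCons a p)
    have "\<delta> [:to_fract (pCons a p):] = \<delta> x * [:to_fract p:] + x * ([:to_fract (pderiv p):] * \<delta> x)"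
      unfolding to_fract_pCons[of a p] by (simp only: add mult const pCons.IH A_const A_closed A_x add_0_left)
    also have "\<dots> = [:to_fract p + X * to_fract (pderiv p):] * \<delta> x"
      by (simp add: smult_add_left mult.commute)
    also have "p + tt * pderiv p = pderiv (pCons a p)"
      by (simp add: pderiv_pCons)
    then have "to_fract p + X * to_fract (pderiv p) = to_fract (pderiv (pCons a p))"
      by (metis to_fract_add to_fract_mult)
    finally show ?case .
  qed
  show ?thesis
  proof (induction G)
    case 0
    show ?case using lnd_zero[OF assms] by (simp add: Dx_def)
  next
    case (pCons c G)
    have "\<delta> (fract_poly (pCons c G)) = [:to_fract (pderiv c):] * \<delta> x + (\<delta> y * fract_poly G
        + y * (fract_poly (Dx G) * \<delta> x + fract_poly (pderiv G) * \<delta> y))"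
      unfolding fract_poly_pCons by (simp only: add mult inner[of c] pCons.IH A_const A_closed A_y A_fract_poly)
    also have "\<dots> = ([:to_fract (pderiv c):] + y * fract_poly (Dx G)) * \<delta> x
        + (fract_poly G + y * fract_poly (pderiv G)) * \<delta> y"
      by (simp only: distrib_left distrib_right mult_ac add_ac)
    also have "[:to_fract (pderiv c):] + y * fract_poly (Dx G) = fract_poly (Dx (pCons c G))"
      by (cases "c = 0 \<and> Dx G = 0") (auto simp: Dx_pCons map_poly_pCons)
    also have "fract_poly G + y * fract_poly (pderiv G) = fract_poly (pderiv (pCons c G))"
      by (simp add: pderiv_pCons map_poly_pCons)
    finally show ?case .
  qed
qed

definition leading :: "'k poly fract poly \<Rightarrow> int \<Rightarrow> nat \<Rightarrow> bool" where
  "leading a p n \<longleftrightarrow> a \<in> \<A> \<and>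
    (\<exists>N G i c. x ^ N * a = fract_poly G \<and> bounded G i n c \<and> c \<noteq> 0 \<and> p = int i - int N)"

lemma leading_nonzero: "leading a p n \<Longrightarrow> a \<noteq> 0"
  by (auto simp: leading_def bounded_def)

lemma pot_of_leading: "leading a p n \<Longrightarrow> pot root (- p) n"
proof -
  assume "leading a p n"
  then obtain N G i c where *: "a \<in> \<A>" "x ^ N * a = fract_poly G" "bounded G i n c" "c \<noteq> 0" "p = int i - int N"
    by (auto simp: leading_def)
  then have "pot root (int N - int i) n"
    by (intro pot_of_element[OF *(1,2)]) (auto simp: bounded_def)
  with * show ?thesis by simp
qed

lemma leading_of_pot: "pot root (int N) n \<Longrightarrow> \<exists>a. leading a (- int N) n"
proof -
  assume "pot root (int N) n"
  then obtain a Q where "a \<in> \<A>" "x ^ N * a = fract_poly Q" "degree Q = n" "coeff Q n = 1"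
    using element_of_pot by metis
  then have "leading a (- int N) n"
    unfolding leading_def bounded_def by (intro conjI exI[of _ N] exI[of _ Q] exI[of _ 0] exI[of _ 1]) auto
  then show ?thesis ..
qed

lemma leading_x: "leading x 1 0" and leading_y: "leading y 0 1"
proof -
  show "leading x 1 0"
    unfolding leading_def bounded_def
    by (intro conjI exI[of _ 0] exI[of _ "[:tt:]"] exI[of _ "1::nat"] exI[of _ 1] A_x)
      (auto simp: map_poly_pCons)
  show "leading y 0 1"
    unfolding leading_def bounded_def
    by (intro conjI exI[of _ 0] exI[of _ "[:0, 1:] :: 'k poly poly"] exI[of _ "0::nat"] exI[of _ 1] A_y)
      (auto simp: map_poly_pCons)
qed

text \<open>By the chain rule, \<delta> acts on x^p y^n as multiplication by p \<delta> x / x + n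
  \<delta> y / y. The pair (\<open>e1\<close>, \<open>e2\<close>) is a common leading exponent of
  the two quotients, and \<open>c1\<close>, \<open>c2\<close> are their coefficients there, not both
  zero.\<close>

lemma lnd_shift:
  assumes lnd: "lnd \<kappa> \<A> \<delta>" and "\<delta> x \<noteq> 0"
  obtains e1 :: int and e2 :: nat and c1 c2 :: 'k where "(c1, c2) \<noteq> (0, 0)"
    "\<forall>a p n. leading a p n \<longrightarrow> of_int p * c1 + of_nat n * c2 \<noteq> 0 \<longrightarrow> leading (\<delta> a) (p + e1) (n + e2)"
proof -
  note cl = lnd_closed[OF lnd]
  obtain M1 p1 where p1: "x ^ M1 * \<delta> x = fract_poly p1" using laurent[OF cl[OF A_x]] .
  obtain M2 q1 where q1: "x ^ M2 * \<delta> y = fract_poly q1" using laurent[OF cl[OF A_y]] .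
  define M p q where "M = M1 + M2" and "p = [:tt ^ M2:] * p1" and "q = [:tt ^ M1:] * q1"
  have p: "x ^ M * \<delta> x = fract_poly p"
    unfolding M_def p_def fract_poly_mult xpow_eq[symmetric] p1[symmetric] by (simp only: power_add mult_ac)
  have q: "x ^ M * \<delta> y = fract_poly q"
    unfolding M_def q_def fract_poly_mult xpow_eq[symmetric] q1[symmetric] by (simp only: power_add mult_ac)
  have p0: "p \<noteq> 0"
  proof
    assume "p = 0"
    then have "x ^ M * \<delta> x = 0" using p by simp
    with assms(2) show False by simp
  qed
  \<comment> \<open>The y-degree of \<delta> y counts one less because of the division by y;
    likewise \<open>tt * q\<close> instead of \<open>q\<close> accounts for the division of \<delta>
    x by x.\<close>
  define e2 where "e2 = max (degree p) (degree q - 1)"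
  define E where "E = max (degree (coeff p e2)) (degree (coeff ([:tt:] * q) (Suc e2)))"
  define c1 c2 where "c1 = coeff (coeff p e2) E" and "c2 = coeff (coeff ([:tt:] * q) (Suc e2)) E"
  have bp: "bounded p E e2 c1"
    by (simp add: bounded_def c1_def E_def e2_def)
  have bq: "bounded ([:tt:] * q) E (Suc e2) c2"
    using degree_smult_le[of tt q] by (auto simp: bounded_def c2_def E_def e2_def)
  have c12: "(c1, c2) \<noteq> (0, 0)"
  proof -
    have "coeff p e2 \<noteq> 0 \<or> coeff ([:tt:] * q) (Suc e2) \<noteq> 0"
    proof (cases "degree q - 1 \<le> degree p")
      case True
      then have "e2 = degree p" by (simp add: e2_def)
      with p0 show ?thesis by simp
    next
      case False
      then have "degree q = Suc e2" "q \<noteq> 0" by (auto simp: e2_def)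
      then show ?thesis by (auto simp flip: \<open>degree q = Suc e2\<close>)
    qed
    then show ?thesis
      unfolding c1_def c2_def E_def prod.inject
      using coeff_max_degree[of "coeff p e2" "coeff ([:tt:] * q) (Suc e2)"] by blast
  qed
  define e1 where "e1 = int E - 1 - int M"
  have "leading (\<delta> a) (k + e1) (n + e2)"
    if lead: "leading a k n" and nz: "of_int k * c1 + of_nat n * c2 \<noteq> 0" for a k n
  proof -
    obtain N G i c where a: "a \<in> \<A>" "x ^ N * a = fract_poly G" "bounded G i n c" "c \<noteq> 0" "k = int i - int N"
      using lead by (auto simp: leading_def)
    \<comment> \<open>The numerator of \<delta> a over x^(N + M + 1), from the product rule for
      \<open>x ^ N * a\<close>; the term with \<open>of_nat N\<close> turns the exponent i of
      \<open>G\<close> into that of \<open>a\<close>.\<close>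
    define G' where "G' = ([:tt:] * Dx G - of_nat N * G) * p + pderiv G * ([:tt:] * q)"
    have xN: "x * \<delta> (x ^ m) = of_nat m * x ^ m * \<delta> x" for m
    proof (induction m)
      case 0
      show ?case using lnd_const[OF lnd, of 1] by (simp add: pCons_one)
    next
      case (Suc m)
      have "x * \<delta> (x ^ Suc m) = x * (x ^ m * \<delta> x) + x * (x * \<delta> (x ^ m))"
        by (simp only: power_Suc lnd_mult[OF lnd A_x A_power[OF A_x]] distrib_left mult_ac)
      also have "\<dots> = of_nat (Suc m) * x ^ Suc m * \<delta> x"
        unfolding Suc.IH by (simp only: power_Suc of_nat_Suc distrib_left distrib_right mult_1 mult_ac add_ac)
      finally show ?case .
    qed
    have tx: "fract_poly [:tt:] = x" by (simp add: map_poly_pCons)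
    have fN: "fract_poly (of_nat N) = of_nat N" by (induction N) simp_all
    have comm1: "w = u - n * (z * v) * d" if "u = n * z * d * v + w" for u v w n z d :: "'k poly fract poly"
      using that by (simp add: algebra_simps)
    have comm2: "m * (z * (f * d + g * e) - n * h * d) = (z * f - n * h) * (m * d) + g * (z * (m * e))"
      for m z f d g e n h :: "'k poly fract poly"
      by (simp add: algebra_simps)
    have "x * \<delta> (fract_poly G) = x * \<delta> (x ^ N) * a + x * x ^ N * \<delta> a"
      unfolding a(2)[symmetric] lnd_mult[OF lnd A_power[OF A_x] a(1)] by (simp only: distrib_left mult_ac)
    then have 1: "x * x ^ N * \<delta> a = x * \<delta> (fract_poly G) - of_nat N * (x ^ N * a) * \<delta> x"
      unfolding xN by (rule comm1)
    have "x ^ Suc (N + M) * \<delta> a = x ^ M * (x * x ^ N * \<delta> a)"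
      by (simp only: power_Suc power_add mult_ac)
    also have "\<dots> = (x * fract_poly (Dx G) - of_nat N * fract_poly G) * (x ^ M * \<delta> x)
        + fract_poly (pderiv G) * (x * (x ^ M * \<delta> y))"
      unfolding 1 a(2) lnd_chain[OF lnd, of G] by (rule comm2)
    also have "\<dots> = fract_poly G'"
      unfolding p q G'_def by (simp only: fract_poly_add fract_poly_diff fract_poly_mult tx fN)
    finally have eq: "x ^ Suc (N + M) * \<delta> a = fract_poly G'" .
    have "bounded G' (i + E) (n + e2) ((of_nat i * c - of_nat N * c) * c1 + of_nat n * c * c2)"
      unfolding G'_def
      by (intro bounded_add bounded_mult bounded_diff bounded_tt_Dx bounded_of_nat bounded_pderiv_mult a bp bq)
    moreover have "(of_nat i * c - of_nat N * c) * c1 + of_nat n * c * c2 = c * (of_int k * c1 + of_nat n * c2)"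
      by (simp add: a(5) algebra_simps)
    ultimately have bG: "bounded G' (i + E) (n + e2) (c * (of_int k * c1 + of_nat n * c2))" by simp
    have ne: "c * (of_int k * c1 + of_nat n * c2) \<noteq> 0" using nz a(4) by simp
    have ke: "k + e1 = int (i + E) - int (Suc (N + M))" by (simp add: e1_def a(5))
    show ?thesis
      unfolding leading_def
      by (rule conjI[OF lnd_closed[OF lnd a(1)]], rule exI[of _ "Suc (N + M)"], rule exI[of _ G'],
          rule exI[of _ "i + E"], rule exI, intro conjI, rule eq, rule bG, rule ne, rule ke)
  qed
  then have "\<forall>a p n. leading a p n \<longrightarrow> of_int p * c1 + of_nat n * c2 \<noteq> 0 \<longrightarrow> leading (\<delta> a) (p + e1) (n + e2)"
    by blast
  with c12 show ?thesis by (rule that)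
qed

end

context labelled
begin

theorem comb_if_lnd_moves_x:
  assumes lnd: "lnd \<kappa> \<A> \<delta>" and "\<delta> x \<noteq> 0"
  shows "comb \<Gamma> r"
proof -
  obtain e1 :: int and e2 :: nat and c1 c2 :: 'k where c12: "(c1, c2) \<noteq> (0, 0)"
    and shift': "\<forall>a p n. leading a p n \<longrightarrow> of_int p * c1 + of_nat n * c2 \<noteq> 0 \<longrightarrow> leading (\<delta> a) (p + e1) (n + e2)"
    by (rule lnd_shift[OF assms])
  note shift = shift'[rule_format]
  define l where "l = of_int e1 * c1 + of_nat e2 * c2"
  \<comment> \<open>Each application of \<delta> changes the multiplier by l, its value at e. As
    long as it is nonzero the iterates have leading exponents and do not vanish, so nilpotency
    forces it to become zero; J is the first such step.\<close>
  have orbit: "\<exists>J. of_int p * c1 + of_nat n * c2 + of_nat J * l = 0 \<and>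
      (\<forall>j\<le>J. \<exists>b. leading b (p + int j * e1) (n + j * e2))" if a: "leading a p n" for a p n
  proof -
    let ?z = "\<lambda>j. of_int p * c1 + of_nat n * c2 + of_nat j * l = 0"
    have step: "(\<forall>i<j. \<not> ?z i) \<Longrightarrow> leading ((\<delta> ^^ j) a) (p + int j * e1) (n + j * e2)" for j
    proof (induction j)
      case (Suc j)
      then have "\<not> ?z j" "leading ((\<delta> ^^ j) a) (p + int j * e1) (n + j * e2)" by auto
      moreover have "of_int (p + int j * e1) * c1 + of_nat (n + j * e2) * c2
          = of_int p * c1 + of_nat n * c2 + of_nat j * l"
        by (simp add: l_def algebra_simps)
      ultimately have "leading (\<delta> ((\<delta> ^^ j) a)) (p + int j * e1 + e1) (n + j * e2 + e2)"
        by (intro shift) auto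
      then show ?case by (simp add: algebra_simps)
    qed (simp add: a)
    have ex: "\<exists>j. ?z j"
    proof (rule ccontr)
      assume no: "\<not> (\<exists>j. ?z j)"
      obtain m where "(\<delta> ^^ m) a = 0" using lnd_nilpotent[OF lnd, of a] a by (auto simp: leading_def)
      moreover have "leading ((\<delta> ^^ m) a) (p + int m * e1) (n + m * e2)" using no by (intro step) blast
      ultimately show False using leading_nonzero by blast
    qed
    define J where "J = (LEAST j. ?z j)"
    have "?z J" unfolding J_def by (rule LeastI_ex[OF ex])
    moreover have "\<not> ?z i" if "i < J" for i using not_less_Least[OF that[unfolded J_def]] .
    then have "\<exists>b. leading b (p + int j * e1) (n + j * e2)" if "j \<le> J" for j
      using step[of j] that by (meson less_le_trans)
    ultimately show ?thesis by blast
  qed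
  obtain B where B: "c1 + of_nat B * l = 0" "\<And>j. j \<le> B \<Longrightarrow> \<exists>b. leading b (1 + int j * e1) (j * e2)"
    using orbit[OF leading_x] by auto
  obtain A where A: "c2 + of_nat A * l = 0" "\<And>j. j \<le> A \<Longrightarrow> \<exists>b. leading b (int j * e1) (1 + j * e2)"
    using orbit[OF leading_y] by auto
  have c: "c1 = - (of_nat B * l)" "c2 = - (of_nat A * l)"
    using A(1) B(1) by (simp_all add: add_eq_0_iff)
  have l0: "l \<noteq> 0" using c c12 by auto
  \<comment> \<open>The value l of the form at e, expressed through the two stopping times, gives
    the Bezout relation.\<close>
  have "of_int (e1 * int B + int e2 * int A) * l = - l"
    by (subst (2) l_def) (simp add: c algebra_simps)
  then have "of_int (e1 * int B + int e2 * int A) * l = of_int (- 1) * l" by simp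
  then have bez: "e1 * int B + int e2 * int A = - 1"
    by (simp only: mult_right_cancel[OF l0] of_int_eq_iff)
  have B0: "B > 0"
  proof (rule ccontr)
    assume "\<not> B > 0"
    then have "int e2 * int A = - 1" using bez by simp
    moreover have "0 \<le> int e2 * int A" by simp
    ultimately show False by linarith
  qed
  have e1: "- e1 > 0"
  proof (rule ccontr)
    assume "\<not> - e1 > 0"
    then have "0 \<le> e1 * int B" by simp
    moreover have "0 \<le> int e2 * int A" by simp
    ultimately show False using bez by linarith
  qed
  have \<rho>_nonneg: "0 \<le> p * int B + int n * int A" if lead: "leading a p n" for a p n
  proof -
    obtain J where "of_int p * c1 + of_nat n * c2 + of_nat J * l = 0" using orbit[OF lead] by blast
    then have "of_int (int J) * l = of_int (p * int B + int n * int A) * l"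
      by (simp add: c algebra_simps)
    then have "int J = p * int B + int n * int A"
      by (simp only: mult_right_cancel[OF l0] of_int_eq_iff)
    then show ?thesis by linarith
  qed
  have "tight (int e2) (- e1) root"
    unfolding tight_def
  proof (rule exI[of _ "int A"], rule exI[of _ "int B"], intro conjI allI impI)
    show "0 < int B" using B0 by simp
    show "int B * P \<le> int A * int n" if "pot root P n" for P n
    proof (cases "P \<le> 0")
      case True
      then have "int B * P \<le> 0" by (simp add: mult_nonneg_nonpos)
      also have "0 \<le> int A * int n" by simp
      finally show ?thesis .
    next
      case False
      then have "pot root (int (nat P)) n" using that by simp
      then obtain a where "leading a (- int (nat P)) n" using leading_of_pot by blast
      from \<rho>_nonneg[OF this] False show ?thesis by (simp add: mult.commute)
    qed
    have "\<exists>b. leading b (1 + int B * e1) (B * e2)" using B(2)[of B] by simp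
    then have "pot root (- (1 + int B * e1)) (B * e2)" using pot_of_leading by blast
    moreover have "- (1 + int B * e1) = int e2 * int A" using bez by (simp add: algebra_simps)
    ultimately show "\<exists>n. int n = int e2 * int B \<and> pot root (int e2 * int A) n"
      by (intro exI[of _ "B * e2"]) simp
    have "\<exists>b. leading b (int A * e1) (1 + A * e2)" using A(2)[of A] by simp
    then have "pot root (- (int A * e1)) (1 + A * e2)" using pot_of_leading by blast
    moreover have "int (1 + A * e2) = - e1 * int B" using bez by (simp add: algebra_simps)
    ultimately show "\<exists>n. int n = - e1 * int B \<and> pot root (- e1 * int A) n"
      by (intro exI[of _ "1 + A * e2"]) (simp add: mult.commute)
    \<comment> \<open>One step before the orbit of x stops, \<rho> has the value 1.\<close>
    obtain B' where B': "B = Suc B'" using B0 by (cases B) auto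
    have "\<exists>b. leading b (1 + int B' * e1) (B' * e2)" using B(2)[of B'] B' by simp
    then have "pot root (- (1 + int B' * e1)) (B' * e2)" using pot_of_leading by blast
    moreover have "int A * int (B' * e2) - int B * (- (1 + int B' * e1)) = int B + int B' * (e1 * int B + int e2 * int A)"
      by (simp add: algebra_simps)
    then have "int A * int (B' * e2) - int B * (- (1 + int B' * e1)) = 1"
      unfolding bez using B' by simp
    ultimately show "\<exists>P n. pot root P n \<and> int A * int n - int B * P = 1" by blast
  qed
  moreover have "coprime (int e2) (- e1)"
  proof (rule coprimeI)
    fix d assume "d dvd int e2" "d dvd - e1"
    then have "d dvd e1 * int B + int e2 * int A" by (intro dvd_add) auto
    then show "is_unit d" unfolding bez by simp
  qed
  ultimately show ?thesis using comb_if_tight e1 by blast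
qed

end

section \<open>A second fibration\<close>

context labelled
begin

text \<open>The restriction of a regular function to the component of x = 0 at the leaf
  \<open>i\<close>, as a polynomial in the chart variable.\<close>

definition res :: "'e \<Rightarrow> 'k poly fract poly \<Rightarrow> 'k poly" where
  "res i a = red (THE q. chart i a = fract_poly q)"

lemma res_eq: "chart i a = fract_poly q \<Longrightarrow> res i a = red q"
  unfolding res_def by (rule arg_cong[of _ _ red]) auto

lemma A_chart:
  assumes "a \<in> \<A>" "i \<in> L"
  obtains q where "chart i a = fract_poly q" "res i a = red q"
  using assms res_eq by (auto simp: \<A>_def)

lemma res_hom:
  assumes "a \<in> \<A>" "b \<in> \<A>" "i \<in> L"
  shows "res i (a + b) = res i a + res i b" "res i (a - b) = res i a - res i b" "res i (a * b) = res i a * res i b"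
proof -
  obtain p where p: "chart i a = fract_poly p" "res i a = red p" using A_chart assms by blast
  obtain q where q: "chart i b = fract_poly q" "res i b = red q" using A_chart assms by blast
  have "chart i (a + b) = fract_poly (p + q)" "chart i (a - b) = fract_poly (p - q)" "chart i (a * b) = fract_poly (p * q)"
    by (simp_all add: p q)
  then show "res i (a + b) = res i a + res i b" "res i (a - b) = res i a - res i b" "res i (a * b) = res i a * res i b"
    unfolding p q by (simp_all only: res_eq red_simps)
qed

lemma res_const: "res i [:to_fract c:] = [:poly c 0:]"
  by (subst res_eq[of _ _ "[:c:]"]) (simp_all add: map_poly_pCons)

lemma res_0: "res i 0 = 0" and res_1: "res i 1 = 1"
  using res_const[of i 0] res_const[of i 1] by (simp_all add: pCons_one)

lemma res_x: "res i x = 0"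
  by (simp add: res_const)

lemma res_power: "a \<in> \<A> \<Longrightarrow> i \<in> L \<Longrightarrow> res i (a ^ n) = res i a ^ n"
  by (induction n) (simp_all add: res_1 res_hom A_power)

lemma res_prod: "i \<in> L \<Longrightarrow> (\<And>s. s \<in> S \<Longrightarrow> f s \<in> \<A>) \<Longrightarrow> res i (prod f S) = (\<Prod>s\<in>S. res i (f s))"
  by (induction S rule: infinite_finite_induct) (simp_all add: res_1 res_hom A_prod)

text \<open>The divisor of x is the reduced sum of these components, so vanishing on all of them is
  divisibility by x.\<close>

lemma divide_x:
  assumes "x * a \<in> \<A>" "\<And>i. i \<in> L \<Longrightarrow> res i (x * a) = 0"
  shows "a \<in> \<A>"
  unfolding \<A>_def
proof (intro CollectI ballI)
  fix i assume i: "i \<in> L"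
  then obtain q where q: "chart i (x * a) = fract_poly q" "res i (x * a) = red q" using A_chart assms by blast
  then have "red q = 0" using assms(2)[OF i] by simp
  then have "[:tt:] dvd q" by (simp only: red_eq_0_iff)
  then obtain q' where "q = [:tt:] * q'" by (rule dvdE)
  then have "x * chart i a = fract_poly ([:tt:] * q')"
    using q(1) by (simp only: chart_simps)
  then have "x * chart i a = x * fract_poly q'"
    by (simp only: fract_poly_mult) (simp add: map_poly_pCons)
  then have "chart i a = fract_poly q'"
    by (subst (asm) mult_left_cancel) auto
  then show "chart i a \<in> \<O>" by simp
qed

text \<open>On each component x (z^M a) restricts to zero; since \<open>z\<close> restricts to a
  nonzero polynomial and k[T] is a domain, x a restricts to zero already.\<close>

lemma cancel_z:
  assumes "z \<in> \<A>" "\<And>i. i \<in> L \<Longrightarrow> res i z \<noteq> 0" "x * a \<in> \<A>" "z ^ M * a \<in> \<A>"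
  shows "a \<in> \<A>"
proof (rule divide_x[OF assms(3)])
  fix i assume i: "i \<in> L"
  have "res i (x * a) * res i z ^ M = res i (x * a * z ^ M)"
    using assms i by (simp only: res_hom res_power A_power)
  also have "x * a * z ^ M = x * (z ^ M * a)" by (simp only: mult_ac)
  also have "res i \<dots> = 0" using assms(4) i by (simp only: res_hom A_x res_x mult_zero_left)
  finally show "res i (x * a) = 0" using assms(2)[OF i] by simp
qed

definition evp :: "'k poly fract poly \<Rightarrow> 'k poly \<Rightarrow> 'k poly fract poly" where
  "evp z p = poly (map_poly (\<lambda>c. \<kappa> c) p) z"

lemma \<kappa>_hom: "\<kappa> (a + b) = \<kappa> a + \<kappa> b" "\<kappa> (a * b) = \<kappa> a * \<kappa> b" "\<kappa> 0 = 0"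
  by (rule danielewski.\<kappa>_add danielewski.\<kappa>_mult danielewski.\<kappa>_zero)+

lemma evp_simps: "evp z 0 = 0" "evp z (pCons a p) = \<kappa> a + z * evp z p"
  by (simp_all add: evp_def map_poly_pCons)

lemma evp_add: "evp z (p + q) = evp z p + evp z q"
proof (induction p q rule: poly_induct2)
  case (pCons a p b q)
  have "evp z (pCons a p + pCons b q) = (\<kappa> a + \<kappa> b) + z * (evp z p + evp z q)"
    unfolding add_pCons evp_simps pCons \<kappa>_hom ..
  also have "\<dots> = evp z (pCons a p) + evp z (pCons b q)"
    unfolding evp_simps by (simp only: distrib_left add_ac)
  finally show ?case .
qed (simp add: evp_simps)

lemma evp_smult: "evp z (smult c p) = \<kappa> c * evp z p"
proof (induction p)
  case (pCons a p)
  show ?case unfolding smult_pCons evp_simps pCons.IH \<kappa>_hom by (simp only: distrib_left mult_ac)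
qed (simp add: evp_simps)

lemma evp_mult: "evp z (p * q) = evp z p * evp z q"
proof (induction p)
  case (pCons a p)
  have "evp z (pCons a p * q) = \<kappa> a * evp z q + (\<kappa> 0 + z * (evp z p * evp z q))"
    unfolding mult_pCons_left evp_add evp_smult evp_simps(2) pCons.IH ..
  also have "\<dots> = evp z (pCons a p) * evp z q"
    unfolding evp_simps \<kappa>_hom by (simp only: distrib_left distrib_right mult_ac add_0_left)
  finally show ?case .
qed (simp add: evp_simps)

lemma evp_const: "evp z [:c:] = \<kappa> c" and evp_var: "evp z [:0, 1:] = z" and evp_1: "evp z 1 = 1"
proof -
  show c: "evp z [:c:] = \<kappa> c" for c by (simp only: evp_simps mult_zero_right add_0_right)
  show "evp z 1 = 1" using c[of 1] danielewski.\<kappa>_one by (simp only: pCons_one)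
  then show "evp z [:0, 1:] = z"
    by (simp only: evp_simps \<kappa>_hom danielewski.\<kappa>_one add_0_left add_0_right mult_1_right mult_zero_right)
qed

lemma evp_power: "evp z (p ^ n) = evp z p ^ n"
  by (induction n) (simp_all only: power_0 power_Suc evp_1 evp_mult)

lemma evp_A: "z \<in> \<A> \<Longrightarrow> evp z p \<in> \<A>"
  by (induction p) (simp_all only: evp_simps A_0 A_closed A_const)

lemma res_evp: "z \<in> \<A> \<Longrightarrow> i \<in> L \<Longrightarrow> res i (evp z p) = pcompose p (res i z)"
proof (induction p)
  case (pCons a p)
  have "res i (evp z (pCons a p)) = [:a:] + res i z * pcompose p (res i z)"
    unfolding evp_simps using pCons
    by (simp only: res_hom A_closed A_const evp_A res_const poly_pCons poly_0 mult_zero_left add_0_right)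
  then show ?case by (simp only: pcompose_pCons)
qed (simp add: evp_simps res_0)

end

text \<open>Here \<open>z\<close> is a function that a second action leaves invariant, and \<open>s\<close> a coordinate on its fibres. That
  \<open>s - \<theta>\<close> vanishes on a component of \<open>x = 0\<close> on which \<open>z\<close> is not constant makes \<open>z\<close> and \<open>s\<close> algebraically
  independent.\<close>

locale slice = labelled \<Gamma> r \<sigma> for \<Gamma> :: "'e set" and r and \<sigma> :: "'e \<Rightarrow> 'k::field_char_0 poly" +
  fixes z s :: "'k poly fract poly" and i0 :: 'e and \<theta> :: 'k
  assumes z: "z \<in> \<A>" and s: "s \<in> \<A>" and i0: "i0 \<in> L"
    and res_z: "\<And>i. i \<in> L \<Longrightarrow> res i z \<noteq> 0"
    and res_z0: "degree (res i0 z) > 0"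
    and res_s: "res i0 (s - \<kappa> \<theta>) = 0" and s_nonconst: "s \<noteq> \<kappa> \<theta>"
begin

abbreviation evz :: "'k poly \<Rightarrow> 'k poly fract poly" where
  "evz \<equiv> evp z"

lemmas evz_simps = evp_simps[of z] and evz_add = evp_add[of z] and evz_smult = evp_smult[of z]
  and evz_mult = evp_mult[of z] and evz_const = evp_const[of z] and evz_var = evp_var[of z]
  and evz_1 = evp_1[of z] and evz_power = evp_power[of z] and evz_A = evp_A[OF z] and res_evz = res_evp[OF z]

definition ev :: "'k poly poly \<Rightarrow> 'k poly fract poly" where
  "ev G = poly (map_poly evz G) s"

lemma ev_simps: "ev 0 = 0" "ev (pCons a p) = evz a + s * ev p"
  by (simp_all add: ev_def map_poly_pCons evz_simps)

lemma ev_add: "ev (p + q) = ev p + ev q"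
proof (induction p q rule: poly_induct2)
  case (pCons a p b q)
  have "ev (pCons a p + pCons b q) = (evz a + evz b) + s * (ev p + ev q)"
    unfolding add_pCons ev_simps pCons evz_add ..
  also have "\<dots> = ev (pCons a p) + ev (pCons b q)"
    unfolding ev_simps by (simp only: distrib_left add_ac)
  finally show ?case .
qed (simp add: ev_simps)

lemma ev_smult: "ev (smult c p) = evz c * ev p"
proof (induction p)
  case (pCons a p)
  show ?case unfolding smult_pCons ev_simps pCons.IH evz_mult by (simp only: distrib_left mult_ac)
qed (simp add: ev_simps)

lemma ev_mult: "ev (p * q) = ev p * ev q"
proof (induction p)
  case (pCons a p)
  have "ev (pCons a p * q) = evz a * ev q + (evz 0 + s * (ev p * ev q))"
    unfolding mult_pCons_left ev_add ev_smult ev_simps(2) pCons.IH ..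
  also have "\<dots> = ev (pCons a p) * ev q"
    unfolding ev_simps evz_simps by (simp only: distrib_left distrib_right mult_ac add_0_left)
  finally show ?case .
qed (simp add: ev_simps)

lemma ev_const: "ev [:c:] = evz c" and ev_var: "ev [:0, 1:] = s"
proof -
  show c: "ev [:c:] = evz c" for c by (simp only: ev_simps mult_zero_right add_0_right)
  show "ev [:0, 1:] = s"
    by (simp only: ev_simps evz_simps evz_1 add_0_left add_0_right mult_1_right mult_zero_right)
qed

lemma ev_1: "ev 1 = 1"
  using ev_const[of 1] evz_1 by (simp only: pCons_one)

lemma ev_zpow: "ev (smult (tt ^ M) G) = z ^ M * ev G"
  by (simp only: ev_smult evz_power evz_var)

lemma ev_A: "ev G \<in> \<A>"
  by (induction G) (simp_all only: ev_simps A_0 A_closed evz_A s)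

lemma z_nonzero: "z \<noteq> 0"
  using res_z[OF i0] by (auto simp: res_0)

text \<open>After the maximal power of s - \<theta> is split off from a relation, the remaining
  factor restricts on the component of \<open>i0\<close>, where s = \<theta>, to a nonzero
  polynomial in the nonconstant restriction of \<open>z\<close>.\<close>

lemma ev_eq_0:
  assumes "ev G = 0"
  shows "G = 0"
proof (rule ccontr)
  assume "G \<noteq> 0"
  then obtain m H where m: "G = [:- [:\<theta>:], 1:] ^ m * H" "\<not> [:- [:\<theta>:], 1:] dvd H"
    using order_decomp[of G "[:\<theta>:]"] by blast
  have lin: "ev [:- [:\<theta>:], 1:] = s - \<kappa> \<theta>"
  proof -
    have e: "[:- [:\<theta>:], 1:] + [:[:\<theta>:]:] = [:0, 1:]" by simp
    have "ev [:- [:\<theta>:], 1:] + ev [:[:\<theta>:]:] = s"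
      unfolding ev_add[symmetric] e by (rule ev_var)
    then show ?thesis by (simp only: ev_const evz_const eq_diff_eq)
  qed
  have pw: "ev (p ^ n) = ev p ^ n" for p n
    by (induction n) (simp_all only: power_0 power_Suc ev_1 ev_mult)
  have "(s - \<kappa> \<theta>) ^ m * ev H = 0" using assms unfolding m(1) ev_mult pw lin .
  then have H0: "ev H = 0" using s_nonconst by simp
  have "res i0 (ev H) = pcompose (poly H [:\<theta>:]) (res i0 z)" for H
  proof (induction H)
    case (pCons a H)
    have ss: "res i0 s = [:\<theta>:]"
      using res_s res_hom(2)[OF s A_const[of "[:\<theta>:]"] i0] by (simp add: res_const)
    have "res i0 (ev (pCons a H)) = pcompose a (res i0 z) + [:\<theta>:] * pcompose (poly H [:\<theta>:]) (res i0 z)"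
      unfolding ev_simps using pCons
      by (simp only: res_hom A_closed s ev_A evz_A res_evz i0 ss)
    also have "\<dots> = pcompose (poly (pCons a H) [:\<theta>:]) (res i0 z)"
      by (simp add: pcompose_add pcompose_mult pcompose_smult)
    finally show ?case .
  qed (simp add: ev_simps res_0)
  from this[of H] have "poly H [:\<theta>:] = 0"
    using H0 res_z0 by (simp add: res_0 pcompose_eq_0_iff)
  with m(2) show False by (simp add: poly_eq_0_iff_dvd)
qed

lemma ev_inj: "ev G = ev H \<Longrightarrow> G = H"
proof -
  assume "ev G = ev H"
  moreover have "ev (G - H) + ev H = ev G" by (simp add: ev_add[symmetric])
  ultimately show ?thesis using ev_eq_0[of "G - H"] by simp
qed

text \<open>The regular functions lying in k[s, z, 1/z], described without forming the
  localisation.\<close>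

definition CA :: "'k poly fract poly set" where
  "CA = {a \<in> \<A>. \<exists>M G. z ^ M * a = ev G}"

lemma CA_I: "a \<in> \<A> \<Longrightarrow> z ^ M * a = ev G \<Longrightarrow> a \<in> CA"
  by (auto simp: CA_def)

lemma CA_A: "a \<in> CA \<Longrightarrow> a \<in> \<A>"
  by (simp add: CA_def)

lemma CA_ev: "ev G \<in> CA"
  by (rule CA_I[of _ 0]) (simp_all add: ev_A)

lemma CA_add:
  assumes "a \<in> CA" "b \<in> CA"
  shows "a + b \<in> CA"
proof -
  obtain M G where G: "z ^ M * a = ev G" using assms by (auto simp: CA_def)
  obtain N H where H: "z ^ N * b = ev H" using assms by (auto simp: CA_def)
  have "z ^ (M + N) * (a + b) = z ^ N * (z ^ M * a) + z ^ M * (z ^ N * b)"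
    by (simp only: power_add distrib_left distrib_right mult_ac)
  also have "\<dots> = ev (smult (tt ^ N) G + smult (tt ^ M) H)"
    by (simp only: G H ev_add ev_zpow)
  finally show ?thesis using assms by (intro CA_I) (auto intro: A_closed CA_A)
qed

lemma CA_mult:
  assumes "a \<in> CA" "b \<in> CA"
  shows "a * b \<in> CA"
proof -
  obtain M G where G: "z ^ M * a = ev G" using assms by (auto simp: CA_def)
  obtain N H where H: "z ^ N * b = ev H" using assms by (auto simp: CA_def)
  have "z ^ (M + N) * (a * b) = (z ^ M * a) * (z ^ N * b)"
    by (simp only: power_add mult_ac)
  also have "\<dots> = ev (G * H)" by (simp only: G H ev_mult)
  finally show ?thesis using assms by (intro CA_I) (auto intro: A_closed CA_A)
qed

lemma CA_const: "\<kappa> c \<in> CA" and CA_z: "z \<in> CA" and CA_s: "s \<in> CA"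
  using CA_ev[of "[:[:c:]:]"] CA_ev[of "[:[:0, 1:]:]"] CA_ev[of "[:0, 1:]"]
  by (simp_all only: ev_const ev_var evz_const evz_var)

lemma CA_1: "1 \<in> CA"
  using CA_const[of 1] danielewski.\<kappa>_one by simp

lemma CA_0: "0 \<in> CA"
  using CA_const[of 0] \<kappa>_hom by simp

lemma \<kappa>_minus_one: "\<kappa> (- 1) = - 1"
  using \<kappa>_hom(1)[of "- 1" 1] danielewski.\<kappa>_one \<kappa>_hom(3) by (simp add: eq_neg_iff_add_eq_0)

lemma CA_diff: "a \<in> CA \<Longrightarrow> b \<in> CA \<Longrightarrow> a - b \<in> CA"
  using CA_add[of a "\<kappa> (- 1) * b"] CA_mult[OF CA_const[of "- 1"], of b]
  unfolding \<kappa>_minus_one by simp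

lemma CA_prod: "(\<And>i. i \<in> S \<Longrightarrow> f i \<in> CA) \<Longrightarrow> prod f S \<in> CA"
  by (induction S rule: infinite_finite_induct) (auto intro: CA_1 CA_mult)

lemma CA_cancel_z:
  assumes "a \<in> \<A>" "z ^ M * a \<in> CA"
  shows "a \<in> CA"
proof -
  obtain N G where G: "z ^ N * (z ^ M * a) = ev G" using assms by (auto simp: CA_def)
  then have "z ^ (N + M) * a = ev G" by (simp only: power_add mult_ac)
  then show ?thesis by (rule CA_I[OF assms(1)])
qed

lemma CA_to_fract:
  assumes "x \<in> CA"
  shows "[:to_fract p:] \<in> CA"
proof (induction p)
  case (pCons c p)
  show ?case unfolding to_fract_pCons[of c p] by (intro CA_add CA_mult CA_const assms pCons.IH)
qed (simp add: CA_0)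

lemma CA_fract_poly:
  assumes "x \<in> CA" "y \<in> CA"
  shows "fract_poly G \<in> CA"
proof (induction G)
  case (pCons a G)
  show ?case
    unfolding fract_poly_pCons by (intro CA_add CA_mult CA_to_fract[OF assms(1)] assms(2) pCons.IH)
qed (simp add: CA_0)

end

context slice
begin

text \<open>\<open>DR K a d\<close>: \<open>d\<close> is the image of \<open>a\<close> under the derivation \<open>z\<^sup>K \<partial>/\<partial>s\<close>.\<close>

definition DR :: "nat \<Rightarrow> 'k poly fract poly \<Rightarrow> 'k poly fract poly \<Rightarrow> bool" where
  "DR K a d \<longleftrightarrow> d \<in> \<A> \<and> (\<exists>M G. z ^ M * a = ev G \<and> z ^ M * d = z ^ K * ev (pderiv G))"

text \<open>Two representations of \<open>a\<close> differ by powers of \<open>z\<close>, which are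
  constants for d/ds; hence the image does not depend on the representation.\<close>

lemma DR_eq:
  assumes "DR K a d" "z ^ M * a = ev G"
  shows "z ^ M * d = z ^ K * ev (pderiv G)"
proof -
  obtain N H where H: "z ^ N * a = ev H" "z ^ N * d = z ^ K * ev (pderiv H)"
    using assms(1) by (auto simp: DR_def)
  have "ev (smult (tt ^ N) G) = z ^ N * (z ^ M * a)" by (simp only: ev_zpow assms(2))
  also have "\<dots> = z ^ M * (z ^ N * a)" by (rule mult.left_commute)
  also have "\<dots> = ev (smult (tt ^ M) H)" by (simp only: ev_zpow H)
  finally have "smult (tt ^ N) G = smult (tt ^ M) H" by (rule ev_inj)
  then have "pderiv (smult (tt ^ N) G) = pderiv (smult (tt ^ M) H)" by simp
  then have e: "smult (tt ^ N) (pderiv G) = smult (tt ^ M) (pderiv H)" by (simp only: pderiv_smult)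
  have "z ^ N * (z ^ M * d) = z ^ M * (z ^ K * ev (pderiv H))" unfolding H(2)[symmetric] by (rule mult.left_commute)
  also have "\<dots> = z ^ K * ev (smult (tt ^ M) (pderiv H))" unfolding ev_zpow by (rule mult.left_commute)
  also have "\<dots> = z ^ N * (z ^ K * ev (pderiv G))" unfolding e[symmetric] ev_zpow by (rule mult.left_commute)
  finally show ?thesis using z_nonzero by simp
qed

lemma DR_unique: "DR K a d \<Longrightarrow> DR K a d' \<Longrightarrow> d = d'"
proof -
  assume d: "DR K a d" "DR K a d'"
  obtain M G where G: "z ^ M * a = ev G" using d(1) by (auto simp: DR_def)
  have "z ^ M * d = z ^ M * d'" using DR_eq[OF d(1) G] DR_eq[OF d(2) G] by simp
  then show ?thesis using z_nonzero by simp
qed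

lemma DR_add:
  assumes "DR K a d" "DR K b d'"
  shows "DR K (a + b) (d + d')"
proof -
  obtain M G where G: "z ^ M * a = ev G" "z ^ M * d = z ^ K * ev (pderiv G)" "d \<in> \<A>" using assms(1) by (auto simp: DR_def)
  obtain N H where H: "z ^ N * b = ev H" "z ^ N * d' = z ^ K * ev (pderiv H)" "d' \<in> \<A>" using assms(2) by (auto simp: DR_def)
  have e: "z ^ (M + N) * (a + b) = z ^ N * (z ^ M * a) + z ^ M * (z ^ N * b)" for a b
    by (simp only: power_add distrib_left distrib_right mult_ac)
  have "z ^ (M + N) * (a + b) = ev (smult (tt ^ N) G + smult (tt ^ M) H)"
    unfolding e G H by (simp only: ev_add ev_zpow)
  moreover have "z ^ (M + N) * (d + d') = z ^ K * ev (pderiv (smult (tt ^ N) G + smult (tt ^ M) H))"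
    unfolding e G H by (simp only: ev_add ev_zpow pderiv_add pderiv_smult distrib_left mult_ac)
  ultimately show ?thesis unfolding DR_def using A_closed(1)[OF G(3) H(3)] by blast
qed

lemma DR_mult:
  assumes "DR K a d" "DR K b d'" "a \<in> \<A>" "b \<in> \<A>"
  shows "DR K (a * b) (d * b + a * d')"
proof -
  obtain M G where G: "z ^ M * a = ev G" "z ^ M * d = z ^ K * ev (pderiv G)" "d \<in> \<A>" using assms(1) by (auto simp: DR_def)
  obtain N H where H: "z ^ N * b = ev H" "z ^ N * d' = z ^ K * ev (pderiv H)" "d' \<in> \<A>" using assms(2) by (auto simp: DR_def)
  have "z ^ (M + N) * (a * b) = (z ^ M * a) * (z ^ N * b)" by (simp only: power_add mult_ac)
  also have "\<dots> = ev (G * H)" by (simp only: G H ev_mult)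
  finally have 1: "z ^ (M + N) * (a * b) = ev (G * H)" .
  have "z ^ (M + N) * (d * b + a * d') = (z ^ M * d) * (z ^ N * b) + (z ^ M * a) * (z ^ N * d')"
    by (simp only: power_add distrib_left mult_ac)
  also have "\<dots> = z ^ K * ev (pderiv (G * H))"
    unfolding G H pderiv_mult ev_add ev_mult by (simp only: distrib_left mult_ac add_ac)
  finally have 2: "z ^ (M + N) * (d * b + a * d') = z ^ K * ev (pderiv (G * H))" .
  have "d * b + a * d' \<in> \<A>" by (intro A_closed assms(3,4) G(3) H(3))
  with 1 2 show ?thesis unfolding DR_def by blast
qed

lemma DR_const: "DR K (\<kappa> c) 0"
  unfolding DR_def
proof (intro conjI exI)
  show "z ^ 0 * \<kappa> c = ev [:[:c:]:]" by (simp only: ev_const evz_const power_0 mult_1)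
  show "z ^ 0 * 0 = z ^ K * ev (pderiv [:[:c:]:])" by (simp add: ev_simps)
qed (rule A_0)

lemma DR_ex_CA:
  assumes "a \<in> CA"
  shows "\<exists>K. \<forall>K'\<ge>K. \<exists>d. DR K' a d"
proof -
  obtain M G where G: "z ^ M * a = ev G" using assms by (auto simp: CA_def)
  have "\<exists>d. DR K' a d" if "K' \<ge> M" for K'
  proof -
    have "z ^ M * (z ^ (K' - M) * ev (pderiv G)) = z ^ K' * ev (pderiv G)"
      using that by (simp only: mult.assoc[symmetric] power_add[symmetric] le_add_diff_inverse)
    moreover have "z ^ (K' - M) * ev (pderiv G) \<in> \<A>" by (intro A_closed A_power z ev_A)
    ultimately show ?thesis unfolding DR_def using G by blast
  qed
  then show ?thesis by blast
qed

text \<open>One exponent K that serves x and y serves every regular function: an element is a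
  polynomial in x and y over a power of x, and the quotient rule divides only by x, which
  \<open>cancel_z\<close> permits.\<close>

lemma DR_ex:
  assumes gen: "\<A> \<subseteq> CA" and dx: "DR K x dx" and dy: "DR K y dy" and a: "a \<in> \<A>"
  shows "\<exists>d. DR K a d"
proof -
  have inner: "\<exists>d. DR K [:to_fract p:] d" for p
  proof (induction p)
    case 0
    show ?case using DR_const[of K 0] by (auto simp: \<kappa>_hom)
  next
    case (pCons c p)
    show ?case unfolding to_fract_pCons[of c p] using pCons.IH DR_add[OF DR_const[of K c] DR_mult[OF dx _ A_x A_const]] by blast
  qed
  have poly: "\<exists>d. DR K (fract_poly G) d" for G
  proof (induction G)
    case 0
    show ?case using DR_const[of K 0] by (auto simp: \<kappa>_hom)
  next
    case (pCons c G)
    obtain d where d: "DR K (fract_poly G) d" using pCons.IH by blast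
    obtain d' where d': "DR K [:to_fract c:] d'" using inner[of c] by blast
    show ?case unfolding fract_poly_pCons using DR_add[OF d' DR_mult[OF dy d A_y A_fract_poly]] by blast
  qed
  obtain N G where NG: "x ^ N * a = fract_poly G" using laurent[OF a] .
  have step: "\<exists>d. DR K a d" if "\<exists>d. DR K (x ^ N * a) d" "a \<in> \<A>" for N a
    using that
  proof (induction N arbitrary: a)
    case (Suc N)
    have xa: "x * a \<in> \<A>" using Suc.prems by (intro A_closed A_x)
    have "x ^ N * (x * a) = x ^ Suc N * a" by (simp only: power_Suc mult_ac)
    then have "\<exists>d. DR K (x ^ N * (x * a)) d" using Suc.prems(1) by simp
    then obtain c where c: "DR K (x * a) c" using Suc.IH[OF _ xa] by blast
    obtain M G where G: "z ^ M * a = ev G" using gen Suc.prems(2) by (auto simp: CA_def)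
    obtain N' H where H: "z ^ N' * x = ev H" "z ^ N' * dx = z ^ K * ev (pderiv H)" "dx \<in> \<A>"
      using dx by (auto simp: DR_def)
    \<comment> \<open>The value that the product rule for x a forces.\<close>
    define d where "d = [:1 / X:] * (c - a * dx)"
    have xd: "x * d = c - a * dx" by (simp add: d_def)
    have "z ^ (N' + M) * (x * a) = (z ^ N' * x) * (z ^ M * a)" by (simp only: power_add mult_ac)
    also have "\<dots> = ev (H * G)" by (simp only: G H ev_mult)
    finally have "z ^ (N' + M) * c = z ^ K * ev (pderiv (H * G))" by (rule DR_eq[OF c])
    also have "\<dots> = (z ^ N' * x) * (z ^ K * ev (pderiv G)) + (z ^ M * a) * (z ^ N' * dx)"
      unfolding G H pderiv_mult ev_add ev_mult by (simp only: distrib_left mult_ac add_ac)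
    finally have zc: "z ^ (N' + M) * c = (z ^ N' * x) * (z ^ K * ev (pderiv G)) + (z ^ M * a) * (z ^ N' * dx)" .
    have "z ^ N' * x * (z ^ M * d) = z ^ (N' + M) * (x * d)" by (simp only: power_add mult_ac)
    also have "\<dots> = z ^ (N' + M) * c - (z ^ M * a) * (z ^ N' * dx)"
      unfolding xd by (simp only: power_add right_diff_distrib mult_ac)
    also have "\<dots> = z ^ N' * x * (z ^ K * ev (pderiv G))" unfolding zc by simp
    finally have zd: "z ^ M * d = z ^ K * ev (pderiv G)"
      by (subst (asm) mult_left_cancel) (use z_nonzero in auto)
    have "d \<in> \<A>"
    proof (rule cancel_z[OF z res_z])
      show "x * d \<in> \<A>" unfolding xd using c H Suc.prems(2) by (intro A_closed) (auto simp: DR_def)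
      show "z ^ M * d \<in> \<A>" unfolding zd by (intro A_closed A_power z ev_A)
    qed
    with zd G show ?case unfolding DR_def by blast
  qed simp
  have "\<exists>d. DR K (x ^ N * a) d" unfolding NG by (rule poly)
  then show ?thesis using a by (rule step)
qed

theorem slice_lnd:
  assumes gen: "\<A> \<subseteq> CA"
  shows "\<exists>\<delta>. lnd \<kappa> \<A> \<delta> \<and> \<delta> x \<noteq> 0"
proof -
  obtain K1 where K1: "\<forall>K\<ge>K1. \<exists>d. DR K x d" using DR_ex_CA[OF subsetD[OF gen A_x]] ..
  obtain K2 where K2: "\<forall>K\<ge>K2. \<exists>d. DR K y d" using DR_ex_CA[OF subsetD[OF gen A_y]] ..
  define K where "K = K1 + K2"
  have K12: "K1 \<le> K" "K2 \<le> K" by (simp_all add: K_def)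
  obtain dx where dx: "DR K x dx" using K1[rule_format, OF K12(1)] ..
  obtain dy where dy: "DR K y dy" using K2[rule_format, OF K12(2)] ..
  define \<delta> where "\<delta> a = (THE d. DR K a d)" for a
  have \<delta>: "DR K a (\<delta> a)" if "a \<in> \<A>" for a
  proof -
    obtain d where "DR K a d" using DR_ex[OF gen dx dy \<open>a \<in> \<A>\<close>] by blast
    then show ?thesis unfolding \<delta>_def using theI[of "DR K a" d] DR_unique by blast
  qed
  have \<delta>_eq: "\<delta> a = d" if "DR K a d" for a d
    unfolding \<delta>_def using that DR_unique by blast
  have cl: "\<delta> a \<in> \<A>" if "a \<in> \<A>" for a
    using \<delta>[OF that] by (simp add: DR_def)
  have \<delta>0: "\<delta> 0 = 0" using \<delta>_eq[OF DR_const[of K 0]] by (simp add: \<kappa>_hom)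
  have pow0: "(\<delta> ^^ n) 0 = 0" for n by (induction n) (simp_all add: \<delta>0)
  have nil: "(\<delta> ^^ n) a = 0" if "a \<in> \<A>" "z ^ M * a = ev G" "degree G < n" for a M G n
    using that
  proof (induction n arbitrary: a G)
    case (Suc n)
    have 1: "z ^ M * \<delta> a = ev (smult (tt ^ K) (pderiv G))"
      unfolding ev_zpow by (rule DR_eq[OF \<delta>[OF Suc.prems(1)] Suc.prems(2)])
    have "(\<delta> ^^ Suc n) a = (\<delta> ^^ n) (\<delta> a)" by (simp add: funpow_Suc_right del: funpow.simps)
    also have "\<dots> = 0"
    proof (cases "degree G = 0")
      case True
      then have "pderiv G = 0" by (simp add: pderiv_eq_0_iff)
      then have "z ^ M * \<delta> a = 0" using 1 by (simp add: ev_simps)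
      then have "\<delta> a = 0" using z_nonzero by simp
      then show ?thesis by (simp add: pow0)
    next
      case False
      then have "degree (smult (tt ^ K) (pderiv G)) < n"
        using Suc.prems(3) by (simp add: degree_pderiv)
      then show ?thesis by (rule Suc.IH[OF cl[OF Suc.prems(1)] 1])
    qed
    finally show ?case .
  qed simp
  have "lnd \<kappa> \<A> \<delta>"
    unfolding lnd_def
  proof (intro conjI ballI allI)
    fix a b assume ab: "a \<in> \<A>" "b \<in> \<A>"
    show "\<delta> (a + b) = \<delta> a + \<delta> b" by (rule \<delta>_eq[OF DR_add[OF \<delta>[OF ab(1)] \<delta>[OF ab(2)]]])
    show "\<delta> (a * b) = \<delta> a * b + a * \<delta> b" by (rule \<delta>_eq[OF DR_mult[OF \<delta>[OF ab(1)] \<delta>[OF ab(2)] ab]])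
  next
    fix a assume a: "a \<in> \<A>"
    then show "\<delta> a \<in> \<A>" by (rule cl)
    obtain M G where "z ^ M * a = ev G" using gen a by (auto simp: CA_def)
    then show "\<exists>n. (\<delta> ^^ n) a = 0" using nil[OF a, of M G "Suc (degree G)"] by blast
  next
    show "\<delta> (\<kappa> c) = 0" for c by (rule \<delta>_eq[OF DR_const])
  qed
  moreover have "\<delta> x \<noteq> 0"
  proof
    assume 0: "\<delta> x = 0"
    obtain M G where G: "z ^ M * x = ev G" using gen A_x by (auto simp: CA_def)
    have "z ^ K * ev (pderiv G) = 0" using DR_eq[OF \<delta>[OF A_x] G] 0 by simp
    then have "pderiv G = 0" using z_nonzero ev_eq_0 by simp
    then have "degree G = 0" by (simp add: pderiv_eq_0_iff)
    then obtain g where g: "G = [:g:]" by (rule degree_eq_zeroE)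
    \<comment> \<open>If x were killed, z^M x would be a polynomial in z alone. On the component of
      \<open>i0\<close> x vanishes and z is not constant, so that polynomial would be zero.\<close>
    have "pcompose g (res i0 z) = res i0 (z ^ M * x)" unfolding G g ev_const by (rule res_evz[OF i0, symmetric])
    also have "\<dots> = 0" by (simp only: res_hom A_power z A_x i0 res_x mult_zero_right)
    finally have "g = 0" using res_z0 by (simp add: pcompose_eq_0_iff)
    then have "z ^ M * x = 0" using G g by (simp add: ev_simps)
    then show False using z_nonzero by simp
  qed
  ultimately show ?thesis by blast
qed

end

section \<open>Combs\<close>

lemma red_pderiv: "red (pderiv F) = pderiv (red F)"
  by (rule poly_eqI) (simp add: coeff_pderiv of_nat_poly)

text \<open>\<open>F = a + c x T + \<dots>\<close>, respectively \<open>F = a + \<dots>\<close>, where the dots stand for terms of \<open>x k[x]\<close> and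
  of \<open>x\<^sup>2 k[x, T]\<close>.\<close>

definition steep :: "'k::field_char_0 poly poly \<Rightarrow> 'k \<Rightarrow> 'k \<Rightarrow> bool" where
  "steep F c a \<longleftrightarrow> red F = [:a:] \<and> (\<exists>G. pderiv F = smult tt G \<and> red G = [:c:])"

definition flat :: "'k::field_char_0 poly poly \<Rightarrow> 'k \<Rightarrow> bool" where
  "flat F a \<longleftrightarrow> red F = [:a:] \<and> (\<exists>G. pderiv F = smult (tt ^ 2) G)"

lemma flat_const: "flat [:[:a:]:] a"
  unfolding flat_def by (intro conjI exI[of _ 0]) simp_all

lemma flat_1: "flat 1 1"
  using flat_const[of 1] by (simp add: pCons_one)

lemma flat_mult:
  assumes "flat F a" "flat G b"
  shows "flat (F * G) (a * b)"
proof -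
  obtain F' where F: "red F = [:a:]" "pderiv F = smult (tt ^ 2) F'" using assms(1) by (auto simp: flat_def)
  obtain G' where G: "red G = [:b:]" "pderiv G = smult (tt ^ 2) G'" using assms(2) by (auto simp: flat_def)
  have "pderiv (F * G) = smult (tt ^ 2) (F * G' + G * F')"
    by (simp only: pderiv_mult F G mult_smult_right smult_add_right)
  moreover have "red (F * G) = [:a * b:]" by (simp add: F G mult.commute)
  ultimately show ?thesis unfolding flat_def by blast
qed

lemma flat_prod: "(\<And>i. i \<in> S \<Longrightarrow> flat (f i) (g i)) \<Longrightarrow> flat (prod f S) (prod g S)"
proof (induction S rule: infinite_finite_induct)
  case (insert i S)
  then show ?case by (simp only: prod.insert not_False_eq_True) (intro flat_mult, auto)
qed (simp_all add: flat_1)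

lemma steep_flat_mult:
  assumes "steep F c a" "flat G b"
  shows "steep (F * G) (c * b) (a * b)"
proof -
  obtain F' where F: "red F = [:a:]" "pderiv F = smult tt F'" "red F' = [:c:]" using assms(1) by (auto simp: steep_def)
  obtain G' where G: "red G = [:b:]" "pderiv G = smult (tt ^ 2) G'" using assms(2) by (auto simp: flat_def)
  have "pderiv (F * G) = smult tt (smult tt (F * G') + G * F')"
    by (simp only: pderiv_mult F G mult_smult_right smult_add_right smult_smult power2_eq_square)
  moreover have "red (smult tt (F * G') + G * F') = [:c * b:]" by (simp add: F G mult.commute)
  moreover have "red (F * G) = [:a * b:]" by (simp add: F G mult.commute)
  ultimately show ?thesis unfolding steep_def by blast
qed

lemma flat_of_steep:
  assumes "steep F c a" "k > 0"
  shows "flat (smult (tt ^ k) F - [:[:b:]:]) (- b)"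
proof -
  obtain F' where F: "red F = [:a:]" "pderiv F = smult tt F'" using assms(1) by (auto simp: steep_def)
  obtain k' where k: "k = Suc k'" using assms(2) by (cases k) auto
  have "pderiv (smult (tt ^ k) F - [:[:b:]:]) = smult (tt ^ 2) (smult (tt ^ k') F')"
    by (simp add: pderiv_diff pderiv_smult pderiv_pCons F k power2_eq_square)
  moreover have "red (smult (tt ^ k) F - [:[:b:]:]) = [:- b:]" by (simp add: k)
  ultimately show ?thesis unfolding flat_def by blast
qed

text \<open>The comb in terms of levels and labels: a leaf i other than \<open>i0\<close> agrees
  with the label of \<open>i0\<close> exactly to order \<open>lev i - 1\<close>, and leaves of equal
  level differ from each other at the next order.\<close>

locale comb_chart = labelled \<Gamma> r \<sigma> for \<Gamma> :: "'e set" and r and \<sigma> :: "'e \<Rightarrow> 'k::field_char_0 poly" +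
  fixes i0 :: 'e and h :: nat
  assumes i0: "i0 \<in> L" and lev_i0: "lev i0 = Suc h"
    and lev_bounds: "\<And>i. i \<in> L \<Longrightarrow> 0 < lev i \<and> lev i \<le> Suc h"
    and dvd_i0: "\<And>i. i \<in> L \<Longrightarrow> tt ^ (lev i - 1) dvd \<sigma> i - \<sigma> i0"
    and not_dvd_i0: "\<And>i. i \<in> L \<Longrightarrow> lev i < Suc h \<Longrightarrow> \<not> tt ^ lev i dvd \<sigma> i - \<sigma> i0"
    and not_dvd: "\<And>i j. i \<in> L \<Longrightarrow> j \<in> L \<Longrightarrow> i \<noteq> j \<Longrightarrow> lev i = lev j \<Longrightarrow> \<not> tt ^ lev i dvd \<sigma> j - \<sigma> i"
begin

text \<open>The spine of the comb leads to \<open>i0\<close>, and \<open>ll i\<close> is the level at which the leaf \<open>i\<close> branches off.\<close>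

definition ll :: "'e \<Rightarrow> nat" where "ll i = lev i - 1"

definition stage :: "nat \<Rightarrow> 'e set" where "stage m = {i \<in> L. ll i = m}"

definition \<mu> :: "'e \<Rightarrow> 'k" where "\<mu> i = poly ((\<sigma> i - \<sigma> i0) div tt ^ ll i) 0"

text \<open>The constants are the leading data of the recursion below, seen from a leaf that has not
  branched off before level m: \<open>ww m\<close> is the value of \<open>W m\<close> there, and
  \<open>cc m\<close> is the factor by which the coordinate along the spine has been rescaled in
  \<open>u m\<close>.\<close>

primrec cw :: "nat \<Rightarrow> 'k \<times> 'k" where
  "cw 0 = (1, 1)"
| "cw (Suc m) = (let w = snd (cw m) * (\<Prod>i\<in>stage m. - (fst (cw m) * \<mu> i)) in (fst (cw m) * w, w))"

definition "cc m = fst (cw m)"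
definition "ww m = snd (cw m)"
definition "\<theta> i = cc (ll i) * \<mu> i"

text \<open>With \<open>q\<^sub>m\<close> the product of \<open>u\<^sub>m - \<theta>\<^sub>i\<close> over the leaves branching off at level \<open>m\<close>, the recursion reads
  \<open>x u\<^sub>m\<^sub>+\<^sub>1 = u\<^sub>m q\<^sub>0 \<cdots> q\<^sub>m\<close> for \<open>m < h\<close> and \<open>x u\<^sub>h\<^sub>+\<^sub>1 = q\<^sub>0 \<cdots> q\<^sub>h\<close>. The constant \<open>\<theta>\<^sub>i\<close> is the value of \<open>u\<^sub>m\<close> on the
  component of \<open>i\<close>.\<close>

primrec uW :: "nat \<Rightarrow> 'k poly fract poly \<times> 'k poly fract poly" where
  "uW 0 = (y - [:to_fract (\<sigma> i0):], 1)"
| "uW (Suc m) = (let q = \<Prod>i\<in>stage m. fst (uW m) - \<kappa> (\<theta> i)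
    in ([:1 / X:] * ((if m < h then fst (uW m) else 1) * q * snd (uW m)), snd (uW m) * q))"

definition "u m = fst (uW m)"
definition "W m = snd (uW m)"
definition "p i = u (ll i) - \<kappa> (\<theta> i)"
definition "q m = (\<Prod>i\<in>stage m. p i)"

lemma stage_L: "i \<in> stage m \<Longrightarrow> i \<in> L" and stage_ll: "i \<in> stage m \<Longrightarrow> ll i = m"
  by (simp_all add: stage_def)

lemma finite_stage: "finite (stage m)"
  using finite_L by (simp add: stage_def)

lemma lev_ll: "i \<in> L \<Longrightarrow> lev i = Suc (ll i)"
  using lev_bounds[of i] by (simp add: ll_def)

lemma ll_le: "i \<in> L \<Longrightarrow> ll i \<le> h"
  using lev_bounds[of i] lev_ll[of i] by simp

lemma ll_i0: "ll i0 = h"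
  by (simp add: ll_def lev_i0)

lemma q_eq: "(\<Prod>i\<in>stage m. u m - \<kappa> (\<theta> i)) = q m"
  unfolding q_def p_def by (rule prod.cong) (simp_all add: stage_ll)

lemma u_0: "u 0 = y - [:to_fract (\<sigma> i0):]" and W_0: "W 0 = 1"
  by (simp_all add: u_def W_def)

lemma u_Suc: "x * u (Suc m) = (if m < h then u m else 1) * q m * W m"
proof -
  have "u (Suc m) = [:1 / X:] * ((if m < h then u m else 1) * q m * W m)"
    unfolding q_eq[symmetric] by (simp only: u_def W_def uW.simps Let_def fst_conv)
  moreover have "x * ([:1 / X:] * a) = a" for a by simp
  ultimately show ?thesis by (simp only:)
qed

lemma W_Suc: "W (Suc m) = W m * q m"
  unfolding q_eq[symmetric] by (simp only: u_def W_def uW.simps Let_def snd_conv)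

lemma \<theta>_stage: "i \<in> stage m \<Longrightarrow> \<theta> i = cc m * \<mu> i"
  by (simp add: \<theta>_def stage_ll)

lemma ww_Suc: "ww (Suc m) = ww m * (\<Prod>i\<in>stage m. - \<theta> i)"
proof -
  have "(\<Prod>i\<in>stage m. - \<theta> i) = (\<Prod>i\<in>stage m. - (cc m * \<mu> i))"
    by (rule prod.cong) (simp_all add: \<theta>_stage)
  then show ?thesis by (simp add: ww_def cc_def Let_def)
qed

lemma cc_Suc: "cc (Suc m) = cc m * ww (Suc m)"
  by (simp add: ww_def cc_def Let_def)

lemma cw_0: "cc 0 = 1" "ww 0 = 1"
  by (simp_all add: cc_def ww_def)

lemma label_eq: "i \<in> L \<Longrightarrow> \<sigma> i - \<sigma> i0 = tt ^ ll i * ((\<sigma> i - \<sigma> i0) div tt ^ ll i)"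
  using dvd_i0[of i] by (simp add: ll_def)

lemma \<mu>_nonzero:
  assumes "i \<in> L" "ll i < h"
  shows "\<mu> i \<noteq> 0"
proof
  assume "\<mu> i = 0"
  then have "tt dvd (\<sigma> i - \<sigma> i0) div tt ^ ll i" by (simp only: \<mu>_def poly_0_iff_dvd)
  then have "tt ^ ll i * tt dvd \<sigma> i - \<sigma> i0"
    by (subst label_eq[OF assms(1)]) (rule mult_dvd_mono[OF dvd_refl])
  with not_dvd_i0[OF assms(1)] lev_ll[OF assms(1)] assms(2) show False by (simp add: mult.commute)
qed

lemma \<mu>_inj:
  assumes "i \<in> stage m" "j \<in> stage m" "i \<noteq> j"
  shows "\<mu> i \<noteq> \<mu> j"
proof
  define a b where "a = (\<sigma> i - \<sigma> i0) div tt ^ m" and "b = (\<sigma> j - \<sigma> i0) div tt ^ m"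
  assume "\<mu> i = \<mu> j"
  then have "poly (b - a) 0 = 0"
    using assms by (simp add: \<mu>_def stage_ll a_def b_def)
  then have "tt dvd b - a" by (simp only: poly_0_iff_dvd)
  then have "tt ^ m * tt dvd tt ^ m * (b - a)" by (rule mult_dvd_mono[OF dvd_refl])
  also have "tt ^ m * (b - a) = tt ^ m * b - tt ^ m * a" by (rule right_diff_distrib)
  also have "\<dots> = (\<sigma> j - \<sigma> i0) - (\<sigma> i - \<sigma> i0)"
    using label_eq[OF stage_L[OF assms(1)]] label_eq[OF stage_L[OF assms(2)]]
    unfolding stage_ll[OF assms(1)] stage_ll[OF assms(2)] a_def[symmetric] b_def[symmetric]
    by (simp only:)
  also have "\<dots> = \<sigma> j - \<sigma> i" by simp
  finally show False
    using not_dvd[OF stage_L[OF assms(1)] stage_L[OF assms(2)] assms(3)] lev_ll[OF stage_L[OF assms(1)]]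
      lev_ll[OF stage_L[OF assms(2)]] stage_ll[OF assms(1)] stage_ll[OF assms(2)]
    by (simp add: mult.commute)
qed

lemma cw_nonzero: "m \<le> h \<Longrightarrow> cc m \<noteq> 0 \<and> ww m \<noteq> 0"
proof (induction m)
  case (Suc m)
  have "- \<theta> i \<noteq> 0" if "i \<in> stage m" for i
    using Suc \<mu>_nonzero[OF stage_L[OF that]] stage_ll[OF that] by (simp add: \<theta>_def)
  then have "(\<Prod>i\<in>stage m. - \<theta> i) \<noteq> 0" using finite_stage by (simp add: prod_zero_iff)
  with Suc show ?case by (simp add: ww_Suc cc_Suc)
qed (simp add: cw_0)

lemma \<theta>_nonzero: "i \<in> L \<Longrightarrow> ll i < h \<Longrightarrow> \<theta> i \<noteq> 0"
  using cw_nonzero[of "ll i"] \<mu>_nonzero by (simp add: \<theta>_def)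

lemma \<theta>_inj: "i \<in> stage m \<Longrightarrow> j \<in> stage m \<Longrightarrow> i \<noteq> j \<Longrightarrow> \<theta> i \<noteq> \<theta> j"
  using cw_nonzero[of m] \<mu>_inj ll_le[OF stage_L] by (auto simp: \<theta>_stage stage_ll)

text \<open>Along a leaf that has not branched off before level m, \<open>u m\<close> is x^(ll i -
  m) times cc m (\<mu> i + x T), up to terms of x k[x] and of x^2 k[x, T]. The dependence on T must
  be known up to first order in x, because one division by x brings it to the component when the
  leaf branches off.\<close>

definition regular :: "nat \<Rightarrow> bool" where
  "regular m \<longleftrightarrow> u m \<in> \<A> \<and> W m \<in> \<A> \<and> (\<forall>i\<in>L. ll i < m \<longrightarrow> res i (W m) = 0) \<and>
    (\<forall>i\<in>L. m \<le> ll i \<longrightarrow>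
      (\<exists>V. chart i (u m) = fract_poly (smult (tt ^ (ll i - m)) V) \<and> steep V (cc m) (cc m * \<mu> i)) \<and>
      (\<exists>Y. chart i (W m) = fract_poly Y \<and> flat Y (ww m)))"

lemma regular_res_u:
  assumes "regular m" "i \<in> L" "m \<le> ll i"
  shows "res i (u m) = (if m = ll i then [:\<theta> i:] else 0)"
proof -
  obtain V where V: "chart i (u m) = fract_poly (smult (tt ^ (ll i - m)) V)" "steep V (cc m) (cc m * \<mu> i)"
    using assms unfolding regular_def by blast
  have "res i (u m) = red (smult (tt ^ (ll i - m)) V)" by (rule res_eq[OF V(1)])
  then show ?thesis using V(2) assms(3) by (auto simp: steep_def \<theta>_def power_0_left)
qed

lemma regular_p:
  assumes "regular m" "i \<in> stage m"
  shows "p i \<in> \<A>" "res i (p i) = 0"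
proof -
  have u: "u m \<in> \<A>" using assms(1) by (simp add: regular_def)
  show "p i \<in> \<A>" unfolding p_def stage_ll[OF assms(2)] by (intro A_closed u A_const)
  have "res i (u m) = [:\<theta> i:]"
    using regular_res_u[OF assms(1) stage_L[OF assms(2)]] stage_ll[OF assms(2)] by simp
  then show "res i (p i) = 0"
    unfolding p_def stage_ll[OF assms(2)]
    using res_hom(2)[OF u A_const stage_L[OF assms(2)]] by (simp add: res_const)
qed

lemma regular_q:
  assumes "regular m"
  shows "q m \<in> \<A>" "\<And>i. i \<in> stage m \<Longrightarrow> res i (q m) = 0"
proof -
  show "q m \<in> \<A>" unfolding q_def by (rule A_prod) (rule regular_p[OF assms])
  fix i assume i: "i \<in> stage m"
  have "res i (q m) = (\<Prod>j\<in>stage m. res i (p j))"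
    unfolding q_def by (rule res_prod[OF stage_L[OF i]]) (rule regular_p[OF assms])
  also have "\<dots> = 0" using finite_stage i regular_p[OF assms i] by (auto simp: prod_zero_iff)
  finally show "res i (q m) = 0" .
qed

text \<open>The numerator \<open>u m * W (Suc m)\<close> vanishes on every component: where the leaf
  has branched off, \<open>W (Suc m)\<close> vanishes, and on the later ones \<open>u m\<close>
  does. At m = h no later leaf exists, so the factor \<open>u m\<close> is dropped.\<close>

lemma regular_next:
  assumes "regular m" "m \<le> h"
  shows "u (Suc m) \<in> \<A>" "W (Suc m) \<in> \<A>" "\<And>i. i \<in> L \<Longrightarrow> ll i < Suc m \<Longrightarrow> res i (W (Suc m)) = 0"
proof -
  have u: "u m \<in> \<A>" and W: "W m \<in> \<A>" using assms(1) by (simp_all add: regular_def)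
  note q = regular_q[OF assms(1)]
  show "W (Suc m) \<in> \<A>" unfolding W_Suc by (intro A_closed W q)
  show W0: "res i (W (Suc m)) = 0" if i: "i \<in> L" "ll i < Suc m" for i
  proof -
    have "res i (W m) = 0 \<or> res i (q m) = 0"
    proof (cases "ll i = m")
      case True
      then show ?thesis using q(2)[of i] i by (simp add: stage_def)
    next
      case False
      then show ?thesis using assms(1) i by (simp add: regular_def)
    qed
    then show ?thesis unfolding W_Suc res_hom(3)[OF W q(1) i(1)] by auto
  qed
  define v where "v = (if m < h then u m else 1)"
  have v: "v \<in> \<A>" using u A_1 by (simp add: v_def)
  have e: "x * u (Suc m) = v * W (Suc m)"
    unfolding u_Suc W_Suc v_def by (simp only: mult_ac)
  show "u (Suc m) \<in> \<A>"
  proof (rule divide_x)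
    show "x * u (Suc m) \<in> \<A>" unfolding e by (intro A_closed v \<open>W (Suc m) \<in> \<A>\<close>)
    fix i assume i: "i \<in> L"
    have "res i v = 0 \<or> res i (W (Suc m)) = 0"
    proof (cases "ll i < Suc m")
      case False
      then have "m < h" "res i (u m) = 0" using ll_le[OF i] regular_res_u[OF assms(1) i] by auto
      then show ?thesis by (simp add: v_def)
    qed (use W0 i in blast)
    then show "res i (x * u (Suc m)) = 0"
      unfolding e res_hom(3)[OF v \<open>W (Suc m) \<in> \<A>\<close> i] by auto
  qed
qed

lemma regular: "m \<le> h \<Longrightarrow> regular m"
proof (induction m)
  case 0
  have chart_u: "chart i (u 0) = fract_poly (smult (tt ^ (ll i - 0)) [:(\<sigma> i - \<sigma> i0) div tt ^ ll i, tt:])"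
    if i: "i \<in> L" for i
  proof -
    have "chart i (u 0) = fract_poly [:\<sigma> i - \<sigma> i0, tt ^ lev i:]"
      unfolding u_0 chart_simps chart_y by (simp add: map_poly_pCons)
    also have "[:\<sigma> i - \<sigma> i0, tt ^ lev i:] = smult (tt ^ (ll i - 0)) [:(\<sigma> i - \<sigma> i0) div tt ^ ll i, tt:]"
      using label_eq[OF i] by (simp add: lev_ll[OF i] mult.commute)
    finally show ?thesis .
  qed
  have st: "steep [:(\<sigma> i - \<sigma> i0) div tt ^ ll i, tt:] (cc 0) (cc 0 * \<mu> i)" for i
    unfolding steep_def
    by (intro conjI exI[of _ 1]) (simp_all add: cw_0 \<mu>_def pderiv_pCons pCons_one)
  have "u 0 \<in> \<A>" unfolding u_0 by (intro A_closed A_y A_const)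
  moreover have "chart i (W 0) = fract_poly 1" "flat 1 (ww 0)" for i
    by (simp_all add: W_0 cw_0 flat_1)
  moreover have "W 0 \<in> \<A>" unfolding W_0 by (rule A_1)
  ultimately show ?case
    unfolding regular_def using chart_u st by blast
next
  case (Suc m)
  then have m: "regular m" "m \<le> h" "m < h" by auto
  have "(\<exists>V. chart i (u (Suc m)) = fract_poly (smult (tt ^ (ll i - Suc m)) V) \<and> steep V (cc (Suc m)) (cc (Suc m) * \<mu> i)) \<and>
      (\<exists>Y. chart i (W (Suc m)) = fract_poly Y \<and> flat Y (ww (Suc m)))" if i: "i \<in> L" "Suc m \<le> ll i" for i
  proof -
    obtain V Y where V: "chart i (u m) = fract_poly (smult (tt ^ (ll i - m)) V)" "steep V (cc m) (cc m * \<mu> i)"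
      and Y: "chart i (W m) = fract_poly Y" "flat Y (ww m)"
      using m(1) i unfolding regular_def by (meson Suc_leD)
    \<comment> \<open>On a later leaf the factors of \<open>q m\<close> restrict to the nonzero
      constants - \<theta> j, so only \<open>u m\<close> supplies the power of x, which the division
      lowers by one.\<close>
    define Q where "Q = (\<Prod>j\<in>stage m. smult (tt ^ (ll i - m)) V - [:[:\<theta> j:]:])"
    have "chart i (q m) = (\<Prod>j\<in>stage m. chart i (u m) - \<kappa> (\<theta> j))"
      unfolding q_eq[symmetric] chart_prod by simp
    also have "\<dots> = (\<Prod>j\<in>stage m. fract_poly (smult (tt ^ (ll i - m)) V - [:[:\<theta> j:]:]))"
      unfolding V(1) by (simp add: map_poly_pCons)
    also have "\<dots> = fract_poly Q" unfolding Q_def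
      by (induction rule: finite_induct[OF finite_stage[of m]]) (simp_all only: prod.empty prod.insert not_False_eq_True fract_poly_1 fract_poly_mult)
    finally have Q: "chart i (q m) = fract_poly Q" .
    have "flat Q (\<Prod>j\<in>stage m. - \<theta> j)"
      unfolding Q_def by (rule flat_prod) (rule flat_of_steep[OF V(2)], use i in simp)
    then have YQ: "flat (Y * Q) (ww (Suc m))" unfolding ww_Suc by (rule flat_mult[OF Y(2)])
    have "chart i (W (Suc m)) = fract_poly (Y * Q)"
      unfolding W_Suc chart_simps Y(1) Q by (simp only: fract_poly_mult)
    moreover have "steep (V * (Y * Q)) (cc (Suc m)) (cc (Suc m) * \<mu> i)"
      using steep_flat_mult[OF V(2) YQ] by (simp add: cc_Suc mult_ac)
    moreover have "chart i (u (Suc m)) = fract_poly (smult (tt ^ (ll i - Suc m)) (V * (Y * Q)))"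
    proof -
      have k: "ll i - m = Suc (ll i - Suc m)" using i by simp
      have "x * chart i (u (Suc m)) = chart i (x * u (Suc m))" by (simp only: chart_simps)
      also have "\<dots> = fract_poly (smult (tt ^ (ll i - m)) V) * fract_poly Q * fract_poly Y"
        unfolding u_Suc using m(3) by (simp only: if_True chart_simps V(1) Q Y(1))
      also have "\<dots> = fract_poly ([:tt:] * smult (tt ^ (ll i - Suc m)) (V * (Y * Q)))"
        unfolding k by (simp only: fract_poly_mult[symmetric]) (simp add: mult_ac)
      also have "\<dots> = x * fract_poly (smult (tt ^ (ll i - Suc m)) (V * (Y * Q)))"
        by (simp only: fract_poly_mult) (simp add: map_poly_pCons)
      finally show ?thesis by (subst (asm) mult_left_cancel) auto
    qed
    ultimately show ?thesis using YQ by blast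
  qed
  then show ?case
    unfolding regular_def using regular_next[OF m(1,2)] by blast
qed

lemma u_A: "m \<le> Suc h \<Longrightarrow> u m \<in> \<A>"
  using regular regular_next(1) unfolding regular_def by (metis le_Suc_eq order_refl)

end

section \<open>Restrictions to the components of x = 0\<close>

context comb_chart
begin

lemma p_A: "i \<in> L \<Longrightarrow> p i \<in> \<A>" and res_p: "i \<in> L \<Longrightarrow> res i (p i) = 0"
  using regular_p[OF regular[OF ll_le], of i i] by (simp_all add: stage_def)

lemma q_A: "m \<le> h \<Longrightarrow> q m \<in> \<A>"
  by (rule regular_q[OF regular])

lemma res_u: "i \<in> L \<Longrightarrow> m \<le> ll i \<Longrightarrow> res i (u m) = (if m = ll i then [:\<theta> i:] else 0)"
  using regular_res_u[OF regular] ll_le[of i] by simp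

text \<open>At its own leaf, \<open>u m - \<theta> i\<close> is x K with K restricting to a
  polynomial of constant nonzero derivative \<open>cc m\<close>; the other factors of the numerator
  restrict to nonzero constants. So the restriction is a coordinate on this component.\<close>

lemma degree_res_u_Suc:
  assumes i: "i \<in> L"
  shows "degree (res i (u (Suc (ll i)))) > 0"
proof -
  define m where "m = ll i"
  have m: "m \<le> h" "regular m" using ll_le[OF i] regular by (simp_all add: m_def)
  have im: "i \<in> stage m" using i by (simp add: stage_def m_def)
  have ex: "(\<exists>V. chart i (u m) = fract_poly (smult (tt ^ (ll i - m)) V) \<and> steep V (cc m) (cc m * \<mu> i)) \<and>
      (\<exists>Y. chart i (W m) = fract_poly Y \<and> flat Y (ww m))"
  proof -
    have "m \<le> ll i" by (simp add: m_def)
    then show ?thesis using m(2) i unfolding regular_def by blast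
  qed
  then obtain V Y where V: "chart i (u m) = fract_poly V" "steep V (cc m) (\<theta> i)"
    and Y: "chart i (W m) = fract_poly Y" "flat Y (ww m)"
    by (auto simp: m_def \<theta>_def)
  obtain V' where V': "red V = [:\<theta> i:]" "pderiv V = smult tt V'" "red V' = [:cc m:]"
    using V(2) by (auto simp: steep_def)
  define S where "S = stage m - {i}"
  define H where "H = (if m < h then V else 1) * (\<Prod>j\<in>S. V - [:[:\<theta> j:]:]) * Y"
  define H0 where "H0 = (if m < h then \<theta> i else 1) * (\<Prod>j\<in>S. \<theta> i - \<theta> j) * ww m"
  have finS: "finite S" using finite_stage by (simp add: S_def)
  have "red V - [:\<theta> i:] = 0" using V' by simp
  then have "red (V - [:[:\<theta> i:]:]) = 0" by simp
  then have "[:tt:] dvd V - [:[:\<theta> i:]:]" by (simp only: red_eq_0_iff)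
  then obtain K where K: "V - [:[:\<theta> i:]:] = smult tt K" by (auto simp: dvd_def)
  have redprod: "red (\<Prod>j\<in>S. V - [:[:\<theta> j:]:]) = [:\<Prod>j\<in>S. \<theta> i - \<theta> j:]"
    by (induction rule: finite_induct[OF finS]) (simp_all add: V' pCons_one mult.commute)
  have redH: "red H = [:H0:]"
    using Y(2) by (simp add: H_def H0_def redprod V' flat_def mult_ac)
  have pV: "pderiv (V - [:[:c:]:]) = [:tt:] * V'" for c
    by (simp add: pderiv_diff pderiv_pCons V'(2))
  have dprod: "[:tt:] dvd pderiv (\<Prod>j\<in>S. V - [:[:\<theta> j:]:])"
  proof (induction rule: finite_induct[OF finS])
    case (2 j S)
    then show ?case
      unfolding prod.insert[OF 2(1,2)] pderiv_mult pV by (intro dvd_add dvd_mult dvd_mult2) simp_all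
  qed simp
  have dV: "[:tt:] dvd pderiv (if m < h then V else 1)"
  proof -
    have "pderiv V = [:tt:] * V'" using V'(2) by simp
    then have "[:tt:] dvd pderiv V" by (rule dvdI)
    then show ?thesis by simp
  qed
  have dY: "[:tt:] dvd pderiv Y"
  proof -
    obtain Y' where "pderiv Y = smult (tt ^ 2) Y'" using Y(2) by (auto simp: flat_def)
    then have "pderiv Y = [:tt:] * smult tt Y'" by (simp add: power2_eq_square)
    then show ?thesis by (rule dvdI)
  qed
  have "[:tt:] dvd pderiv H"
    unfolding H_def pderiv_mult by (intro dvd_add dvd_mult dvd_mult2 dprod dV dY)
  then have dH: "red (pderiv H) = 0" by (simp only: red_eq_0_iff)
  have "chart i (q m) = (\<Prod>j\<in>stage m. chart i (u m) - \<kappa> (\<theta> j))"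
    unfolding q_eq[symmetric] chart_prod by simp
  also have "\<dots> = (chart i (u m) - \<kappa> (\<theta> i)) * (\<Prod>j\<in>S. chart i (u m) - \<kappa> (\<theta> j))"
    unfolding S_def by (rule prod.remove[OF finite_stage im])
  also have "\<dots> = fract_poly (V - [:[:\<theta> i:]:]) * fract_poly (\<Prod>j\<in>S. V - [:[:\<theta> j:]:])"
  proof -
    have e: "chart i (u m) - \<kappa> c = fract_poly (V - [:[:c:]:])" for c
      unfolding V(1) by (simp add: map_poly_pCons)
    have "(\<Prod>j\<in>S. fract_poly (V - [:[:\<theta> j:]:])) = fract_poly (\<Prod>j\<in>S. V - [:[:\<theta> j:]:])"
      by (induction rule: finite_induct[OF finS])
        (simp_all only: prod.empty prod.insert not_False_eq_True fract_poly_1 fract_poly_mult)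
    then show ?thesis unfolding e by simp
  qed
  finally have cq: "chart i (q m) = fract_poly (smult tt K) * fract_poly (\<Prod>j\<in>S. V - [:[:\<theta> j:]:])"
    unfolding K .
  have cv: "chart i (if m < h then u m else 1) = fract_poly (if m < h then V else 1)"
    by (simp add: V(1))
  have "x * chart i (u (Suc m)) = chart i (x * u (Suc m))" by (simp only: chart_simps)
  also have "\<dots> = fract_poly ([:tt:] * (K * H))"
    unfolding u_Suc chart_simps cq cv Y(1) H_def fract_poly_mult[symmetric] by (simp add: mult_ac)
  also have "\<dots> = x * fract_poly (K * H)"
    by (simp only: fract_poly_mult) (simp add: map_poly_pCons)
  finally have "chart i (u (Suc m)) = fract_poly (K * H)" by (subst (asm) mult_left_cancel) auto
  then have r: "res i (u (Suc m)) = red (K * H)" by (rule res_eq)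
  have "smult tt (pderiv K) = smult tt V'"
    unfolding V'(2)[symmetric] pderiv_smult[symmetric] K[symmetric] by (simp add: pderiv_diff pderiv_pCons)
  then have "smult tt (pderiv K - V') = 0" by (simp add: smult_diff_right)
  then have pK: "pderiv K = V'" by simp
  have "pderiv (res i (u (Suc m))) = red (pderiv K * H + K * pderiv H)"
    unfolding r red_pderiv[symmetric] pderiv_mult by (simp only: mult_ac add_ac)
  also have "\<dots> = [:cc m * H0:]"
    by (simp add: pK V' redH dH mult.commute)
  finally have d: "pderiv (res i (u (Suc m))) = [:cc m * H0:]" .
  have "(if m < h then \<theta> i else 1) \<noteq> 0" using \<theta>_nonzero[OF i] by (simp add: m_def)
  moreover have "(\<Prod>j\<in>S. \<theta> i - \<theta> j) \<noteq> 0"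
    using finS \<theta>_inj[OF im] by (auto simp: S_def prod_zero_iff)
  ultimately have "cc m * H0 \<noteq> 0" using cw_nonzero[OF m(1)] unfolding H0_def mult_eq_0_iff by blast
  then have "pderiv (res i (u (Suc m))) \<noteq> 0" unfolding d by simp
  then show ?thesis using pderiv_eq_0_iff by (auto simp: m_def)
qed

lemma W_split: "l < m \<Longrightarrow> W m = W (Suc l) * (\<Prod>n\<in>{l<..<m}. q n)"
proof (induction m)
  case (Suc m)
  show ?case
  proof (cases "l = m")
    case True
    then have "{l<..<Suc m} = {}" by auto
    then show ?thesis using True by simp
  next
    case False
    then have "l < m" using Suc.prems by simp
    moreover from this have "{l<..<Suc m} = insert m {l<..<m}" by auto
    ultimately show ?thesis using Suc.IH by (simp add: W_Suc mult_ac)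
  qed
qed simp

text \<open>Elimination of x between the recursions for \<open>u (Suc l)\<close> and
  \<open>u (Suc m)\<close>, whose right sides share the factor \<open>W (Suc l)\<close>.\<close>

lemma u_relation:
  assumes "l < m" "l < h"
  shows "u l * u (Suc m) = (if m < h then u m else 1) * q m * u (Suc l) * (\<Prod>n\<in>{l<..<m}. q n)"
proof -
  define v where "v = (if m < h then u m else 1)"
  define P where "P = (\<Prod>n\<in>{l<..<m}. q n)"
  have 1: "x * u (Suc l) = u l * W (Suc l)"
    unfolding u_Suc W_Suc using assms(2) by (simp only: if_True mult_ac)
  have "x * (u l * u (Suc m)) = u l * (x * u (Suc m))" by (rule mult.left_commute)
  also have "\<dots> = v * q m * (u l * W (Suc l)) * P"
    unfolding u_Suc W_split[OF assms(1)] v_def P_def by (simp only: mult_ac)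
  also have "\<dots> = x * (v * q m * u (Suc l) * P)" unfolding 1[symmetric] by (simp only: mult_ac)
  finally have "u l * u (Suc m) = v * q m * u (Suc l) * P" by (subst (asm) mult_left_cancel) auto
  then show ?thesis unfolding v_def P_def .
qed

lemma res_u_relation:
  assumes i: "i \<in> L" and m: "ll i < m" "m \<le> h"
  shows "[:\<theta> i:] * res i (u (Suc m)) = (if m < h then res i (u m) else 1) * res i (q m) * res i (u (Suc (ll i))) *
    (\<Prod>n\<in>{ll i<..<m}. res i (q n))"
proof -
  have lh: "ll i < h" using m by simp
  have A: "u (ll i) \<in> \<A>" "u (Suc m) \<in> \<A>" "(if m < h then u m else 1) \<in> \<A>" "q m \<in> \<A>"
    "u (Suc (ll i)) \<in> \<A>" "(\<Prod>n\<in>{ll i<..<m}. q n) \<in> \<A>"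
    using m ll_le[OF i] by (auto intro!: u_A q_A A_1 A_prod)
  have "res i (u (ll i)) * res i (u (Suc m)) = res i (u (ll i) * u (Suc m))"
    by (simp only: res_hom A i)
  also have "\<dots> = res i (if m < h then u m else 1) * res i (q m) * res i (u (Suc (ll i))) * res i (\<Prod>n\<in>{ll i<..<m}. q n)"
    unfolding u_relation[OF m(1) lh] by (simp only: res_hom A A_closed i)
  also have "res i (\<Prod>n\<in>{ll i<..<m}. q n) = (\<Prod>n\<in>{ll i<..<m}. res i (q n))"
    using m by (intro res_prod i q_A) auto
  finally show ?thesis using res_u[OF i order_refl] by (simp add: res_1 if_distrib)
qed

lemma res_q_nonzero:
  assumes i: "i \<in> L" and m: "m \<le> h" and deg: "degree (res i (u m)) > 0"
  shows "res i (q m) \<noteq> 0"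
proof -
  have "res i (q m) = (\<Prod>j\<in>stage m. res i (p j))"
    unfolding q_def using stage_L by (intro res_prod i p_A) auto
  also have "\<dots> = (\<Prod>j\<in>stage m. res i (u m) - [:\<theta> j:])"
  proof (rule prod.cong[OF refl])
    fix j assume "j \<in> stage m"
    then show "res i (p j) = res i (u m) - [:\<theta> j:]"
      unfolding p_def using res_hom(2)[OF u_A[of m] A_const i, of "[:\<theta> j:]"] m
      by (simp add: res_const stage_ll)
  qed
  also have "\<dots> \<noteq> 0" using finite_stage deg by (auto simp: prod_zero_iff)
  finally show ?thesis .
qed

text \<open>On the component, \<open>u (ll i)\<close> is the nonzero constant \<theta> i when the
  relation is applied, so the next restriction is a nonzero polynomial times that of
  \<open>u (Suc (ll i))\<close>.\<close>

lemma degree_res_u: "i \<in> L \<Longrightarrow> ll i < m \<Longrightarrow> m \<le> Suc h \<Longrightarrow> degree (res i (u m)) > 0"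
proof (induction m rule: less_induct)
  case (less m)
  obtain k where k: "m = Suc k" using less.prems by (cases m) auto
  show ?case
  proof (cases "k = ll i")
    case True
    then show ?thesis using degree_res_u_Suc[OF less.prems(1)] k by simp
  next
    case False
    then have kk: "ll i < k" "k \<le> h" using less.prems k by auto
    have IH: "degree (res i (u n)) > 0" if "ll i < n" "n \<le> k" for n
      using less.IH[of n] less.prems(1) that k kk by simp
    have qn: "res i (q n) \<noteq> 0" if "ll i < n" "n \<le> k" for n
      using res_q_nonzero[OF less.prems(1) _ IH[OF that]] that kk by simp
    define F where "F = (if k < h then res i (u k) else 1) * res i (q k) * (\<Prod>n\<in>{ll i<..<k}. res i (q n))"
    have "(\<Prod>n\<in>{ll i<..<k}. res i (q n)) \<noteq> 0" using qn by (auto simp: prod_zero_iff)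
    moreover have "(if k < h then res i (u k) else 1) \<noteq> 0" using IH[OF kk(1)] by auto
    ultimately have F0: "F \<noteq> 0" unfolding F_def mult_eq_0_iff using qn[OF kk(1) order_refl] by blast
    have r0: "res i (u (Suc (ll i))) \<noteq> 0" and r1: "degree (res i (u (Suc (ll i)))) > 0"
      using degree_res_u_Suc[OF less.prems(1)] by auto
    have "[:\<theta> i:] * res i (u (Suc k)) = F * res i (u (Suc (ll i)))"
      unfolding res_u_relation[OF less.prems(1) kk] F_def by (simp only: mult_ac)
    then have "degree ([:\<theta> i:] * res i (u (Suc k))) = degree F + degree (res i (u (Suc (ll i))))"
      by (simp only: degree_mult_eq[OF F0 r0])
    moreover have "degree ([:\<theta> i:] * res i (u (Suc k))) \<le> degree (res i (u (Suc k)))"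
      by (simp add: degree_smult_le)
    ultimately show ?thesis using r1 k by simp
  qed
qed

text \<open>On the component of \<open>j\<close> the function \<open>u (ll i)\<close> is zero, a
  constant different from \<theta> i, or nonconstant, according to whether \<open>i\<close> leaves
  the spine before, together with, or after \<open>j\<close>.\<close>

lemma res_p_other:
  assumes i: "i \<in> L" and j: "j \<in> L" and ne: "i \<noteq> j"
  shows "res j (p i) \<noteq> 0"
proof -
  have e: "res j (p i) = res j (u (ll i)) - [:\<theta> i:]"
    unfolding p_def using res_hom(2)[OF u_A[of "ll i"] A_const j, of "[:\<theta> i:]"] ll_le[OF i]
    by (simp add: res_const)
  consider "ll i < ll j" | "ll i = ll j" | "ll j < ll i" by linarith
  then show ?thesis
  proof cases
    case 1
    then show ?thesis using e res_u[OF j, of "ll i"] \<theta>_nonzero[OF i] ll_le[OF j] by simp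
  next
    case 2
    then have "i \<in> stage (ll j)" "j \<in> stage (ll j)" using i j by (simp_all add: stage_def)
    then have "\<theta> i \<noteq> \<theta> j" using \<theta>_inj ne by blast
    then show ?thesis using e res_u[OF j, of "ll i"] 2 by simp
  next
    case 3
    then have "degree (res j (u (ll i))) > 0" using degree_res_u[OF j] ll_le[OF i] by simp
    then show ?thesis unfolding e by auto
  qed
qed

lemma W_prod: "W m = (\<Prod>i\<in>{i \<in> L. ll i < m}. p i)"
proof (induction m)
  case (Suc m)
  have "{i \<in> L. ll i < Suc m} = {i \<in> L. ll i < m} \<union> stage m" by (auto simp: stage_def)
  moreover have "(\<Prod>i\<in>{i \<in> L. ll i < m} \<union> stage m. p i) = (\<Prod>i\<in>{i \<in> L. ll i < m}. p i) * (\<Prod>i\<in>stage m. p i)"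
    using finite_L by (intro prod.union_disjoint) (auto simp: stage_def)
  ultimately show ?case using Suc by (simp add: W_Suc q_def)
qed (simp add: W_0)

lemma prod_p: "(\<Prod>i\<in>L. p i) = x * u (Suc h)"
proof -
  have "{i \<in> L. ll i < Suc h} = L" using ll_le by (auto simp: less_Suc_eq_le)
  then have "(\<Prod>i\<in>L. p i) = W (Suc h)" by (simp add: W_prod)
  also have "\<dots> = x * u (Suc h)" unfolding W_Suc u_Suc by (simp add: mult.commute)
  finally show ?thesis .
qed

lemma p_nonzero: "i \<in> L \<Longrightarrow> p i \<noteq> 0"
proof
  assume i: "i \<in> L" "p i = 0"
  then have "x * u (Suc h) = 0" unfolding prod_p[symmetric] using finite_L by (auto simp: prod_zero_iff)
  then have "u (Suc h) = 0" by simp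
  then show False using degree_res_u[OF i0, of "Suc h"] ll_i0 by (simp add: res_0)
qed

sublocale slice \<Gamma> r \<sigma> "u (Suc h)" "u h" i0 "\<theta> i0"
proof
  show "u (Suc h) \<in> \<A>" "u h \<in> \<A>" by (simp_all add: u_A)
  show "res i (u (Suc h)) \<noteq> 0" if "i \<in> L" for i
    using degree_res_u[OF that, of "Suc h"] ll_le[OF that] by auto
  show "0 < degree (res i0 (u (Suc h)))" using degree_res_u[OF i0, of "Suc h"] ll_i0 by simp
  show "res i0 (u h - \<kappa> (\<theta> i0)) = 0" using res_p[OF i0] by (simp add: p_def ll_i0)
  show "u h \<noteq> \<kappa> (\<theta> i0)" using p_nonzero[OF i0] by (simp add: p_def ll_i0)
qed (rule i0)

section \<open>Generation of the regular functions by s, z and 1/z\<close>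

lemma CA_q: "u m \<in> CA \<Longrightarrow> q m \<in> CA"
  unfolding q_eq[symmetric] by (intro CA_prod CA_diff CA_const)

text \<open>Downward induction: the relation between \<open>u m\<close> and z =
  \<open>u (Suc h)\<close> expresses their product by functions of larger index, and a factor z may
  be cancelled.\<close>

lemma CA_u: "m \<le> Suc h \<Longrightarrow> u m \<in> CA"
proof (induction "Suc h - m" arbitrary: m rule: less_induct)
  case less
  consider "m = Suc h" | "m = h" | "m < h" using less.prems by linarith
  then show ?case
  proof cases
    case 3
    have IH: "u n \<in> CA" if "m < n" "n \<le> Suc h" for n using less.hyps[of n] that by simp
    have "u m * u (Suc h) = 1 * q h * u (Suc m) * (\<Prod>n\<in>{m<..<h}. q n)"
      using u_relation[OF 3 3] by simp
    also have "\<dots> \<in> CA" using 3 by (intro CA_mult CA_1 CA_q CA_prod IH) auto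
    finally have "u (Suc h) ^ 1 * u m \<in> CA" by (simp add: mult.commute)
    then show ?thesis by (rule CA_cancel_z[OF u_A[OF less.prems]])
  qed (use CA_z CA_s in auto)
qed

lemma CA_p: "i \<in> L \<Longrightarrow> p i \<in> CA"
  unfolding p_def using ll_le[of i] by (intro CA_diff CA_u CA_const) simp

lemma CA_x: "x \<in> CA" and CA_y: "y \<in> CA"
proof -
  have "(\<Prod>i\<in>L. p i) \<in> CA" by (rule CA_prod) (rule CA_p)
  then have "u (Suc h) ^ 1 * x \<in> CA" unfolding prod_p by (simp only: power_one_right mult.commute)
  then show x: "x \<in> CA" by (rule CA_cancel_z[OF A_x])
  have "u 0 + [:to_fract (\<sigma> i0):] \<in> CA" by (intro CA_add CA_u CA_to_fract[OF x]) simp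
  then show "y \<in> CA" unfolding u_0 by (simp only: diff_add_cancel)
qed

text \<open>Modulo \<open>p i\<close>, the ring \<open>CA\<close> is generated by \<open>\<tau> = u (Suc (ll i))\<close> and \<open>1/z\<close>.\<close>

definition modp :: "'e \<Rightarrow> 'k poly fract poly set" where
  "modp i = {g. \<exists>t. \<exists>c\<in>CA. g = evp (u (Suc (ll i))) t + p i * c}"

context
  fixes i assumes i: "i \<in> L"
begin

private abbreviation "\<tau> \<equiv> u (Suc (ll i))"

lemma CA_evp: "evp \<tau> t \<in> CA"
proof (induction t)
  case (pCons a t)
  have "\<tau> \<in> CA" using ll_le[OF i] by (intro CA_u) simp
  then show ?case unfolding evp_simps by (intro CA_add CA_mult CA_const pCons.IH)
qed (simp add: evp_simps CA_0)

lemma modpI: "c \<in> CA \<Longrightarrow> g = evp \<tau> t + p i * c \<Longrightarrow> g \<in> modp i"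
  unfolding modp_def by blast

lemma modpE:
  assumes "g \<in> modp i"
  obtains t c where "c \<in> CA" "g = evp \<tau> t + p i * c"
  using assms unfolding modp_def by blast

lemma modp_add: "g \<in> modp i \<Longrightarrow> g' \<in> modp i \<Longrightarrow> g + g' \<in> modp i"
proof -
  assume "g \<in> modp i" "g' \<in> modp i"
  then obtain t c t' c' where "c \<in> CA" "g = evp \<tau> t + p i * c" "c' \<in> CA" "g' = evp \<tau> t' + p i * c'"
    by (elim modpE)
  then show ?thesis
    by (intro modpI[of "c + c'" _ "t + t'"] CA_add) (simp_all only: evp_add distrib_left add_ac)
qed

lemma modp_mult: "g \<in> modp i \<Longrightarrow> g' \<in> modp i \<Longrightarrow> g * g' \<in> modp i"
proof -
  assume "g \<in> modp i" "g' \<in> modp i"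
  then obtain t c t' c' where c: "c \<in> CA" "g = evp \<tau> t + p i * c" "c' \<in> CA" "g' = evp \<tau> t' + p i * c'"
    by (elim modpE)
  have "g * g' = evp \<tau> (t * t') + p i * (evp \<tau> t * c' + c * evp \<tau> t' + p i * c * c')"
    unfolding c(2,4) evp_mult by (simp only: distrib_left distrib_right mult_ac add_ac)
  moreover have "evp \<tau> t * c' + c * evp \<tau> t' + p i * c * c' \<in> CA"
    by (intro CA_add CA_mult CA_evp c CA_p i)
  ultimately show ?thesis by (rule modpI[rotated])
qed

lemma modp_const: "\<kappa> a \<in> modp i"
  by (rule modpI[of 0 _ "[:a:]"]) (simp_all only: CA_0 evp_const mult_zero_right add_0_right)

lemma modp_p: "c \<in> CA \<Longrightarrow> p i * c \<in> modp i"
  by (rule modpI[of c _ 0]) (simp_all only: evp_simps add_0_left)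

lemma modp_\<tau>: "\<tau> \<in> modp i"
  by (rule modpI[of 0 _ "[:0, 1:]"]) (simp_all only: CA_0 evp_var mult_zero_right add_0_right)

lemma modp_diff: "g \<in> modp i \<Longrightarrow> g' \<in> modp i \<Longrightarrow> g - g' \<in> modp i"
  using modp_add[of g "\<kappa> (- 1) * g'"] modp_mult[OF modp_const[of "- 1"], of g']
  unfolding \<kappa>_minus_one by simp

lemma modp_1: "1 \<in> modp i"
  using modp_const[of 1] unfolding danielewski.\<kappa>_one .

lemma modp_prod: "(\<And>n. n \<in> S \<Longrightarrow> f n \<in> modp i) \<Longrightarrow> prod f S \<in> modp i"
  by (induction S rule: infinite_finite_induct) (auto intro: modp_1 modp_mult)

lemma modp_q: "u m \<in> modp i \<Longrightarrow> q m \<in> modp i"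
  unfolding q_eq[symmetric] by (intro modp_prod modp_diff modp_const)

text \<open>Modulo \<open>p i\<close> the function \<open>u (ll i)\<close> is the constant \<theta>
  i, which is invertible as soon as larger indices exist; the relation then computes each
  \<open>u (Suc k)\<close> from preceding ones.\<close>

lemma modp_u: "ll i \<le> m \<Longrightarrow> m \<le> Suc h \<Longrightarrow> u m \<in> modp i"
proof (induction m rule: less_induct)
  case (less m)
  consider "m = ll i" | "m = Suc (ll i)" | k where "m = Suc k" "ll i < k"
    using less.prems by (cases m) (auto simp: le_Suc_eq less_le)
  then show ?case
  proof cases
    case 1
    have "\<kappa> (\<theta> i) + p i * 1 \<in> modp i" by (intro modp_add modp_const modp_p CA_1)
    then show ?thesis unfolding 1 by (simp add: p_def)
  next
    case 2
    then show ?thesis using modp_\<tau> by simp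
  next
    case (3 k)
    then have k: "k \<le> h" "ll i < h" using less.prems by auto
    have IH: "u n \<in> modp i" if "ll i < n" "n \<le> k" for n
      using less.IH[of n] that 3 less.prems by simp
    have "(if k < h then u k else 1) \<in> modp i" using IH[OF 3(2)] modp_1 by simp
    then have "u (ll i) * u (Suc k) \<in> modp i"
      unfolding u_relation[OF 3(2) k(2)]
      by (intro modp_mult modp_q modp_prod IH modp_\<tau>) (use 3 in auto)
    moreover have "p i * u (Suc k) \<in> modp i" using k by (intro modp_p CA_u) simp
    ultimately have "u (ll i) * u (Suc k) - p i * u (Suc k) \<in> modp i" by (rule modp_diff)
    moreover have "u (ll i) * u (Suc k) - p i * u (Suc k) = \<kappa> (\<theta> i) * u (Suc k)"
      unfolding p_def left_diff_distrib by (rule diff_diff_eq2[THEN trans]) simp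
    ultimately have "\<kappa> (\<theta> i) * u (Suc k) \<in> modp i" by simp
    then have "\<kappa> (inverse (\<theta> i)) * (\<kappa> (\<theta> i) * u (Suc k)) \<in> modp i" by (rule modp_mult[OF modp_const])
    moreover have "\<kappa> (inverse (\<theta> i)) * (\<kappa> (\<theta> i) * a) = (\<kappa> (\<theta> i) * \<kappa> (inverse (\<theta> i))) * a" for a
      by (simp only: mult_ac)
    ultimately show ?thesis
      unfolding 3(1) danielewski.\<kappa>_inverse[OF \<theta>_nonzero[OF i k(2)]] by (simp only: mult_1)
  qed
qed

lemma modp_ev: "ev G \<in> modp i"
proof -
  have z: "u (Suc h) \<in> modp i" and s: "u h \<in> modp i"
    using ll_le[OF i] by (auto intro: modp_u)
  have evz: "evp (u (Suc h)) a \<in> modp i" for a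
  proof (induction a)
    case 0
    show ?case using modp_const[of 0] unfolding evp_simps \<kappa>_hom .
  next
    case (pCons c a)
    then show ?case unfolding evp_simps by (intro modp_add modp_mult modp_const z)
  qed
  show ?thesis
  proof (induction G)
    case 0
    show ?case using modp_const[of 0] unfolding ev_simps \<kappa>_hom .
  next
    case (pCons c G)
    then show ?case unfolding ev_simps by (intro modp_add modp_mult evz s)
  qed
qed

text \<open>Write z^M g as a polynomial in \<tau> plus a multiple of \<open>p i\<close>. On the
  component \<open>p i\<close> vanishes and \<tau> is nonconstant, so the vanishing of g kills the
  polynomial.\<close>

lemma modp_division:
  assumes g: "g \<in> CA" "res i g = 0"
  obtains M c where "c \<in> CA" "u (Suc h) ^ M * g = p i * c"
proof -
  obtain M G where G: "u (Suc h) ^ M * g = ev G" using g(1) by (auto simp: CA_def)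
  obtain t c where c: "c \<in> CA" "ev G = evp \<tau> t + p i * c" using modp_ev by (rule modpE)
  have \<tau>: "\<tau> \<in> \<A>" using ll_le[OF i] by (intro u_A) simp
  have "pcompose t (res i \<tau>) = res i (evp \<tau> t) + res i (p i) * res i c"
    unfolding res_evp[OF \<tau> i] res_p[OF i] by simp
  also have "\<dots> = res i (u (Suc h) ^ M * g)"
    unfolding G c(2) using c(1) by (simp only: res_hom evp_A[OF \<tau>] A_closed p_A CA_A i)
  also have "\<dots> = 0"
    using g by (simp add: res_hom i A_power CA_A u_A)
  finally have "t = 0" using degree_res_u_Suc[OF i] by (simp add: pcompose_eq_0_iff)
  then have "u (Suc h) ^ M * g = p i * c" unfolding G c(2) by (simp add: evp_simps)
  with c(1) show ?thesis by (rule that)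
qed

end

text \<open>After division by some of the \<open>p i\<close> the quotient still vanishes on the
  component of a further leaf \<open>j\<close>, because those \<open>p i\<close> restrict there to
  nonzero elements of a domain.\<close>

lemma divide_prod:
  assumes "finite I" "I \<subseteq> L" "g \<in> CA" "\<And>i. i \<in> I \<Longrightarrow> res i g = 0"
  shows "\<exists>M c. c \<in> CA \<and> u (Suc h) ^ M * g = (\<Prod>i\<in>I. p i) * c"
  using assms
proof (induction I rule: finite_induct)
  case empty
  then show ?case by (intro exI[of _ 0] exI[of _ g]) simp
next
  case (insert j I)
  then obtain M c where c: "c \<in> CA" "u (Suc h) ^ M * g = (\<Prod>i\<in>I. p i) * c" by auto
  have j: "j \<in> L" and I: "\<And>i. i \<in> I \<Longrightarrow> i \<in> L" using insert.prems by auto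
  have PA: "(\<Prod>i\<in>I. p i) \<in> \<A>" by (rule A_prod) (rule p_A[OF I])
  have "res j (\<Prod>i\<in>I. p i) * res j c = res j (u (Suc h) ^ M * g)"
    unfolding c(2) using PA c(1) j by (simp only: res_hom CA_A)
  also have "\<dots> = 0"
    using insert.prems by (simp add: res_hom j A_power CA_A u_A)
  finally have "res j (\<Prod>i\<in>I. p i) = 0 \<or> res j c = 0" by simp
  moreover have "res j (\<Prod>i\<in>I. p i) = (\<Prod>i\<in>I. res j (p i))" by (rule res_prod[OF j]) (rule p_A[OF I])
  moreover have "(\<Prod>i\<in>I. res j (p i)) \<noteq> 0"
    using insert.hyps res_p_other[OF I j] by (auto simp: prod_zero_iff)
  ultimately have "res j c = 0" by simp
  then obtain N d where d: "d \<in> CA" "u (Suc h) ^ N * c = p j * d" using modp_division[OF j c(1)] by blast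
  have "u (Suc h) ^ (N + M) * g = u (Suc h) ^ N * (u (Suc h) ^ M * g)" by (simp only: power_add mult_ac)
  also have "\<dots> = (\<Prod>i\<in>I. p i) * (u (Suc h) ^ N * c)" unfolding c(2) by (simp only: mult_ac)
  also have "\<dots> = (\<Prod>i\<in>insert j I. p i) * d"
    unfolding d(2) using insert.hyps by (simp only: prod.insert not_False_eq_True mult_ac)
  finally show ?case using d(1) by blast
qed

text \<open>The function x a vanishes on all components, so a power of z times it is divisible by
  the product of all \<open>p i\<close>, which is x z; now x cancels.\<close>

lemma CA_divide_x:
  assumes "a \<in> \<A>" "x * a \<in> CA"
  shows "a \<in> CA"
proof -
  have "res i (x * a) = 0" if "i \<in> L" for i
    using assms(1) that by (simp only: res_hom A_x res_x mult_zero_left)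
  then obtain M c where c: "c \<in> CA" "u (Suc h) ^ M * (x * a) = (\<Prod>i\<in>L. p i) * c"
    using divide_prod[OF finite_L order_refl assms(2)] by blast
  have "x * (u (Suc h) ^ M * a) = u (Suc h) ^ M * (x * a)" by (rule mult.left_commute)
  also have "\<dots> = x * (u (Suc h) * c)" unfolding c(2) prod_p by (rule mult.assoc)
  finally have "u (Suc h) ^ M * a = u (Suc h) * c" by (subst (asm) mult_left_cancel) auto
  also have "\<dots> \<in> CA" by (intro CA_mult CA_z c)
  finally show ?thesis by (rule CA_cancel_z[OF assms(1)])
qed

lemma CA_all: "\<A> \<subseteq> CA"
proof
  fix a assume a: "a \<in> \<A>"
  obtain N G where NG: "x ^ N * a = fract_poly G" using laurent[OF a] .
  have "a \<in> CA" if "x ^ N * a \<in> CA" "a \<in> \<A>" for N a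
    using that
  proof (induction N arbitrary: a)
    case (Suc N)
    have "x ^ N * (x * a) = x ^ Suc N * a" by (simp only: power_Suc mult_ac)
    then have "x * a \<in> CA" using Suc.IH[of "x * a"] Suc.prems A_closed(3)[OF A_x Suc.prems(2)] by simp
    then show ?case by (rule CA_divide_x[OF Suc.prems(2)])
  qed simp
  moreover have "x ^ N * a \<in> CA" unfolding NG by (rule CA_fract_poly[OF CA_x CA_y])
  ultimately show "a \<in> CA" using a by blast
qed

theorem comb_lnd: "\<exists>\<delta>. lnd \<kappa> \<A> \<delta> \<and> \<delta> x \<noteq> 0"
  by (rule slice_lnd[OF CA_all])

end

section \<open>The Makar-Limanov invariant\<close>

context labelled
begin

lemma lnd_moves_x_of_comb:
  assumes comb: "comb \<Gamma> r"
  shows "\<exists>\<delta>. lnd \<kappa> \<A> \<delta> \<and> \<delta> x \<noteq> 0"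
proof -
  have "\<exists>i. i \<in> L \<and> (\<forall>j\<in>L. lev j \<le> lev i)"
  proof -
    have "lev ` L \<noteq> {}" using L_nonempty by simp
    then have "Max (lev ` L) \<in> lev ` L" using finite_L by (intro Max_in) auto
    then obtain i where "i \<in> L" "lev i = Max (lev ` L)" by auto
    then show ?thesis using finite_L by auto
  qed
  then obtain i0 where i0: "i0 \<in> L" "\<And>j. j \<in> L \<Longrightarrow> lev j \<le> lev i0" by blast
  show ?thesis
  proof (cases "lev i0")
    case 0
    \<comment> \<open>The tree is a single node and the surface is the affine plane; y serves as z
      and x as s.\<close>
    have y: "chart i0 y = fract_poly [:\<sigma> i0, 1:]" using 0 chart_y[of i0] by simp
    have root: "i = i0" if "i \<in> L" for i
    proof -
      have "i = root" if "i \<in> L" for i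
      proof (rule ccontr)
        assume "i \<noteq> root"
        then have "lev root < lev i" using level_strict_mono[OF root_le[OF leaf_in[OF that]]] by simp
        then show False using i0(2)[OF that] 0 by simp
      qed
      then show ?thesis using that i0(1) by metis
    qed
    have res_y: "res i0 y = [:poly (\<sigma> i0) 0, 1:]"
      using res_eq[OF y] by (simp add: pCons_one)
    interpret slice \<Gamma> r \<sigma> y x i0 0
    proof
      show "res i y \<noteq> 0" if "i \<in> L" for i using root[OF that] res_y by simp
      show "0 < degree (res i0 y)" using res_y by simp
      show "res i0 (x - \<kappa> 0) = 0" using res_x[of i0] by simp
      show "x \<noteq> \<kappa> 0" by simp
    qed (simp_all only: A_y A_x i0(1))
    have "\<A> \<subseteq> CA"
    proof
      fix a assume a: "a \<in> \<A>"
      then obtain q where q: "chart i0 a = fract_poly q" using i0(1) by (auto simp: \<A>_def)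
      have "pcompose (pcompose q [:- \<sigma> i0, 1:]) [:\<sigma> i0, tt ^ lev i0:] = q"
        unfolding pcompose_assoc[symmetric] 0 by (simp add: pcompose_pCons)
      then have "chart i0 a = chart i0 (fract_poly (pcompose q [:- \<sigma> i0, 1:]))"
        unfolding chart_fract_poly q by simp
      then have "a = fract_poly (pcompose q [:- \<sigma> i0, 1:])" by (rule chart_eqI[OF i0(1)])
      then show "a \<in> CA" using CA_fract_poly[OF CA_s CA_z] by metis
    qed
    then show ?thesis by (rule slice_lnd)
  next
    case (Suc h)
    have struct: "\<exists>e. i \<in> ch e \<and> e \<preceq> i0 \<and> e \<noteq> i0" if "i \<in> L" "i \<noteq> i0" for i
      using comb_leaf_structure[OF comb i0 that] by blast
    have i0_dvd: "tt ^ (lev i - 1) dvd \<sigma> i - \<sigma> i0 \<and> \<not> tt ^ lev i dvd \<sigma> i - \<sigma> i0"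
      if i: "i \<in> L" "i \<noteq> i0" for i
    proof -
      obtain e where e: "i \<in> ch e" "e \<preceq> i0" "e \<noteq> i0" using struct[OF i] by blast
      obtain c where c: "c \<in> ch e" "c \<preceq> i0" using child_above[OF e(2,3)] .
      have "i \<noteq> c" using c(2) leaf_maximal[OF i(1)] i(2) by blast
      then have "\<not> tt ^ Suc (lev e) dvd \<sigma> i - \<sigma> i0"
        using label_not_dvd[OF i0(1) i(1) c(1) e(1) _ c(2) le_refl[OF leaf_in[OF i(1)]]] by blast
      moreover have "tt ^ lev e dvd \<sigma> i - \<sigma> i0"
        using label_dvd[OF i0(1) i(1) e(2) childD(1)[OF e(1)]] .
      ultimately show ?thesis unfolding level_child[OF e(1)] by simp
    qed
    have not_dvd: "\<not> tt ^ lev i dvd \<sigma> j - \<sigma> i"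
      if i: "i \<in> L" and j: "j \<in> L" and ne: "i \<noteq> j" and lv: "lev i = lev j" for i j
    proof (cases "i = i0 \<or> j = i0")
      case True
      then show ?thesis
      proof
        assume "i = i0"
        then show ?thesis using i0_dvd[OF j] ne lv by auto
      next
        assume "j = i0"
        then have "\<not> tt ^ lev i dvd \<sigma> i - \<sigma> j" using i0_dvd[OF i] ne by auto
        then show ?thesis using dvd_minus_iff[of "tt ^ lev i" "\<sigma> i - \<sigma> j"] by simp
      qed
    next
      case False
      obtain e where e: "i \<in> ch e" "e \<preceq> i0" using struct[OF i] False by blast
      obtain e' where e': "j \<in> ch e'" "e' \<preceq> i0" using struct[OF j] False by blast
      have l: "lev e = lev e'" using lv level_child[OF e(1)] level_child[OF e'(1)] by simp
      \<comment> \<open>Both nodes lie on the spine and have the same level.\<close>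
      have "e = e'"
      proof (rule ccontr)
        assume "e \<noteq> e'"
        then have "lev e < lev e' \<or> lev e' < lev e"
          using le_linear[OF e(2) e'(2)] level_strict_mono by blast
        with l show False by simp
      qed
      then show ?thesis
        using label_not_dvd[OF i j e(1) _ ne] e'(1) le_refl leaf_in i j
        unfolding level_child[OF e(1)] by blast
    qed
    interpret comb_chart \<Gamma> r \<sigma> i0 h
    proof
      show "0 < lev i \<and> lev i \<le> Suc h" if "i \<in> L" for i
      proof (cases "i = i0")
        case False
        then show ?thesis using struct[OF that] level_child i0(2)[OF that] Suc by fastforce
      qed (simp add: Suc)
      show "tt ^ (lev i - 1) dvd \<sigma> i - \<sigma> i0" if "i \<in> L" for i
        using i0_dvd[OF that] by (cases "i = i0") simp_all
      show "\<not> tt ^ lev i dvd \<sigma> i - \<sigma> i0" if "i \<in> L" "lev i < Suc h" for i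
      proof -
        have "i \<noteq> i0" using that(2) Suc by auto
        then show ?thesis using i0_dvd[OF that(1)] by blast
      qed
    qed (use i0 Suc not_dvd in auto)
    show ?thesis by (rule comb_lnd)
  qed
qed

text \<open>The translations \<open>T\<^sub>i \<mapsto> T\<^sub>i + x\<^bsup>N - m\<^sub>i\<^esup> t\<close>.\<close>

lemma lnd_translation: "\<exists>N. lnd \<kappa> \<A> (\<lambda>F. x ^ N * pderiv F)"
proof -
  define N where "N = Max (lev ` L)"
  have N: "lev i \<le> N" if "i \<in> L" for i
    unfolding N_def using finite_L that by (intro Max_ge) auto
  have xN: "x ^ n * F = smult (X ^ n) F" for n F
    by (simp add: poly_const_pow)
  have "lnd \<kappa> \<A> (\<lambda>F. x ^ N * pderiv F)"
    unfolding lnd_def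
  proof (intro conjI ballI allI)
    fix a b assume a: "a \<in> \<A>"
    show "x ^ N * pderiv a \<in> \<A>"
      unfolding \<A>_def
    proof (intro CollectI ballI)
      fix i assume i: "i \<in> L"
      obtain q where q: "chart i a = fract_poly q" using a i by (auto simp: \<A>_def)
      have "pderiv (chart i a) = chart i (pderiv a) * [:X ^ lev i:]"
        unfolding chart_def pderiv_pcompose by (simp add: pderiv_pCons)
      moreover have "pderiv (fract_poly q) = fract_poly (pderiv q)"
      proof (rule poly_eqI)
        have "to_fract (of_nat n :: 'k poly) = of_nat n" for n by (induction n) simp_all
        then show "coeff (pderiv (fract_poly q)) n = coeff (fract_poly (pderiv q)) n" for n
          by (simp add: coeff_pderiv coeff_map_poly del: of_nat_Suc)
      qed
      ultimately have e: "chart i (pderiv a) * [:X ^ lev i:] = fract_poly (pderiv q)" using q by simp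
      have xs: "x ^ N = x ^ (N - lev i) * [:X ^ lev i:]"
        using N[OF i] by (simp add: poly_const_pow power_add[symmetric])
      have "chart i (x ^ N * pderiv a) = x ^ N * chart i (pderiv a)" by (simp only: chart_simps)
      also have "\<dots> = fract_poly ([:tt ^ (N - lev i):] * pderiv q)"
        unfolding xs fract_poly_mult e[symmetric] xpow_eq[symmetric] by (simp only: mult_ac)
      finally show "chart i (x ^ N * pderiv a) \<in> \<O>" by (simp only: rangeI)
    qed
    show "\<exists>n. ((\<lambda>F. x ^ N * pderiv F) ^^ n) a = 0"
    proof -
      have "((\<lambda>F. x ^ N * pderiv F) ^^ n) F = 0" if "degree F < n" for n F
        using that
      proof (induction n arbitrary: F)
        case (Suc n)
        have z: "((\<lambda>F. x ^ N * pderiv F) ^^ k) 0 = 0" for k by (induction k) simp_all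
        have "((\<lambda>F. x ^ N * pderiv F) ^^ Suc n) F = ((\<lambda>F. x ^ N * pderiv F) ^^ n) (x ^ N * pderiv F)"
          by (simp only: funpow_Suc_right o_apply)
        also have "\<dots> = 0"
        proof (cases "degree F = 0")
          case True
          then have "pderiv F = 0" by (auto elim: degree_eq_zeroE simp: pderiv_pCons)
          then show ?thesis by (simp only: mult_zero_right z)
        next
          case False
          have "degree (pderiv F) \<le> degree F - 1"
            using False by (intro degree_le) (auto simp: coeff_pderiv coeff_eq_0)
          then have "degree (x ^ N * pderiv F) \<le> degree F - 1"
            unfolding xN using degree_smult_le[of "X ^ N" "pderiv F"] by simp
          then show ?thesis using False Suc.prems by (intro Suc.IH) simp
        qed
        finally show ?case .
      qed simp
      then show ?thesis by blast
    qed
  next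
    fix a b
    show "x ^ N * pderiv (a + b) = x ^ N * pderiv a + x ^ N * pderiv b"
      by (simp only: pderiv_add distrib_left)
    show "x ^ N * pderiv (a * b) = x ^ N * pderiv a * b + a * (x ^ N * pderiv b)"
      by (simp only: pderiv_mult distrib_left distrib_right mult_ac add_ac)
    show "x ^ N * pderiv (\<kappa> c) = 0" for c by (simp add: pderiv_pCons)
  qed
  then show ?thesis ..
qed

text \<open>Invariance under the translations gives an element of k(x), regularity in one chart
  makes it a polynomial f(x), and a derivation moving x gives f'(x) \<delta> x = 0, so f is constant
  in characteristic zero.\<close>

lemma invariants_of_comb:
  assumes comb: "comb \<Gamma> r" and a: "a \<in> \<A>" and inv: "\<And>\<delta>. lnd \<kappa> \<A> \<delta> \<Longrightarrow> \<delta> a = 0"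
  shows "a \<in> range \<kappa>"
proof -
  obtain N where "lnd \<kappa> \<A> (\<lambda>F. x ^ N * pderiv F)" using lnd_translation ..
  then have "x ^ N * pderiv a = 0" by (rule inv)
  then have pa: "pderiv a = 0" by simp
  obtain i where i: "i \<in> L" using L_nonempty by blast
  obtain q where q: "chart i a = fract_poly q" using a i by (auto simp: \<A>_def)
  have "degree a = 0"
  proof (rule ccontr)
    assume d: "degree a \<noteq> 0"
    have "of_nat (Suc (degree a - 1)) * coeff a (Suc (degree a - 1)) = 0"
      unfolding coeff_pderiv[symmetric] pa by simp
    then have "of_nat (degree a) * lead_coeff a = 0" using d by simp
    moreover have "to_fract (of_nat n :: 'k poly) = of_nat n" for n by (induction n) simp_all
    then have "(of_nat (degree a) :: 'k poly fract) \<noteq> 0" using d by (metis of_nat_eq_0_iff to_fract_eq_0_iff)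
    ultimately show False using d by auto
  qed
  then obtain k where k: "a = [:k:]" by (rule degree_eq_zeroE)
  then have "fract_poly q = [:k:]" using q by simp
  then have "k = to_fract (coeff q 0)" by (metis coeff_map_poly coeff_pCons_0 to_fract_0)
  then have ap: "a = fract_poly [:coeff q 0:]" by (simp add: k map_poly_pCons)
  obtain \<delta> where \<delta>: "lnd \<kappa> \<A> \<delta>" "\<delta> x \<noteq> 0" using lnd_moves_x_of_comb[OF comb] by blast
  have "\<delta> a = fract_poly (Dx [:coeff q 0:]) * \<delta> x + fract_poly (pderiv [:coeff q 0:]) * \<delta> y"
    unfolding ap by (rule lnd_chain[OF \<delta>(1)])
  also have "\<dots> = fract_poly [:pderiv (coeff q 0):] * \<delta> x"
    by (simp add: Dx_pCons pderiv_pCons) (simp add: Dx_def)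
  finally have "fract_poly [:pderiv (coeff q 0):] * \<delta> x = 0" using inv[OF \<delta>(1)] by simp
  then have "fract_poly [:pderiv (coeff q 0):] = 0" using \<delta>(2) by simp
  then have "pderiv (coeff q 0) = 0" by (simp only: fract_poly_eq_0_iff) simp
  then have "degree (coeff q 0) = 0" by (simp add: pderiv_eq_0_iff)
  then obtain c where "coeff q 0 = [:c:]" by (rule degree_eq_zeroE)
  then have "a = \<kappa> c" using ap by (simp add: map_poly_pCons)
  then show ?thesis by blast
qed

lemma makar_limanov_trivial_iff_comb: "makar_limanov \<B> \<iota> = range \<iota> \<longleftrightarrow> comb \<Gamma> r"
  unfolding makar_limanov_trivial_iff
proof
  assume triv: "\<forall>a\<in>\<A>. (\<forall>\<delta>. lnd \<kappa> \<A> \<delta> \<longrightarrow> \<delta> a = 0) \<longrightarrow> a \<in> range \<kappa>"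
  have "x \<noteq> \<kappa> c" for c by simp
  then have "x \<notin> range \<kappa>" by blast
  then obtain \<delta> where "lnd \<kappa> \<A> \<delta>" "\<delta> x \<noteq> 0" using triv A_x by blast
  then show "comb \<Gamma> r" by (rule comb_if_lnd_moves_x)
qed (use invariants_of_comb in blast)

end

theorem theorem0p2:
  fixes \<Gamma> :: "'e set" and r :: "'e rel"
    and \<sigma> :: "'e \<Rightarrow> ('k :: {alg_closed_field, field_char_0}) poly"
  assumes "labelled_tree \<Gamma> r \<sigma>"
  shows "makar_limanov (danielewski_ring \<Gamma> r \<sigma>) (danielewski_const \<Gamma> r)
           = range (danielewski_const \<Gamma> r)
         \<longleftrightarrow> comb \<Gamma> r"
proof -
  interpret labelled \<Gamma> r \<sigma>
    by unfold_locales (use assms in \<open>auto simp: labelled_tree_def\<close>)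
  show ?thesis by (rule makar_limanov_trivial_iff_comb)
qed

end
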